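(* Let $$\nu=\frac{12\pi}{8\pi+3\sqrt3},$$ which satisfies $\nu<\frac54<10^{1/10}$ (i.e., $\nu$ is less than 1 dB). For all $\lambda_{\rm p}>0$ and $\delta>0$, let $\mathrm{EIR}$ denote the excess interference ratio of the Matérn hard-core process of type II with parent intensity $\lambda_{\rm p}$ and hard-core distance $\delta$. (i) For every path loss function $g:[0,\infty)\to[0,\infty)$ (measurable, with $\int_{\mathbb{R}^2}g(\|x\|)\,\mathrm{d}x<\infty$ and $\int_\delta^\infty g(r)\,r\,\mathrm{d}r>0$), $\mathrm{EIR}\le\nu$. (ii) For every power path loss law $g(r)=(\max\{r_0,r\})^{-\alpha}$ with $\alpha>2$ and $0\le r_0\le\delta$, $$\mathrm{EIR}\le\nu-\frac{\nu-1}{2^{\alpha-2}}.$$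
   Context: **Matérn process of type II.** Start from a stationary Poisson point process (PPP) on $\mathbb{R}^2$ of intensity $\lambda_{\rm p}$ (the parent process), attach to its points i.i.d. marks, uniform on $[0,1]$ and independent of the points, and delete a point if and only if there exists another point of the parent process within distance $\delta$ with a smaller mark. The resulting stationary, isotropic process $\Phi$ has intensity $$\lambda=\frac{1-\exp(-\lambda_{\rm p}\pi\delta^2)}{\pi\delta^2}.$$ **Mean interference.** For a stationary point process $\Phi\subset\mathbb{R}^2$ of intensity $\lambda$ and a radially symmetric path loss function $g(x)=g(\|x\|)\ge0$, the interference at the origin $o$ is $I=\sum_{x\in\Phi}h_xg(x)$, where the $h_x$ are nonnegative fading coefficients, independent of $\Phi$, with $\mathbb{E}(h_x)=1$. $\mathbb{E}_o^!(I)$ denotes the expectation of $I$ with respect to the reduced Palm distribution of $\Phi$ at $o$ (i.e., given that $o\in\Phi$, but not counting the contribution of $o$). With $\mathcal{K}$ the reduced second moment measure, so that $\mathcal{K}(B)$ is the mean number of points in $B$ under the reduced Palm distribution at $o$, and $K(r)=\frac1\lambda\mathcal{K}(b_o(r))$, where $b_o(r)$ is the ball of radius $r$ centered at $o$, for isotropic $\Phi$ one has $$\mathbb{E}_o^!(I)=\int_{\mathbb{R}^2}g(x)\,\mathcal{K}(\mathrm{d}x)=\lambda\int_0^\infty g(r)K'(r)\,\mathrm{d}r .$$ For the type II process, $K'(r)=2\pi\left(\frac{\lambda_{\rm p}}{\lambda}\right)^2 r\,k(r)$, where $k(r)$ is the probability that two parent points at distance $r$ are both retained: $k(r)=0$ for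 $r<\delta$ and, for $r\ge\delta$, $$k(r)=\frac{2V_\delta(r)(1-e^{-\lambda_{\rm p}\pi\delta^2})-2\pi\delta^2(1-e^{-\lambda_{\rm p}V_\delta(r)})}{\lambda_{\rm p}^2\pi\delta^2V_\delta(r)(V_\delta(r)-\pi\delta^2)}.$$ Here $V_\delta(r)$ is the area of the union of two disks of radius $\delta$ whose centers are at distance $r$: $V_\delta(r)=2\pi\delta^2-2\delta^2\arccos\left(\frac{r}{2\delta}\right)+r\sqrt{\delta^2-\frac{r^2}{4}}$ for $0\le r\le2\delta$, and $V_\delta(r)=2\pi\delta^2$ for $r>2\delta$. **Excess interference ratio (EIR).** For a stationary hard-core point process of intensity $\lambda$ with minimum distance $\delta$, $\mathrm{EIR}=\mathbb{E}_o^!(I)/\mathbb{E}_o^!(I_{\rm PPP})$, where $\mathbb{E}_o^!(I_{\rm PPP})=2\pi\lambda\int_\delta^\infty g(r)\,r\,\mathrm{d}r$ is the mean interference at $o$ in a Poisson process with intensity function $\lambda\mathbf{1}_{[\delta,\infty)}(r)$, $r=\|x\|$, with the same $\lambda$ (the intensity of the hard-core process, not of its parent). *)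

theory Defs
  imports "HOL-Probability.Probability"
begin

text \<open>
  The plane is the Euclidean space \<^typ>\<open>real \<times> real\<close>, whose library norm is
  the Euclidean one and whose \<^term>\<open>lborel\<close> is area.

  A point process is described by an enumeration of its points, a sequence of random vectors.
  Every Poisson process of positive intensity on the plane has almost surely infinitely many
  points, so no process is excluded.
\<close>

context prob_space
begin

text \<open>
  Independence of two random elements; unlike in \<^const>\<open>indep_var\<close>, their ranges may be of
  different types.
\<close>

definition indep_elements ::
    "'b measure \<Rightarrow> ('a \<Rightarrow> 'b) \<Rightarrow> 'c measure \<Rightarrow> ('a \<Rightarrow> 'c) \<Rightarrow> bool" where
  "indep_elements N Y N' Z \<longleftrightarrow>
     random_variable N Y \<and> random_variable N' Z \<and>
     indep_set {Y -` A \<inter> space M | A. A \<in> sets N} {Z -` A \<inter> space M | A. A \<in> sets N'}"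

definition poisson_process :: "real \<Rightarrow> (nat \<Rightarrow> 'a \<Rightarrow> real \<times> real) \<Rightarrow> bool" where
  "poisson_process lp X \<longleftrightarrow>
     (\<forall>n. random_variable borel (X n)) \<and>
     (AE \<omega> in M. inj (\<lambda>n. X n \<omega>)) \<and>
     (AE \<omega> in M. \<forall>r. finite {n. norm (X n \<omega>) \<le> r}) \<and>
     (\<forall>B k. B \<in> sets borel \<longrightarrow> bounded B \<longrightarrow>
        prob {\<omega> \<in> space M. card {n. X n \<omega> \<in> B} = k} =
        (lp * measure lborel B) ^ k / fact k * exp (- (lp * measure lborel B))) \<and>
     (\<forall>(m :: nat) B. (\<forall>i<m. B i \<in> sets borel \<and> bounded (B i)) \<longrightarrow> disjoint_family_on B {..<m} \<longrightarrow>
        indep_vars (\<lambda>_. count_space UNIV) (\<lambda>i \<omega>. card {n. X n \<omega> \<in> B i}) {..<m})"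

definition iid_uniform_marks ::
    "(nat \<Rightarrow> 'a \<Rightarrow> real \<times> real) \<Rightarrow> (nat \<Rightarrow> 'a \<Rightarrow> real) \<Rightarrow> bool" where
  "iid_uniform_marks X U \<longleftrightarrow>
     indep_vars (\<lambda>_. borel) U UNIV \<and>
     (\<forall>n. distr M lborel (U n) = uniform_measure lborel {0..1}) \<and>
     indep_elements (PiM UNIV (\<lambda>_. borel)) (\<lambda>\<omega> n. X n \<omega>) (PiM UNIV (\<lambda>_. borel)) (\<lambda>\<omega> n. U n \<omega>)"

end

definition retained_II :: "real \<Rightarrow> (nat \<Rightarrow> real \<times> real) \<Rightarrow> (nat \<Rightarrow> real) \<Rightarrow> nat \<Rightarrow> bool" where
  "retained_II \<delta> x u n \<longleftrightarrow> \<not> (\<exists>m. m \<noteq> n \<and> dist (x m) (x n) \<le> \<delta> \<and> u m < u n)"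

text \<open>
  A process \<open>X\<close>, \<open>U\<close> of marked parent points, together with fading coefficients:
  \<open>H n\<close> is the coefficient \<open>h\<^sub>x\<close> of the point \<open>x = X n\<close>. Each coefficient is independent of the
  thinned process, the latter given by the parent points and the indices of the retained ones;
  nothing is assumed about the joint distribution of different coefficients.
\<close>

locale matern_II = prob_space M
  for M :: "'a measure" and lp \<delta> :: real and X :: "nat \<Rightarrow> 'a \<Rightarrow> real \<times> real"
    and U H :: "nat \<Rightarrow> 'a \<Rightarrow> real" +
  assumes lp_pos: "lp > 0"
    and delta_pos: "\<delta> > 0"
    and parents: "poisson_process lp X"
    and marks: "iid_uniform_marks X U"
    and fading_nonneg: "\<And>n. AE \<omega> in M. H n \<omega> \<ge> 0"
    and fading_mean: "\<And>n. expectation (H n) = 1"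
    and fading_indep: "\<And>n. indep_elements
          (PiM UNIV (\<lambda>_. borel \<Otimes>\<^sub>M count_space UNIV))
          (\<lambda>\<omega> i. (X i \<omega>, retained_II \<delta> (\<lambda>j. X j \<omega>) (\<lambda>j. U j \<omega>) i))
          borel (H n)"

definition matern_II_points ::
    "real \<Rightarrow> (nat \<Rightarrow> 'a \<Rightarrow> real \<times> real) \<Rightarrow> (nat \<Rightarrow> 'a \<Rightarrow> real) \<Rightarrow> (nat \<Rightarrow> 'a \<Rightarrow> real)
      \<Rightarrow> 'a \<Rightarrow> ((real \<times> real) \<times> real) set" where
  "matern_II_points \<delta> X U H \<omega> =
     {(X n \<omega>, H n \<omega>) | n. retained_II \<delta> (\<lambda>j. X j \<omega>) (\<lambda>j. U j \<omega>) n}"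

text \<open>
  The following notions apply to any stationary process \<open>\<Phi>\<close> of points with fading coefficients,
  given as a random set of pairs (location, coefficient). Values are extended nonnegative reals,
  so no integrability side conditions are hidden.
\<close>

abbreviation unit_square :: "(real \<times> real) set" where
  "unit_square \<equiv> {0..1} \<times> {0..1}"

definition intensity :: "'a measure \<Rightarrow> ('a \<Rightarrow> ((real \<times> real) \<times> real) set) \<Rightarrow> ennreal" where
  "intensity M \<Phi> =
     (\<integral>\<^sup>+\<omega>. emeasure (count_space UNIV) {p \<in> \<Phi> \<omega>. fst p \<in> unit_square} \<partial>M)"

definition shift_reduce ::
    "(real \<times> real) \<Rightarrow> ((real \<times> real) \<times> real) set \<Rightarrow> ((real \<times> real) \<times> real) set" where
  "shift_reduce x \<phi> = {(y - x, h) | y h. (y, h) \<in> \<phi> \<and> y \<noteq> x}"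

text \<open>
  Expectation of \<open>F\<close> under the reduced Palm distribution of \<open>\<Phi>\<close> at the origin: by definition, the
  average of \<open>F\<close> over the configurations seen from (and excluding) each of the points of \<open>\<Phi>\<close> in a
  window of unit area. For stationary \<open>\<Phi>\<close> the window is immaterial.
\<close>

definition reduced_palm_expectation ::
    "'a measure \<Rightarrow> ('a \<Rightarrow> ((real \<times> real) \<times> real) set)
      \<Rightarrow> (((real \<times> real) \<times> real) set \<Rightarrow> ennreal) \<Rightarrow> ennreal" where
  "reduced_palm_expectation M \<Phi> F =
     (\<integral>\<^sup>+\<omega>. (\<integral>\<^sup>+p. F (shift_reduce (fst p) (\<Phi> \<omega>))
              \<partial>count_space {p \<in> \<Phi> \<omega>. fst p \<in> unit_square}) \<partial>M) / intensity M \<Phi>"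

definition interference :: "(real \<Rightarrow> real) \<Rightarrow> ((real \<times> real) \<times> real) set \<Rightarrow> ennreal" where
  "interference g \<phi> = (\<integral>\<^sup>+(x, h). ennreal (h * g (norm x)) \<partial>count_space \<phi>)"

definition mean_interference_ppp :: "ennreal \<Rightarrow> real \<Rightarrow> (real \<Rightarrow> real) \<Rightarrow> ennreal" where
  "mean_interference_ppp l \<delta> g =
     ennreal (2 * pi) * l * (\<integral>\<^sup>+r\<in>{\<delta>..}. ennreal (g r * r) \<partial>lborel)"

definition EIR ::
    "'a measure \<Rightarrow> ('a \<Rightarrow> ((real \<times> real) \<times> real) set) \<Rightarrow> real \<Rightarrow> (real \<Rightarrow> real) \<Rightarrow> ennreal" where
  "EIR M \<Phi> \<delta> g =
     reduced_palm_expectation M \<Phi> (interference g) / mean_interference_ppp (intensity M \<Phi>) \<delta> g"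

definition nu :: real where
  "nu = 12 * pi / (8 * pi + 3 * sqrt 3)"

end

theory Submission
  imports Defs
begin

text \<open>
  The interference at a typical point is a sum over pairs of retained points. Parent points are
  counted in the cells of a fine grid; counts in disjoint sets are independent, which gives a
  Mecke-type formula for pairs in two different cells once the discs excluding smaller marks
  are shrunk so as to depend only on the cells. In the limit of fine grids, a pair at distance
  \<open>r\<close> contributes at most its two-point retention probability. Writing \<open>A = \<pi> \<delta>\<^sup>2\<close> and \<open>V\<close> for the area
  of the union of the two discs, convexity of \<open>v \<mapsto> exp (- lp * A * v)\<close> on \<open>[1, 2]\<close> bounds this
  probability by \<open>2 A / V\<close> times the square of the one-point retention probability. The lens
  is largest at \<open>r = \<delta>\<close>, where \<open>2 A / V = \<nu>\<close>, and it is empty for \<open>r \<ge> 2 \<delta>\<close>, where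
  the factor is \<open>1\<close>; the power law has the fraction \<open>2\<^sup>2\<^sup>-\<^sup>\<alpha>\<close> of its mass there. For the
  denominator, only a lower bound on the intensity is needed.
\<close>

text \<open>The assumptions on the parent process give the laws of counts in fixed sets, whereas a
  disc around a point of the process is a random set. Cells make it fixed: the corner of a cell
  stands in for all its points, and the cells are cut out of the discs, so that the counts in the
  rest are independent of the points in the cells. Removing competitors can only raise a retention
  probability, so the discs shrink for the upper bound on pairs and grow for the lower bound on the
  intensity; both bounds hold at every mesh size, and their errors vanish in the limit. The
  intensity enters \<open>EIR\<close> twice, as the normalisation of the Palm average and in the
  Poisson mean, and both times it is a divisor. This is why a lower bound on it suffices: the square
  of \<open>intensity_formula\<close> cancels against the two one-point factors of the pair bound.
  The value of nu comes from V = 2 A - L with L the area of the lens. At distance \<delta>, L = (2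
  pi / 3 - sqrt 3 / 2) \<delta>^2, and 2 A / V becomes 2 pi / (4 pi / 3 + sqrt 3 / 2).\<close>

lemma borel_measurable_nn_integral_count_nat [measurable (raw)]:
  fixes f :: "nat \<Rightarrow> 'a \<Rightarrow> ennreal"
  assumes "\<And>n. f n \<in> borel_measurable M"
  shows "(\<lambda>x. \<integral>\<^sup>+n. f n x \<partial>count_space UNIV) \<in> borel_measurable M"
  using assms unfolding nn_integral_count_space_nat by measurable

lemma borel_measurable_power_nat [measurable (raw)]:
  fixes g :: "'a \<Rightarrow> real"
  assumes [measurable]: "N \<in> measurable M (count_space UNIV)" "g \<in> borel_measurable M"
  shows "(\<lambda>x. g x ^ (N x :: nat)) \<in> borel_measurable M"
  by (rule measurable_compose_countable'[where I = UNIV and f = "\<lambda>i x. g x ^ i" and g = N]) auto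

lemma nn_integral_count_space_indicator_finite:
  assumes "finite {n. x n \<in> A}"
  shows "(\<integral>\<^sup>+n. indicator A (x n) \<partial>count_space UNIV) = (of_nat (card {n. x n \<in> A}) :: ennreal)"
proof -
  have "(\<integral>\<^sup>+n. indicator A (x n) \<partial>count_space UNIV) = (\<integral>\<^sup>+n. indicator {n. x n \<in> A} n \<partial>count_space UNIV)"
    by (intro nn_integral_cong) (auto split: split_indicator)
  also have "\<dots> = emeasure (count_space UNIV) {n. x n \<in> A}"
    by (rule nn_integral_indicator) auto
  also have "\<dots> = of_nat (card {n. x n \<in> A})"
    using assms by (subst emeasure_count_space) auto
  finally show ?thesis .
qed

lemma ennreal_inverse_antimono:
  fixes a b :: ennreal
  shows "a \<le> b \<Longrightarrow> inverse b \<le> inverse a"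
  including ennreal.lifting by transfer (simp add: ereal_inverse_antimono)

lemma bounded_borel_fmeasurable:
  fixes A :: "'a::euclidean_space set"
  shows "A \<in> sets borel \<Longrightarrow> bounded A \<Longrightarrow> A \<in> fmeasurable lborel"
  by (intro fmeasurableI emeasure_bounded_finite) auto

lemma measure_disc: "0 \<le> r \<Longrightarrow> measure lborel (ball (p :: real \<times> real) r) = pi * r\<^sup>2"
  by (simp add: content_ball unit_ball_vol_2 power2_eq_square)

lemma unit_square_borel [measurable]: "unit_square \<in> sets (borel :: (real \<times> real) measure)"
  by (intro borel_closed closed_Times) auto

section \<open>Integration in the plane\<close>

lemma borel_measurable_fst_prod [measurable]:
  "(fst :: 'a::second_countable_topology \<times> 'b::second_countable_topology \<Rightarrow> 'a) \<in> borel_measurable borel"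
  by (intro borel_measurable_continuous_onI continuous_intros)

lemma borel_measurable_snd_prod [measurable]:
  "(snd :: 'a::second_countable_topology \<times> 'b::second_countable_topology \<Rightarrow> 'b) \<in> borel_measurable borel"
  by (intro borel_measurable_continuous_onI continuous_intros)

text \<open>On each horizontal line the shear is a translation, so Tonelli and one-dimensional
  translation invariance apply. Shears are the building blocks of
  \<open>nn_integral_rotation\<close>.\<close>

lemma nn_integral_shear_fst:
  fixes f :: "real \<times> real \<Rightarrow> ennreal"
  assumes [measurable]: "f \<in> borel_measurable borel"
  shows "(\<integral>\<^sup>+z. f (fst z + a * snd z, snd z) \<partial>lborel) = (\<integral>\<^sup>+z. f z \<partial>lborel)"
proof -
  have [measurable]: "f \<in> borel_measurable (lborel \<Otimes>\<^sub>M lborel)"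
    unfolding lborel_prod by simp
  have m [measurable]: "(\<lambda>z. f (fst z + a * snd z, snd z)) \<in> borel_measurable (lborel \<Otimes>\<^sub>M lborel)"
    by measurable
  have "(\<integral>\<^sup>+z. f (fst z + a * snd z, snd z) \<partial>(lborel \<Otimes>\<^sub>M lborel))
      = (\<integral>\<^sup>+y. \<integral>\<^sup>+x. f (x + a * y, y) \<partial>lborel \<partial>lborel)"
    using lborel_pair.nn_integral_snd[OF m] by simp
  also have "\<dots> = (\<integral>\<^sup>+y. \<integral>\<^sup>+x. f (x, y) \<partial>lborel \<partial>lborel)"
  proof (rule nn_integral_cong)
    fix y :: real
    show "(\<integral>\<^sup>+x. f (x + a * y, y) \<partial>lborel) = (\<integral>\<^sup>+x. f (x, y) \<partial>lborel)"
      using nn_integral_real_affine[of "\<lambda>x. f (x, y)" 1 "a * y"] by (simp add: add.commute)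
  qed
  also have "\<dots> = (\<integral>\<^sup>+z. f z \<partial>(lborel \<Otimes>\<^sub>M lborel))"
    by (simp add: lborel_pair.nn_integral_snd)
  finally show ?thesis
    by (simp add: lborel_prod)
qed

lemma nn_integral_swap_coords:
  fixes f :: "real \<times> real \<Rightarrow> ennreal"
  assumes [measurable]: "f \<in> borel_measurable borel"
  shows "(\<integral>\<^sup>+z. f (snd z, fst z) \<partial>lborel) = (\<integral>\<^sup>+z. f z \<partial>lborel)"
proof -
  have [measurable]: "f \<in> borel_measurable (lborel \<Otimes>\<^sub>M lborel)"
    unfolding lborel_prod by simp
  have m: "(\<lambda>z. f (snd z, fst z)) \<in> borel_measurable (lborel \<Otimes>\<^sub>M lborel)"
    by measurable
  have "(\<integral>\<^sup>+z. f (snd z, fst z) \<partial>(lborel \<Otimes>\<^sub>M lborel)) = (\<integral>\<^sup>+z. f z \<partial>(lborel \<Otimes>\<^sub>M lborel))"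
    using lborel_pair.nn_integral_snd[OF m] by (simp add: lborel.nn_integral_fst)
  then show ?thesis
    by (simp add: lborel_prod)
qed

lemma nn_integral_shear_snd:
  fixes f :: "real \<times> real \<Rightarrow> ennreal"
  assumes [measurable]: "f \<in> borel_measurable borel"
  shows "(\<integral>\<^sup>+z. f (fst z, snd z + a * fst z) \<partial>lborel) = (\<integral>\<^sup>+z. f z \<partial>lborel)"
  using nn_integral_shear_fst[of "\<lambda>z. f (snd z, fst z)" a]
    nn_integral_swap_coords[of "\<lambda>z. f (fst z, snd z + a * fst z)"]
  by (simp add: nn_integral_swap_coords[of f])

text \<open>
  Three shears compose to a rotation by any angle other than \<open>\<pi>\<close>; \<open>\<pi>\<close> is twice \<open>\<pi> / 2\<close>.
\<close>

lemma nn_integral_rotation: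
  fixes f :: "real \<times> real \<Rightarrow> ennreal"
  assumes [measurable]: "f \<in> borel_measurable borel" and cs: "c\<^sup>2 + s\<^sup>2 = 1"
  shows "(\<integral>\<^sup>+z. f (c * fst z - s * snd z, s * fst z + c * snd z) \<partial>lborel) = (\<integral>\<^sup>+z. f z \<partial>lborel)"
proof -
  have *: "(\<integral>\<^sup>+z. f (c * fst z - s * snd z, s * fst z + c * snd z) \<partial>lborel) = (\<integral>\<^sup>+z. f z \<partial>lborel)"
    if [measurable]: "f \<in> borel_measurable borel" and cs: "c\<^sup>2 + s\<^sup>2 = 1" and "c \<noteq> -1"
    for f :: "real \<times> real \<Rightarrow> ennreal" and c s
  proof -
    \<comment> \<open>For c = cos \<theta> and s = sin \<theta>, t is tan (\<theta> / 2). The three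
      shears have the parameters -t, s, -t, and c = -1 is exactly where t has no value.\<close>
    define t where "t = s / (1 + c)"
    have "1 + c \<noteq> 0" using that(3) by (simp add: add_eq_0_iff)
    then have t: "t * (1 + c) = s" by (simp add: t_def)
    then have st: "s * t = 1 - c"
      using cs \<open>1 + c \<noteq> 0\<close> unfolding t_def by (simp add: field_simps power2_eq_square)
    have e2: "x - t * y + - t * (y + s * (x - t * y)) = c * x - s * y"
      and e1: "y + s * (x - t * y) = s * x + c * y" for x y
    proof -
      have "y + s * (x - t * y) = s * x + (1 - s * t) * y"
        by (simp add: algebra_simps)
      then show 1: "y + s * (x - t * y) = s * x + c * y"
        unfolding st by simp
      have "x - t * y + - t * (s * x + c * y) = (1 - s * t) * x - t * (1 + c) * y"
        by (simp add: algebra_simps)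
      then show "x - t * y + - t * (y + s * (x - t * y)) = c * x - s * y"
        unfolding 1 st t by simp
    qed
    have e1': "y + s * (x + - t * y) = s * x + c * y"
      and e2': "x + - t * y + - t * (y + s * (x + - t * y)) = c * x - s * y" for x y
      using e1[of y x] e2[of x y] by simp_all
    have "(\<integral>\<^sup>+z. f z \<partial>lborel) = (\<integral>\<^sup>+z. f (fst z + (- t) * snd z, snd z) \<partial>lborel)"
      by (subst nn_integral_shear_fst) simp_all
    also have "\<dots> = (\<integral>\<^sup>+z. f (fst z + (- t) * (snd z + s * fst z), snd z + s * fst z) \<partial>lborel)"
      by (subst nn_integral_shear_snd[symmetric, where a = s]) simp_all
    also have "\<dots> = (\<integral>\<^sup>+z. f ((fst z + (- t) * snd z) + (- t) * (snd z + s * (fst z + (- t) * snd z)),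
        snd z + s * (fst z + (- t) * snd z)) \<partial>lborel)"
      by (subst nn_integral_shear_fst[symmetric, where a = "- t"]) simp_all
    also have "\<dots> = (\<integral>\<^sup>+z. f (c * fst z - s * snd z, s * fst z + c * snd z) \<partial>lborel)"
      unfolding e2' unfolding e1' ..
    finally show ?thesis by simp
  qed
  show ?thesis
  proof (cases "c = -1")
    case False
    then show ?thesis using * assms by blast
  next
    case True
    then have "s = 0" using cs by simp
    have "(\<integral>\<^sup>+z. f z \<partial>lborel) = (\<integral>\<^sup>+z. f (- snd z, fst z) \<partial>lborel)"
      using *[of f 0 1] by simp
    also have "\<dots> = (\<integral>\<^sup>+z. f (- fst z, - snd z) \<partial>lborel)"
      using *[of "\<lambda>z. f (- snd z, fst z)" 0 1] by simp
    finally show ?thesis using True \<open>s = 0\<close> by simp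
  qed
qed

text \<open>Polar coordinates by comparing distribution functions: the image of area under
  \<open>norm\<close> and the measure with density 2 pi r on the half-line both give
  \<open>{..r}\<close> the mass pi r^2 for r \<ge> 0 and 0 otherwise, and these sets generate the
  Borel sets.\<close>

lemma nn_integral_radial:
  fixes f :: "real \<Rightarrow> ennreal"
  assumes [measurable]: "f \<in> borel_measurable borel"
  shows "(\<integral>\<^sup>+z. f (norm (z :: real \<times> real)) \<partial>lborel) = (\<integral>\<^sup>+r\<in>{0..}. ennreal (2 * pi * r) * f r \<partial>lborel)"
proof -
  let ?N = "distr lborel borel (norm :: real \<times> real \<Rightarrow> real)"
  let ?D = "density lborel (\<lambda>r. ennreal (2 * pi * r) * indicator {0..} r)"
  have N: "emeasure ?N {..r} = ennreal (if 0 \<le> r then pi * r\<^sup>2 else 0)" for r :: real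
  proof -
    have "emeasure ?N {..r} = emeasure lborel (cball (0 :: real \<times> real) r)"
      by (subst emeasure_distr) (auto simp: cball_def intro!: arg_cong2[where f = emeasure])
    also have "\<dots> = ennreal (if 0 \<le> r then pi * r\<^sup>2 else 0)"
      by (cases "0 \<le> r") (auto simp: emeasure_cball unit_ball_vol_2 power2_eq_square)
    finally show ?thesis .
  qed
  have D: "emeasure ?D {..r} = ennreal (if 0 \<le> r then pi * r\<^sup>2 else 0)" for r :: real
  proof -
    have "emeasure ?D {..r} = (\<integral>\<^sup>+x. ennreal (2 * pi * x) * indicator {0..r} x \<partial>lborel)"
      by (subst emeasure_density) (auto intro!: nn_integral_cong split: split_indicator)
    also have "\<dots> = ennreal (if 0 \<le> r then pi * r\<^sup>2 else 0)"
    proof (cases "0 \<le> r")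
      case True
      have "(\<integral>\<^sup>+x. ennreal (2 * pi * x) * indicator {0..r} x \<partial>lborel) = ennreal (pi * r\<^sup>2 - pi * 0\<^sup>2)"
        by (rule nn_integral_FTC_Icc) (use True in \<open>auto intro!: derivative_eq_intros\<close>)
      then show ?thesis using True by simp
    qed (auto simp: not_le)
    finally show ?thesis .
  qed
  have "?N = ?D"
  proof (rule measure_eqI_generator_eq[where E = "range atMost" and \<Omega> = UNIV and A = "\<lambda>i. {..real i}"])
    show "Int_stable (range (atMost :: real \<Rightarrow> real set))"
      by (auto simp: Int_stable_def)
    show "(\<Union>i. {..real i}) = UNIV"
      using real_nat_ceiling_ge by (auto simp: atMost_def)
  qed (use N D in \<open>auto simp: borel_eq_atMost\<close>)
  have "(\<integral>\<^sup>+z. f (norm (z :: real \<times> real)) \<partial>lborel) = (\<integral>\<^sup>+r. f r \<partial>?N)"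
    by (subst nn_integral_distr) auto
  also have "\<dots> = (\<integral>\<^sup>+r\<in>{0..}. ennreal (2 * pi * r) * f r \<partial>lborel)"
    unfolding \<open>?N = ?D\<close> by (subst nn_integral_density) (auto simp: ac_simps)
  finally show ?thesis .
qed

section \<open>Area of the lens of two discs\<close>

text \<open>The value is the area of the segment cut off a disc of radius \<rho> by a line at
  distance \<rho> / 2 from its centre: a sector of angle 2 pi / 3 less a triangle.\<close>

lemma has_integral_chord_length:
  assumes "\<rho> > 0"
  shows "((\<lambda>x. 2 * sqrt (\<rho>\<^sup>2 - x\<^sup>2)) has_integral \<rho>\<^sup>2 * (pi / 3 - sqrt 3 / 4)) {\<rho> / 2..\<rho>}"
proof -
  let ?F = "\<lambda>x. x * sqrt (\<rho>\<^sup>2 - x\<^sup>2) + \<rho>\<^sup>2 * arcsin (x / \<rho>)"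
  have "((\<lambda>x. 2 * sqrt (\<rho>\<^sup>2 - x\<^sup>2)) has_integral ?F \<rho> - ?F (\<rho> / 2)) {\<rho> / 2..\<rho>}"
  \<comment> \<open>The interior form is used because at x = \<rho> neither \<open>sqrt\<close> nor
    \<open>arcsin\<close> is differentiable, so that only continuity is at hand there.\<close>
  proof (rule fundamental_theorem_of_calculus_interior)
    show "continuous_on {\<rho> / 2..\<rho>} ?F"
      using assms by (intro continuous_intros) (auto simp: field_simps)
    fix x assume x: "x \<in> {\<rho> / 2<..<\<rho>}"
    then have "x / \<rho> < 1" "-1 < x / \<rho>" and pos: "\<rho>\<^sup>2 - x\<^sup>2 > 0"
      using assms by (auto simp: field_simps intro!: power_strict_mono)
    have s: "sqrt (1 - (x / \<rho>)\<^sup>2) = sqrt (\<rho>\<^sup>2 - x\<^sup>2) / \<rho>"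
    proof -
      have "1 - (x / \<rho>)\<^sup>2 = (\<rho>\<^sup>2 - x\<^sup>2) / \<rho>\<^sup>2"
        using assms by (simp add: field_simps)
      then show ?thesis using assms by (simp add: real_sqrt_divide)
    qed
    have "(?F has_real_derivative
        sqrt (\<rho>\<^sup>2 - x\<^sup>2) + x * (- (2 * x) * (inverse (sqrt (\<rho>\<^sup>2 - x\<^sup>2)) / 2))
        + \<rho>\<^sup>2 * (inverse (sqrt (1 - (x / \<rho>)\<^sup>2)) * (1 / \<rho>))) (at x)"
      using \<open>x / \<rho> < 1\<close> \<open>-1 < x / \<rho>\<close> pos assms
      by (auto intro!: derivative_eq_intros simp: field_simps)
    also have "sqrt (\<rho>\<^sup>2 - x\<^sup>2) + x * (- (2 * x) * (inverse (sqrt (\<rho>\<^sup>2 - x\<^sup>2)) / 2))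
        + \<rho>\<^sup>2 * (inverse (sqrt (1 - (x / \<rho>)\<^sup>2)) * (1 / \<rho>))
        = sqrt (\<rho>\<^sup>2 - x\<^sup>2) + (\<rho>\<^sup>2 - x\<^sup>2) / sqrt (\<rho>\<^sup>2 - x\<^sup>2)"
      unfolding s using assms pos by (simp add: field_simps power2_eq_square)
    also have "\<dots> = 2 * sqrt (\<rho>\<^sup>2 - x\<^sup>2)"
      using pos by (simp add: real_div_sqrt)
    finally show "(?F has_vector_derivative 2 * sqrt (\<rho>\<^sup>2 - x\<^sup>2)) (at x)"
      by (simp add: has_real_derivative_iff_has_vector_derivative)
  qed (use assms in auto)
  also have "?F \<rho> - ?F (\<rho> / 2) = \<rho>\<^sup>2 * (pi / 3 - sqrt 3 / 4)"
  proof -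
    have "arcsin (1 / 2) = pi / 6"
      by (rule arcsin_unique) (auto simp: sin_30)
    moreover have "sqrt (\<rho>\<^sup>2 - (\<rho> / 2)\<^sup>2) = \<rho> * sqrt 3 / 2"
    proof -
      have "\<rho>\<^sup>2 - (\<rho> / 2)\<^sup>2 = (\<rho> * sqrt 3 / 2)\<^sup>2"
        by (simp add: power_divide power_mult_distrib)
      then show ?thesis
        using assms by (simp only: real_sqrt_abs) simp
    qed
    ultimately show ?thesis
      using assms by (simp add: field_simps power2_eq_square)
  qed
  finally show ?thesis .
qed

lemma emeasure_disc_segment_le:
  fixes e :: "real \<times> real"
  assumes "\<rho> > 0" "norm e = 1"
  shows "emeasure lborel {z. norm z < \<rho> \<and> \<rho> / 2 \<le> z \<bullet> e} \<le> ennreal (\<rho>\<^sup>2 * (pi / 3 - sqrt 3 / 4))"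
proof -
  obtain c s where e: "e = (c, s)" by (cases e)
  have cs: "c\<^sup>2 + s\<^sup>2 = 1"
    using assms(2) by (simp add: e norm_Pair)
  define S where "S = {z :: real \<times> real. norm z < \<rho> \<and> \<rho> / 2 \<le> fst z}"
  have [measurable]: "S \<in> sets borel"
    unfolding S_def by measurable
  \<comment> \<open>This rotation takes the first axis to the direction \<open>e\<close>, so that
    the segment becomes one cut off by a vertical line and can be integrated chord by chord.\<close>
  let ?R = "\<lambda>z. (c * fst z - s * snd z, s * fst z + c * snd z) :: real \<times> real"
  have R: "norm (?R z) = norm z" "?R z \<bullet> e = fst z" for z
  proof -
    have "(c * fst z - s * snd z)\<^sup>2 + (s * fst z + c * snd z)\<^sup>2 = (c\<^sup>2 + s\<^sup>2) * ((fst z)\<^sup>2 + (snd z)\<^sup>2)"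
      by (simp add: power2_eq_square algebra_simps)
    then show "norm (?R z) = norm z"
      by (simp add: norm_prod_def cs)
    have "?R z \<bullet> e = (c\<^sup>2 + s\<^sup>2) * fst z"
      by (simp add: e power2_eq_square algebra_simps)
    then show "?R z \<bullet> e = fst z" by (simp add: cs)
  qed
  have [measurable]: "{z. norm z < \<rho> \<and> \<rho> / 2 \<le> z \<bullet> e} \<in> sets borel"
    by measurable
  have "emeasure lborel {z. norm z < \<rho> \<and> \<rho> / 2 \<le> z \<bullet> e}
      = (\<integral>\<^sup>+z. indicator {z. norm z < \<rho> \<and> \<rho> / 2 \<le> z \<bullet> e} (?R z) \<partial>lborel)"
    by (subst nn_integral_rotation[OF _ cs]) simp_all
  also have "\<dots> = (\<integral>\<^sup>+z. indicator S z \<partial>lborel)"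
    using R by (intro nn_integral_cong) (simp add: S_def indicator_def)
  also have "\<dots> = (\<integral>\<^sup>+z. indicator S z \<partial>(lborel \<Otimes>\<^sub>M lborel))"
    by (simp add: lborel_prod)
  also have "\<dots> = (\<integral>\<^sup>+x. \<integral>\<^sup>+y. indicator S (x, y) \<partial>lborel \<partial>lborel)"
    by (subst lborel.nn_integral_fst) (auto simp: lborel_prod)
  also have "\<dots> \<le> (\<integral>\<^sup>+x. ennreal (2 * sqrt (\<rho>\<^sup>2 - x\<^sup>2)) * indicator {\<rho> / 2..\<rho>} x \<partial>lborel)"
  proof (rule nn_integral_mono)
    fix x :: real
    show "(\<integral>\<^sup>+y. indicator S (x, y) \<partial>lborel) \<le> ennreal (2 * sqrt (\<rho>\<^sup>2 - x\<^sup>2)) * indicator {\<rho> / 2..\<rho>} x"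
    proof (cases "x \<in> {\<rho> / 2..\<rho>}")
      case True
      let ?h = "sqrt (\<rho>\<^sup>2 - x\<^sup>2)"
      have "x\<^sup>2 \<le> \<rho>\<^sup>2" using True assms by (auto intro!: power_mono)
      have "(x, y) \<in> S \<Longrightarrow> y \<in> {- ?h..?h}" for y
      proof -
        assume "(x, y) \<in> S"
        then have "sqrt (x\<^sup>2 + y\<^sup>2) < \<rho>" by (simp add: S_def norm_Pair)
        then have "x\<^sup>2 + y\<^sup>2 < \<rho>\<^sup>2" by (metis assms(1) less_eq_real_def real_less_lsqrt real_sqrt_less_iff real_sqrt_unique)
        then have "\<bar>y\<bar> \<le> ?h" by (intro real_le_rsqrt) (simp add: power2_abs)
        then show ?thesis by auto
      qed
      then have "(\<integral>\<^sup>+y. indicator S (x, y) \<partial>lborel) \<le> (\<integral>\<^sup>+y. indicator {- ?h..?h} y \<partial>lborel)"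
        by (intro nn_integral_mono) (auto split: split_indicator)
      also have "\<dots> = ennreal (2 * ?h)" using \<open>x\<^sup>2 \<le> \<rho>\<^sup>2\<close> by simp
      finally show ?thesis using True by simp
    next
      case False
      have "(x, y) \<notin> S" for y
        using False norm_fst_le[of x y] by (auto simp: S_def)
      then show ?thesis by simp
    qed
  qed
  also have "\<dots> = ennreal (\<rho>\<^sup>2 * (pi / 3 - sqrt 3 / 4))"
  proof -
    have "((\<lambda>x. 2 * sqrt (\<rho>\<^sup>2 - x\<^sup>2) * indicator {\<rho> / 2..\<rho>} x) has_integral \<rho>\<^sup>2 * (pi / 3 - sqrt 3 / 4)) UNIV"
    proof -
      have "(\<lambda>x. 2 * sqrt (\<rho>\<^sup>2 - x\<^sup>2) * indicator {\<rho> / 2..\<rho>} x)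
          = (\<lambda>x. if x \<in> {\<rho> / 2..\<rho>} then 2 * sqrt (\<rho>\<^sup>2 - x\<^sup>2) else 0)"
        by (auto simp: fun_eq_iff)
      then show ?thesis
        using has_integral_chord_length[OF assms(1)] by (simp only: has_integral_restrict_UNIV)
    qed
    moreover have "0 \<le> 2 * sqrt (\<rho>\<^sup>2 - x\<^sup>2) * indicator {\<rho> / 2..\<rho>} x" for x
      using assms(1) by (auto split: split_indicator intro!: power_mono)
    ultimately have "(\<integral>\<^sup>+x. ennreal (2 * sqrt (\<rho>\<^sup>2 - x\<^sup>2) * indicator {\<rho> / 2..\<rho>} x) \<partial>lborel)
        = ennreal (\<rho>\<^sup>2 * (pi / 3 - sqrt 3 / 4))"
      by (intro nn_integral_has_integral_lborel) auto
    then show ?thesis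
      by (simp add: nn_integral_set_ennreal)
  qed
  finally show ?thesis .
qed

text \<open>The projection of z - p onto the unit vector from p to q and that of z - q onto its
  opposite add up to dist p q, which is at least \<rho>. One of them is thus at least \<rho> / 2,
  and the lens is covered by one segment of each disc. At distance \<rho> the two segments make up
  the lens, hence the constant.\<close>

lemma emeasure_lens_le:
  fixes p q :: "real \<times> real"
  assumes "\<rho> > 0" "\<rho> \<le> dist p q"
  shows "emeasure lborel (ball p \<rho> \<inter> ball q \<rho>) \<le> ennreal ((2 * pi / 3 - sqrt 3 / 2) * \<rho>\<^sup>2)"
proof -
  define d where "d = dist p q"
  define e where "e = (q - p) /\<^sub>R d"
  have d: "d \<ge> \<rho>" "d > 0" using assms by (auto simp: d_def)
  have e: "norm e = 1" using d(2) by (simp add: e_def d_def dist_norm norm_minus_commute)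
  have e': "norm (- e) = 1" using e by simp
  define S where "S e = {z :: real \<times> real. norm z < \<rho> \<and> \<rho> / 2 \<le> z \<bullet> e}" for e
  have [measurable]: "S e \<in> sets borel" for e
    unfolding S_def by measurable
  have sum: "(z - p) \<bullet> e + (z - q) \<bullet> (- e) = d" for z
  proof -
    have "(z - p) \<bullet> e + (z - q) \<bullet> (- e) = (q - p) \<bullet> e"
      by (simp add: algebra_simps inner_diff_left)
    also have "\<dots> = (norm (q - p))\<^sup>2 / d"
      by (simp add: e_def power2_norm_eq_inner divide_inverse)
    also have "\<dots> = d" using d(2) by (simp add: d_def dist_norm norm_minus_commute power2_eq_square)
    finally show ?thesis .
  qed
  have shift: "emeasure lborel {z. z - c \<in> S v} = emeasure lborel (S v)" for c v
  proof -
    have "emeasure lborel (S v) = emeasure (distr lborel borel ((+) (- c))) (S v)"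
      by (simp add: lborel_distr_plus)
    also have "\<dots> = emeasure lborel {z. z - c \<in> S v}"
      by (subst emeasure_distr) (auto simp: vimage_def)
    finally show ?thesis ..
  qed
  have [measurable]: "{z. z - c \<in> S v} \<in> sets borel" for c v
    by measurable
  have "ball p \<rho> \<inter> ball q \<rho> \<subseteq> {z. z - p \<in> S e} \<union> {z. z - q \<in> S (- e)}"
  proof
    fix z assume z: "z \<in> ball p \<rho> \<inter> ball q \<rho>"
    then show "z \<in> {z. z - p \<in> S e} \<union> {z. z - q \<in> S (- e)}"
      using sum[of z] d(1) by (auto simp: S_def dist_norm norm_minus_commute)
  qed
  then have "emeasure lborel (ball p \<rho> \<inter> ball q \<rho>)
      \<le> emeasure lborel ({z. z - p \<in> S e} \<union> {z. z - q \<in> S (- e)})"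
    by (intro emeasure_mono) auto
  also have "\<dots> \<le> emeasure lborel {z. z - p \<in> S e} + emeasure lborel {z. z - q \<in> S (- e)}"
    by (intro emeasure_subadditive) auto
  also have "\<dots> = emeasure lborel (S e) + emeasure lborel (S (- e))"
    by (simp only: shift)
  also have "\<dots> \<le> ennreal (\<rho>\<^sup>2 * (pi / 3 - sqrt 3 / 4)) + ennreal (\<rho>\<^sup>2 * (pi / 3 - sqrt 3 / 4))"
    using emeasure_disc_segment_le[OF assms(1) e] emeasure_disc_segment_le[OF assms(1) e']
    by (auto simp: S_def intro!: add_mono)
  also have "\<dots> = ennreal ((2 * pi / 3 - sqrt 3 / 2) * \<rho>\<^sup>2)"
  proof -
    have "sqrt 3 \<le> 2" by (intro real_le_lsqrt) auto
    then have "0 \<le> pi / 3 - sqrt 3 / 4" using pi_gt3 by linarith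
    then have "0 \<le> \<rho>\<^sup>2 * (pi / 3 - sqrt 3 / 4)" by simp
    then show ?thesis by (simp add: ennreal_plus[symmetric] algebra_simps del: ennreal_plus)
  qed
  finally show ?thesis .
qed

section \<open>The convexity estimate and the constant nu\<close>

text \<open>The right-hand side is the chord of v \<mapsto> p powr v between v = 1 and v = 2;
  \<open>exp\<close> is convex along the segment from ln p to 2 ln p.\<close>

lemma powr_le_chord:
  fixes p v :: real
  assumes "0 < p" "1 \<le> v" "v \<le> 2"
  shows "p powr v \<le> (2 - v) * p + (v - 1) * p\<^sup>2"
proof -
  have "exp ((1 - (v - 1)) *\<^sub>R ln p + (v - 1) *\<^sub>R (2 * ln p))
      \<le> (1 - (v - 1)) * exp (ln p) + (v - 1) * exp (2 * ln p)"
    by (rule convex_onD[OF exp_convex]) (use assms in auto)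
  moreover have "(1 - (v - 1)) *\<^sub>R ln p + (v - 1) *\<^sub>R (2 * ln p) = v * ln p"
    by (simp add: algebra_simps)
  moreover have "exp (2 * ln p) = p\<^sup>2"
    using assms by (simp add: exp_double)
  ultimately show ?thesis
    using assms by (simp add: powr_def)
qed

lemma integral_exp_linear:
  assumes "c > 0" "0 \<le> b"
  shows "(\<integral>\<^sup>+u. ennreal (exp (- (c * u))) * indicator {0..b} u \<partial>lborel) = ennreal ((1 - exp (- (c * b))) / c)"
proof -
  have "(\<integral>\<^sup>+u. ennreal (exp (- (c * u))) * indicator {0..b} u \<partial>lborel)
      = ennreal (- exp (- (c * b)) / c - - exp (- (c * 0)) / c)"
    using assms by (intro nn_integral_FTC_Icc) (auto intro!: derivative_eq_intros)
  then show ?thesis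
    by (simp add: diff_divide_distrib)
qed

text \<open>
  The integral equals \<open>2 (V (1 - e\<^sup>-\<^sup>l\<^sup>A) - A (1 - e\<^sup>-\<^sup>l\<^sup>V)) / (l\<^sup>2 A V S)\<close> with \<open>V = A + S\<close>, and the bound is
  convexity of \<open>v \<mapsto> e\<^sup>-\<^sup>l\<^sup>A\<^sup>v\<close> on \<open>[1, 2]\<close>.
\<close>

lemma nn_integral_exp_min_max_le:
  fixes l A S :: real
  assumes l: "0 < l" and S: "0 < S" "S \<le> A"
  shows "(\<integral>\<^sup>+u\<in>{0..1}. (\<integral>\<^sup>+w\<in>{0..1}. ennreal (exp (- (l * (min u w * S + max u w * A)))) \<partial>lborel) \<partial>lborel)
     \<le> ennreal (2 * A / (A + S) * ((1 - exp (- (l * A))) / (l * A))\<^sup>2)"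
proof -
  \<comment> \<open>The integrand on the triangle 0 \<le> u \<le> w \<le> 1, where min and max are u
    and w; exchanging the arguments covers the other triangle.\<close>
  define h where "h u w = ennreal (exp (- (l * (u * S + w * A)))) * (indicator {0..w} u * indicator {0..1} w)" for u w
  have A: "A > 0" using S by simp
  have [measurable]: "case_prod h \<in> borel_measurable (lborel \<Otimes>\<^sub>M lborel)"
  proof -
    have "case_prod h = (\<lambda>p. ennreal (exp (- (l * (fst p * S + snd p * A)))) *
        (indicator {p. 0 \<le> fst p \<and> fst p \<le> snd p} p * indicator {0..1} (snd p)))"
      by (auto simp: h_def fun_eq_iff split: split_indicator)
    then show ?thesis by simp
  qed
  have half: "(\<integral>\<^sup>+w. \<integral>\<^sup>+u. h u w \<partial>lborel \<partial>lborel)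
      = ennreal (((1 - exp (- (l * A))) / (l * A) - (1 - exp (- (l * (A + S)))) / (l * (A + S))) / (l * S))"
  proof -
    have "(\<integral>\<^sup>+w. \<integral>\<^sup>+u. h u w \<partial>lborel \<partial>lborel)
        = (\<integral>\<^sup>+w. ennreal ((exp (- (l * A * w)) - exp (- (l * (A + S) * w))) / (l * S)) * indicator {0..1} w \<partial>lborel)"
    proof (rule nn_integral_cong)
      fix w :: real
      show "(\<integral>\<^sup>+u. h u w \<partial>lborel)
        = ennreal ((exp (- (l * A * w)) - exp (- (l * (A + S) * w))) / (l * S)) * indicator {0..1} w"
      proof (cases "w \<in> {0..1}")
        case True
        have "(\<integral>\<^sup>+u. h u w \<partial>lborel)
            = (\<integral>\<^sup>+u. ennreal (exp (- (l * A * w))) * (ennreal (exp (- ((l * S) * u))) * indicator {0..w} u) \<partial>lborel)"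
          using True
          by (intro nn_integral_cong)
             (auto simp: h_def algebra_simps ennreal_mult[symmetric] exp_add[symmetric] split: split_indicator)
        also have "\<dots> = ennreal (exp (- (l * A * w))) * ennreal ((1 - exp (- ((l * S) * w))) / (l * S))"
          using l S True by (subst nn_integral_cmult) (auto simp: integral_exp_linear)
        also have "\<dots> = ennreal ((exp (- (l * A * w)) - exp (- (l * (A + S) * w))) / (l * S))"
        proof -
          have "exp (- (l * A * w)) * exp (- ((l * S) * w)) = exp (- (l * (A + S) * w))"
            by (simp add: exp_add[symmetric] algebra_simps)
          then have "exp (- (l * A * w)) * ((1 - exp (- ((l * S) * w))) / (l * S))
              = (exp (- (l * A * w)) - exp (- (l * (A + S) * w))) / (l * S)"
            by (simp add: right_diff_distrib)
          then show ?thesis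
            using l S True by (subst ennreal_mult'[symmetric]) auto
        qed
        finally show ?thesis using True by simp
      next
        case False
        then have "h u w = 0" for u by (simp add: h_def)
        then show ?thesis using False by simp
      qed
    qed
    also have "\<dots> = ennreal ((- exp (- (l * A * 1)) / (l * A) + exp (- (l * (A + S) * 1)) / (l * (A + S))) / (l * S)
        - (- exp (- (l * A * 0)) / (l * A) + exp (- (l * (A + S) * 0)) / (l * (A + S))) / (l * S))"
    proof (rule nn_integral_FTC_Icc)
      fix w :: real assume "w \<in> {0..1}"
      show "((\<lambda>w. (- exp (- (l * A * w)) / (l * A) + exp (- (l * (A + S) * w)) / (l * (A + S))) / (l * S))
          has_real_derivative (exp (- (l * A * w)) - exp (- (l * (A + S) * w))) / (l * S)) (at w)"
        using l S A by (auto intro!: derivative_eq_intros simp: divide_simps) (simp add: algebra_simps)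
      have "l * A * w \<le> l * (A + S) * w"
        using \<open>w \<in> {0..1}\<close> l S by (intro mult_right_mono mult_left_mono) auto
      then show "0 \<le> (exp (- (l * A * w)) - exp (- (l * (A + S) * w))) / (l * S)"
        using l S by simp
    qed auto
    also have "\<dots> = ennreal (((1 - exp (- (l * A))) / (l * A) - (1 - exp (- (l * (A + S)))) / (l * (A + S))) / (l * S))"
      by (rule arg_cong[where f = ennreal]) (simp add: diff_divide_distrib add_divide_distrib)
    finally show ?thesis .
  qed
  \<comment> \<open>Both triangles contain the diagonal, so the sum of the two halves dominates the
    integrand instead of being equal to it.\<close>
  have "(\<integral>\<^sup>+u\<in>{0..1}. (\<integral>\<^sup>+w\<in>{0..1}. ennreal (exp (- (l * (min u w * S + max u w * A)))) \<partial>lborel) \<partial>lborel)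
      \<le> (\<integral>\<^sup>+u. \<integral>\<^sup>+w. h u w + h w u \<partial>lborel \<partial>lborel)"
    by (subst nn_integral_multc[symmetric], simp, intro nn_integral_mono)
       (auto simp: h_def min_def max_def split: split_indicator)
  also have "\<dots> = (\<integral>\<^sup>+u. \<integral>\<^sup>+w. h u w \<partial>lborel \<partial>lborel) + (\<integral>\<^sup>+u. \<integral>\<^sup>+w. h w u \<partial>lborel \<partial>lborel)"
    by (simp add: nn_integral_add)
  also have "(\<integral>\<^sup>+u. \<integral>\<^sup>+w. h u w \<partial>lborel \<partial>lborel) = (\<integral>\<^sup>+w. \<integral>\<^sup>+u. h u w \<partial>lborel \<partial>lborel)"
    by (rule lborel_pair.Fubini'[symmetric]) simp
  also have "(\<integral>\<^sup>+w. \<integral>\<^sup>+u. h u w \<partial>lborel \<partial>lborel) + (\<integral>\<^sup>+w. \<integral>\<^sup>+u. h u w \<partial>lborel \<partial>lborel)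
      = ennreal (2 * (((1 - exp (- (l * A))) / (l * A) - (1 - exp (- (l * (A + S)))) / (l * (A + S))) / (l * S)))"
    unfolding half mult_2[symmetric] by (subst ennreal_mult'[of 2, simplified]) simp_all
  also have "\<dots> \<le> ennreal (2 * A / (A + S) * ((1 - exp (- (l * A))) / (l * A))\<^sup>2)"
  proof (rule ennreal_leI)
    define p where "p = exp (- (l * A))"
    define q where "q = exp (- (l * (A + S)))"
    \<comment> \<open>\<open>A\<close> stands for the area of a disc, \<open>S\<close> for a disc
      less the lens, \<open>A + S\<close> for the union. The chord bound at v shows that the
      numerator is at most \<open>S * (1 - p)\<^sup>2\<close>; its factor S cancels that of the
      denominator and leaves the square of the one-point factor.\<close>
    define v where "v = (A + S) / A"
    have v: "1 \<le> v" "v \<le> 2" using S A by (auto simp: v_def field_simps)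
    have "q = p powr v"
      using A by (simp add: p_def q_def powr_def v_def)
    then have "q \<le> (2 - v) * p + (v - 1) * p\<^sup>2"
      using powr_le_chord[of p v] v by (simp add: p_def)
    then have "A * q \<le> A * ((2 - v) * p + (v - 1) * p\<^sup>2)"
      using A by simp
    also have "\<dots> = (A - S) * p + S * p\<^sup>2"
      using A by (simp add: v_def field_simps)
    finally have "(A + S) * (1 - p) - A * (1 - q) \<le> S * (1 - p)\<^sup>2"
      by (simp add: algebra_simps power2_eq_square)
    then have "2 * ((A + S) * (1 - p) - A * (1 - q)) / (l\<^sup>2 * A * (A + S) * S)
        \<le> 2 * (S * (1 - p)\<^sup>2) / (l\<^sup>2 * A * (A + S) * S)"
      using l A S by (intro divide_right_mono mult_left_mono) auto
    also have "2 * (S * (1 - p)\<^sup>2) / (l\<^sup>2 * A * (A + S) * S) = 2 * A / (A + S) * ((1 - p) / (l * A))\<^sup>2"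
      using l A S by (simp add: power2_eq_square divide_simps)
    also have "2 * ((A + S) * (1 - p) - A * (1 - q)) / (l\<^sup>2 * A * (A + S) * S)
        = 2 * (((1 - p) / (l * A) - (1 - q) / (l * (A + S))) / (l * S))"
      using l A S by (simp add: power2_eq_square divide_simps)
    finally show "2 * (((1 - exp (- (l * A))) / (l * A) - (1 - exp (- (l * (A + S)))) / (l * (A + S))) / (l * S))
        \<le> 2 * A / (A + S) * ((1 - exp (- (l * A))) / (l * A))\<^sup>2"
      by (simp add: p_def q_def)
  qed
  finally show ?thesis .
qed

lemma nu_less: "nu < 5 / 4"
proof -
  \<comment> \<open>The claim amounts to 8 pi < 15 sqrt 3; with the two rational bounds this is
    25.136 < 25.95.\<close>
  have "173 / 100 < sqrt (3 :: real)" by (rule real_less_rsqrt) (simp add: power2_eq_square)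
  moreover have "pi < 3142 / 1000" using pi_approx by simp
  ultimately have "8 * pi < 15 * sqrt 3" by linarith
  moreover have "8 * pi + 3 * sqrt 3 > 0" by (simp add: add_pos_pos)
  ultimately show ?thesis by (simp add: nu_def field_simps)
qed

lemma nu_ge_1: "1 \<le> nu"
proof -
  have "sqrt 3 \<le> (2 :: real)" by (intro real_le_lsqrt) auto
  then have "8 * pi + 3 * sqrt 3 \<le> 12 * pi" using pi_gt3 by linarith
  moreover have "8 * pi + 3 * sqrt 3 > 0" by (simp add: add_pos_pos)
  ultimately show ?thesis by (simp add: nu_def)
qed

lemma five_quarters_less: "(5 / 4 :: real) < 10 powr (1 / 10)"
proof -
  \<comment> \<open>(5 / 4)^10 is about 9.31.\<close>
  have "(5 / 4 :: real) = ((5 / 4) powr 10) powr (1 / 10)"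
    unfolding powr_powr by simp
  also have "\<dots> < 10 powr (1 / 10)"
    by (rule powr_less_mono2) (simp_all add: field_simps)
  finally show ?thesis .
qed

section \<open>Marks and counts\<close>

abbreviation point_count :: "(nat \<Rightarrow> 'a \<Rightarrow> real \<times> real) \<Rightarrow> (real \<times> real) set \<Rightarrow> 'a \<Rightarrow> nat" where
  "point_count X B \<omega> \<equiv> card {n. X n \<omega> \<in> B}"

context prob_space
begin

text \<open>Independence makes the joint law the product of the two laws, which are compared on
  rectangles; the second element is then averaged over a separate sample point. In this way marks
  are integrated out over a frozen point configuration, and fading over a frozen thinned
  process.\<close>

lemma indep_elements_nn_integral:
  assumes YZ: "indep_elements N Y N' Z"
    and F [measurable]: "case_prod F \<in> borel_measurable (N \<Otimes>\<^sub>M N')"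
  shows "(\<integral>\<^sup>+\<omega>. F (Y \<omega>) (Z \<omega>) \<partial>M) = (\<integral>\<^sup>+\<omega>. \<integral>\<^sup>+\<omega>'. F (Y \<omega>) (Z \<omega>') \<partial>M \<partial>M)"
proof -
  have [measurable]: "random_variable N Y" "random_variable N' Z"
    using YZ by (auto simp: indep_elements_def)
  interpret Y: prob_space "distr M N Y" by (rule prob_space_distr) simp
  interpret Z: prob_space "distr M N' Z" by (rule prob_space_distr) simp
  have eq: "distr M N Y \<Otimes>\<^sub>M distr M N' Z = distr M (N \<Otimes>\<^sub>M N') (\<lambda>\<omega>. (Y \<omega>, Z \<omega>))"
  proof (rule pair_measure_eqI)
    fix A B assume AB: "A \<in> sets (distr M N Y)" "B \<in> sets (distr M N' Z)"
    then have [measurable]: "A \<in> sets N" "B \<in> sets N'" by simp_all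
    have "prob ((Y -` A \<inter> space M) \<inter> (Z -` B \<inter> space M))
        = prob (Y -` A \<inter> space M) * prob (Z -` B \<inter> space M)"
      using YZ AB unfolding indep_elements_def by (intro indep_setD) auto
    moreover have "(\<lambda>\<omega>. (Y \<omega>, Z \<omega>)) -` (A \<times> B) \<inter> space M = (Y -` A \<inter> space M) \<inter> (Z -` B \<inter> space M)"
      by auto
    ultimately show "emeasure (distr M N Y) A * emeasure (distr M N' Z) B
        = emeasure (distr M (N \<Otimes>\<^sub>M N') (\<lambda>\<omega>. (Y \<omega>, Z \<omega>))) (A \<times> B)"
      by (simp add: emeasure_distr emeasure_eq_measure ennreal_mult[symmetric])
  qed (auto intro: Y.sigma_finite_measure_axioms Z.sigma_finite_measure_axioms)
  have "(\<integral>\<^sup>+\<omega>. F (Y \<omega>) (Z \<omega>) \<partial>M) = (\<integral>\<^sup>+p. case_prod F p \<partial>distr M (N \<Otimes>\<^sub>M N') (\<lambda>\<omega>. (Y \<omega>, Z \<omega>)))"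
    by (subst nn_integral_distr) auto
  also have "\<dots> = (\<integral>\<^sup>+y. \<integral>\<^sup>+z. F y z \<partial>distr M N' Z \<partial>distr M N Y)"
    unfolding eq[symmetric] by (subst Z.nn_integral_fst[symmetric]) auto
  also have "\<dots> = (\<integral>\<^sup>+\<omega>. \<integral>\<^sup>+z. F (Y \<omega>) z \<partial>distr M N' Z \<partial>M)"
    by (subst nn_integral_distr) auto
  also have "\<dots> = (\<integral>\<^sup>+\<omega>. \<integral>\<^sup>+\<omega>'. F (Y \<omega>) (Z \<omega>') \<partial>M \<partial>M)"
  proof (rule nn_integral_cong)
    fix \<omega> assume "\<omega> \<in> space M"
    then have "Y \<omega> \<in> space N" by (rule measurable_space[rotated]) simp
    then show "(\<integral>\<^sup>+z. F (Y \<omega>) z \<partial>distr M N' Z) = (\<integral>\<^sup>+\<omega>'. F (Y \<omega>) (Z \<omega>') \<partial>M)"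
      by (subst nn_integral_distr) auto
  qed
  finally show ?thesis .
qed

text \<open>On the right-hand side, \<open>u\<close> and \<open>w\<close> are the values of \<open>U n\<close> and \<open>U m\<close>.\<close>

lemma iid_uniform_two_minima:
  fixes U :: "'i \<Rightarrow> 'a \<Rightarrow> real"
  assumes indep: "indep_vars (\<lambda>_. borel) U UNIV"
    and unif: "\<And>i. distr M lborel (U i) = uniform_measure lborel {0..1}"
    and fin: "finite Sn" "finite Sm" and nm: "n \<noteq> m" "n \<notin> Sn \<union> Sm" "m \<notin> Sn \<union> Sm"
  shows "emeasure M {\<omega> \<in> space M. (\<forall>i\<in>Sn. U n \<omega> \<le> U i \<omega>) \<and> (\<forall>i\<in>Sm. U m \<omega> \<le> U i \<omega>)} =
    (\<integral>\<^sup>+u\<in>{0..1}. (\<integral>\<^sup>+w\<in>{0..1}. ennreal ((1 - u) ^ card (Sn - Sm) * (1 - w) ^ card (Sm - Sn) *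
       (1 - max u w) ^ card (Sn \<inter> Sm)) \<partial>lborel) \<partial>lborel)"
proof -
  define \<nu> where "\<nu> = uniform_measure lborel {0..1::real}"
  have [measurable_cong, simp]: "sets \<nu> = sets borel" by (simp add: \<nu>_def)
  have space_\<nu> [simp]: "space \<nu> = UNIV" by (simp add: \<nu>_def)
  interpret \<nu>: prob_space \<nu> unfolding \<nu>_def by (rule prob_space_uniform_measure) auto
  have int_\<nu>: "(\<integral>\<^sup>+v. f v \<partial>\<nu>) = (\<integral>\<^sup>+v\<in>{0..1}. f v \<partial>lborel)" if "f \<in> borel_measurable borel" for f
    unfolding \<nu>_def using that by (subst nn_integral_uniform_measure) (auto simp: divide_ennreal_def)
  have U [measurable]: "random_variable borel (U i)" for i
    using indep by (auto simp: indep_vars_def)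
  have distr_U: "distr M borel (U i) = \<nu>" for i
    unfolding \<nu>_def unif[symmetric, of i] by (rule distr_cong) auto
  define S where "S = Sn \<union> Sm"
  define J where "J = insert n (insert m S)"
  have J: "finite J" "J \<noteq> {}" "finite S" using fin by (auto simp: J_def S_def)
  have "indep_vars (\<lambda>_. borel) U J"
    using indep by (rule indep_vars_subset) simp
  then have PiM: "distr M (\<Pi>\<^sub>M i\<in>J. borel) (\<lambda>\<omega>. \<lambda>i\<in>J. U i \<omega>) = (\<Pi>\<^sub>M i\<in>J. \<nu>)"
    using indep_vars_iff_distr_eq_PiM[where I = J and X = U and M' = "\<lambda>_. borel"] J by (simp add: distr_U)
  interpret product_sigma_finite "\<lambda>_ :: 'i. \<nu>" ..
  \<comment> \<open>The factor contributed by index i when n has mark u and m has mark w. It splits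
    the event into one condition per remaining mark, so that the product measure can be integrated
    factor by factor.\<close>
  define g where "g i u w v = (indicator {v. (i \<in> Sn \<longrightarrow> u \<le> v) \<and> (i \<in> Sm \<longrightarrow> w \<le> v)} v :: ennreal)" for i and u w v :: real
  have [measurable]: "(\<lambda>x. g i (a x) (b x) (c x)) \<in> borel_measurable L"
    if [measurable]: "a \<in> borel_measurable L" "b \<in> borel_measurable L" "c \<in> borel_measurable L"
    for i a b c and L :: "'b measure"
    unfolding g_def by simp
  have "emeasure M {\<omega> \<in> space M. (\<forall>i\<in>Sn. U n \<omega> \<le> U i \<omega>) \<and> (\<forall>i\<in>Sm. U m \<omega> \<le> U i \<omega>)}
      = (\<integral>\<^sup>+\<omega>. indicator {\<omega> \<in> space M. (\<forall>i\<in>Sn. U n \<omega> \<le> U i \<omega>) \<and> (\<forall>i\<in>Sm. U m \<omega> \<le> U i \<omega>)} \<omega> \<partial>M)"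
    using fin by (intro nn_integral_indicator[symmetric] sets.sets_Collect_conj sets.sets_Collect_finite_All) auto
  also have "\<dots> = (\<integral>\<^sup>+\<omega>. (\<Prod>i\<in>S. g i (U n \<omega>) (U m \<omega>) (U i \<omega>)) \<partial>M)"
  proof (rule nn_integral_cong)
    fix \<omega> assume "\<omega> \<in> space M"
    then show "indicator {\<omega> \<in> space M. (\<forall>i\<in>Sn. U n \<omega> \<le> U i \<omega>) \<and> (\<forall>i\<in>Sm. U m \<omega> \<le> U i \<omega>)} \<omega>
        = (\<Prod>i\<in>S. g i (U n \<omega>) (U m \<omega>) (U i \<omega>))"
      using \<open>finite S\<close> by (auto simp: S_def g_def indicator_def prod_zero_iff)
  qed
  also have "\<dots> = (\<integral>\<^sup>+x. (\<Prod>i\<in>S. g i (x n) (x m) (x i)) \<partial>distr M (\<Pi>\<^sub>M i\<in>J. borel) (\<lambda>\<omega>. \<lambda>i\<in>J. U i \<omega>))"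
    by (subst nn_integral_distr) (auto simp: J_def intro!: nn_integral_cong prod.cong)
  \<comment> \<open>The coordinates n and m are split off the product measure as the two outer
    integrals; \<open>nm\<close> keeps them distinct and outside S.\<close>
  also have "\<dots> = (\<integral>\<^sup>+u. \<integral>\<^sup>+w. \<integral>\<^sup>+x. (\<Prod>i\<in>S. g i u w (x i)) \<partial>(\<Pi>\<^sub>M i\<in>S. \<nu>) \<partial>\<nu> \<partial>\<nu>)"
    unfolding PiM unfolding J_def using nm J
    apply (subst product_nn_integral_insert_rev)
       apply (auto simp: S_def)[3]
    apply (subst product_nn_integral_insert_rev)
       apply (auto simp: S_def)[3]
    apply (intro nn_integral_cong prod.cong)
    apply (auto simp: S_def)
    done
  also have "\<dots> = (\<integral>\<^sup>+u. \<integral>\<^sup>+w. (\<Prod>i\<in>S. \<integral>\<^sup>+v. g i u w v \<partial>\<nu>) \<partial>\<nu> \<partial>\<nu>)"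
    using J by (subst product_nn_integral_prod) auto
  also have "\<dots> = (\<integral>\<^sup>+u\<in>{0..1}. (\<integral>\<^sup>+w\<in>{0..1}. (\<Prod>i\<in>S. \<integral>\<^sup>+v. g i u w v \<partial>\<nu>) \<partial>lborel) \<partial>lborel)"
    by (subst int_\<nu>, measurable)+
  also have "\<dots> = (\<integral>\<^sup>+u\<in>{0..1}. (\<integral>\<^sup>+w\<in>{0..1}. ennreal ((1 - u) ^ card (Sn - Sm) * (1 - w) ^ card (Sm - Sn) *
       (1 - max u w) ^ card (Sn \<inter> Sm)) \<partial>lborel) \<partial>lborel)"
  proof -
    \<comment> \<open>A mark compared with u only, with w only, or with both passes with probability
      1 - u, 1 - w or 1 - max u w; the index set is cut into the three corresponding parts.\<close>
    have "(\<Prod>i\<in>S. \<integral>\<^sup>+v. g i u w v \<partial>\<nu>) = ennreal ((1 - u) ^ card (Sn - Sm) * (1 - w) ^ card (Sm - Sn) *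
       (1 - max u w) ^ card (Sn \<inter> Sm))" if "u \<in> {0..1}" "w \<in> {0..1}" for u w
    proof -
      have above: "(\<integral>\<^sup>+v. indicator {a..} v \<partial>\<nu>) = ennreal (1 - a)" if "a \<in> {0..1}" for a :: real
      proof -
        have "(\<integral>\<^sup>+v. indicator {a..} v \<partial>\<nu>) = (\<integral>\<^sup>+v\<in>{0..1}. indicator {a..} v \<partial>lborel)"
          by (rule int_\<nu>) simp
        also have "\<dots> = (\<integral>\<^sup>+v. indicator {a..1} v \<partial>lborel)"
          using that by (intro nn_integral_cong) (auto split: split_indicator)
        finally have "(\<integral>\<^sup>+v. indicator {a..} v \<partial>\<nu>) = emeasure lborel {a..1}"
          by simp
        then show ?thesis using that by simp
      qed
      have "prod f S = prod f (Sn - Sm) * (prod f (Sm - Sn) * prod f (Sn \<inter> Sm))" for f :: "'i \<Rightarrow> ennreal"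
      proof -
        have "prod f ((Sn - Sm) \<union> Sm) = prod f (Sn - Sm) * prod f Sm"
          using fin by (intro prod.union_disjoint) auto
        moreover have "prod f ((Sm - Sn) \<union> (Sn \<inter> Sm)) = prod f (Sm - Sn) * prod f (Sn \<inter> Sm)"
          using fin by (intro prod.union_disjoint) auto
        moreover have "(Sn - Sm) \<union> Sm = S" "(Sm - Sn) \<union> (Sn \<inter> Sm) = Sm"
          by (auto simp: S_def)
        ultimately show ?thesis by simp
      qed
      then have "(\<Prod>i\<in>S. \<integral>\<^sup>+v. g i u w v \<partial>\<nu>) = (\<Prod>i\<in>Sn - Sm. \<integral>\<^sup>+v. g i u w v \<partial>\<nu>) *
          ((\<Prod>i\<in>Sm - Sn. \<integral>\<^sup>+v. g i u w v \<partial>\<nu>) * (\<Prod>i\<in>Sn \<inter> Sm. \<integral>\<^sup>+v. g i u w v \<partial>\<nu>))" .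
      also have "(\<Prod>i\<in>Sn - Sm. \<integral>\<^sup>+v. g i u w v \<partial>\<nu>) = (\<Prod>i\<in>Sn - Sm. ennreal (1 - u))"
        using above[OF that(1)] by (intro prod.cong) (auto simp: g_def atLeast_def)
      also have "(\<Prod>i\<in>Sm - Sn. \<integral>\<^sup>+v. g i u w v \<partial>\<nu>) = (\<Prod>i\<in>Sm - Sn. ennreal (1 - w))"
        using above[OF that(2)] by (intro prod.cong) (auto simp: g_def atLeast_def)
      also have "(\<Prod>i\<in>Sn \<inter> Sm. \<integral>\<^sup>+v. g i u w v \<partial>\<nu>) = (\<Prod>i\<in>Sn \<inter> Sm. ennreal (1 - max u w))"
      proof (intro prod.cong refl)
        fix i assume "i \<in> Sn \<inter> Sm"
        then have "g i u w v = indicator {max u w..} v" for v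
          by (auto simp: g_def split: split_indicator)
        then show "(\<integral>\<^sup>+v. g i u w v \<partial>\<nu>) = ennreal (1 - max u w)"
          using above[of "max u w"] that by (simp add: le_max_iff_disj)
      qed
      finally show ?thesis
        using that by (simp add: ennreal_power ennreal_mult[symmetric] mult.assoc)
    qed
    then show ?thesis
      by (intro nn_integral_cong) (auto split: split_indicator intro!: nn_integral_cong)
  qed
  finally show ?thesis .
qed


text \<open>The case of an empty second set of competitors. The second index can be any index
  outside \<open>insert n S\<close>, and its mark integrates to 1.\<close>

lemma iid_uniform_minimum:
  fixes U :: "nat \<Rightarrow> 'a \<Rightarrow> real"
  assumes indep: "indep_vars (\<lambda>_. borel) U UNIV"
    and unif: "\<And>i. distr M lborel (U i) = uniform_measure lborel {0..1}"
    and "finite S" "n \<notin> S"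
  shows "emeasure M {\<omega> \<in> space M. \<forall>i\<in>S. U n \<omega> \<le> U i \<omega>} =
    (\<integral>\<^sup>+u\<in>{0..1}. ennreal ((1 - u) ^ card S) \<partial>lborel)"
proof -
  obtain m where m: "m \<notin> insert n S"
    using ex_new_if_finite[of "insert n S"] assms by auto
  have "(\<integral>\<^sup>+w\<in>{0..1::real}. ennreal ((1 - u) ^ card S) \<partial>lborel) = ennreal ((1 - u) ^ card S)" for u :: real
    by (subst nn_integral_cmult) auto
  then show ?thesis
    using iid_uniform_two_minima[OF indep unif, of S "{}" n m] m assms by auto
qed

text \<open>Each of the two inequalities has probability 1 / 2 and together they cover the whole
  space, so inclusion-exclusion leaves nothing for the overlap.\<close>

lemma iid_uniform_tie:
  fixes U :: "nat \<Rightarrow> 'a \<Rightarrow> real"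
  assumes indep: "indep_vars (\<lambda>_. borel) U UNIV"
    and unif: "\<And>i. distr M lborel (U i) = uniform_measure lborel {0..1}"
    and "n \<noteq> m"
  shows "emeasure M {\<omega> \<in> space M. U n \<omega> \<le> U m \<omega> \<and> U m \<omega> \<le> U n \<omega>} = 0"
proof -
  have U [measurable]: "random_variable borel (U i)" for i
    using indep by (auto simp: indep_vars_def)
  have half: "prob {\<omega> \<in> space M. U n \<omega> \<le> U m \<omega>} = 1 / 2" if "n \<noteq> m" for n m
  proof -
    have "(\<integral>\<^sup>+u\<in>{0..1}. ennreal (1 - u) \<partial>lborel) = ennreal ((1 - 1\<^sup>2 / 2) - (0 - 0\<^sup>2 / 2))"
      by (rule nn_integral_FTC_Icc) (auto intro!: derivative_eq_intros)
    moreover have "emeasure M {\<omega> \<in> space M. U n \<omega> \<le> U m \<omega>} = (\<integral>\<^sup>+u\<in>{0..1}. ennreal (1 - u) \<partial>lborel)"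
      using iid_uniform_minimum[OF indep unif, of "{m}" n] that by simp
    ultimately have "ennreal (prob {\<omega> \<in> space M. U n \<omega> \<le> U m \<omega>}) = ennreal (1 / 2)"
      by (simp add: emeasure_eq_measure)
    then show ?thesis by (subst (asm) ennreal_inj) auto
  qed
  have "prob ({\<omega> \<in> space M. U n \<omega> \<le> U m \<omega>} \<union> {\<omega> \<in> space M. U m \<omega> \<le> U n \<omega>}) = 1"
  proof -
    have "{\<omega> \<in> space M. U n \<omega> \<le> U m \<omega>} \<union> {\<omega> \<in> space M. U m \<omega> \<le> U n \<omega>} = space M" by (auto simp: not_le)
    then show ?thesis by (simp add: prob_space)
  qed
  moreover have "prob ({\<omega> \<in> space M. U n \<omega> \<le> U m \<omega>} \<union> {\<omega> \<in> space M. U m \<omega> \<le> U n \<omega>})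
      = 1 - prob ({\<omega> \<in> space M. U n \<omega> \<le> U m \<omega>} \<inter> {\<omega> \<in> space M. U m \<omega> \<le> U n \<omega>})"
    using half[of n m] half[of m n] \<open>n \<noteq> m\<close> by (subst measure_Un3) (auto simp: fmeasurable_eq_sets)
  moreover have "{\<omega> \<in> space M. U n \<omega> \<le> U m \<omega>} \<inter> {\<omega> \<in> space M. U m \<omega> \<le> U n \<omega>}
      = {\<omega> \<in> space M. U n \<omega> \<le> U m \<omega> \<and> U m \<omega> \<le> U n \<omega>}" by auto
  ultimately show ?thesis by (simp add: emeasure_eq_measure)
qed

lemma emeasure_retained:
  fixes U :: "nat \<Rightarrow> 'a \<Rightarrow> real"
  assumes indep: "indep_vars (\<lambda>_. borel) U UNIV"
    and unif: "\<And>i. distr M lborel (U i) = uniform_measure lborel {0..1}"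
    and "finite {i. i \<noteq> n \<and> dist (x i) (x n) \<le> \<delta>}"
  shows "emeasure M {\<omega> \<in> space M. retained_II \<delta> x (\<lambda>j. U j \<omega>) n} =
    (\<integral>\<^sup>+u\<in>{0..1}. ennreal ((1 - u) ^ card {i. i \<noteq> n \<and> dist (x i) (x n) \<le> \<delta>}) \<partial>lborel)"
proof -
  have "{\<omega> \<in> space M. retained_II \<delta> x (\<lambda>j. U j \<omega>) n}
      = {\<omega> \<in> space M. \<forall>i\<in>{i. i \<noteq> n \<and> dist (x i) (x n) \<le> \<delta>}. U n \<omega> \<le> U i \<omega>}"
    by (auto simp: retained_II_def not_less)
  then show ?thesis
    using iid_uniform_minimum[OF indep unif assms(3)] by simp
qed

text \<open>If neither of two such points deletes the other, their marks are equal. Since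
  \<open>retained_II\<close> compares strictly, a tie can keep both, and the hard core is an almost
  sure property.\<close>

lemma emeasure_two_retained_eq_0:
  fixes U :: "nat \<Rightarrow> 'a \<Rightarrow> real"
  assumes indep: "indep_vars (\<lambda>_. borel) U UNIV"
    and unif: "\<And>i. distr M lborel (U i) = uniform_measure lborel {0..1}"
    and "n \<noteq> m" "dist (x n) (x m) \<le> \<delta>"
  shows "emeasure M {\<omega> \<in> space M. retained_II \<delta> x (\<lambda>j. U j \<omega>) n \<and> retained_II \<delta> x (\<lambda>j. U j \<omega>) m} = 0"
proof -
  have U [measurable]: "random_variable borel (U i)" for i
    using indep by (auto simp: indep_vars_def)
  have "{\<omega> \<in> space M. retained_II \<delta> x (\<lambda>j. U j \<omega>) n \<and> retained_II \<delta> x (\<lambda>j. U j \<omega>) m}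
      \<subseteq> {\<omega> \<in> space M. U n \<omega> \<le> U m \<omega> \<and> U m \<omega> \<le> U n \<omega>}"
    using assms(3,4) by (auto simp: retained_II_def not_less dist_commute)
  then have "emeasure M {\<omega> \<in> space M. retained_II \<delta> x (\<lambda>j. U j \<omega>) n \<and> retained_II \<delta> x (\<lambda>j. U j \<omega>) m}
      \<le> emeasure M {\<omega> \<in> space M. U n \<omega> \<le> U m \<omega> \<and> U m \<omega> \<le> U n \<omega>}"
    by (rule emeasure_mono) simp
  then show ?thesis
    using iid_uniform_tie[OF indep unif assms(3)] by simp
qed

text \<open>Ignoring the competitors outside P and Q only enlarges the event. The two sets are
  therefore free within the discs and can later be chosen from the cells alone. They avoid both
  points, so that neither n nor m counts as a competitor.\<close>

lemma emeasure_two_retained_le: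
  fixes U :: "nat \<Rightarrow> 'a \<Rightarrow> real"
  assumes indep: "indep_vars (\<lambda>_. borel) U UNIV"
    and unif: "\<And>i. distr M lborel (U i) = uniform_measure lborel {0..1}"
    and "n \<noteq> m" and fin: "finite {i. x i \<in> P}" "finite {i. x i \<in> Q}"
    and notin: "x n \<notin> P \<union> Q" "x m \<notin> P \<union> Q"
    and sub: "P \<subseteq> cball (x n) \<delta>" "Q \<subseteq> cball (x m) \<delta>"
  shows "emeasure M {\<omega> \<in> space M. retained_II \<delta> x (\<lambda>j. U j \<omega>) n \<and> retained_II \<delta> x (\<lambda>j. U j \<omega>) m} \<le>
    (\<integral>\<^sup>+u\<in>{0..1}. (\<integral>\<^sup>+w\<in>{0..1}. ennreal ((1 - u) ^ card {i. x i \<in> P - Q} * (1 - w) ^ card {i. x i \<in> Q - P} *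
       (1 - max u w) ^ card {i. x i \<in> P \<inter> Q}) \<partial>lborel) \<partial>lborel)"
proof -
  have U [measurable]: "random_variable borel (U i)" for i
    using indep by (auto simp: indep_vars_def)
  let ?Sn = "{i. x i \<in> P}" and ?Sm = "{i. x i \<in> Q}"
  have "{\<omega> \<in> space M. retained_II \<delta> x (\<lambda>j. U j \<omega>) n \<and> retained_II \<delta> x (\<lambda>j. U j \<omega>) m}
      \<subseteq> {\<omega> \<in> space M. (\<forall>i\<in>?Sn. U n \<omega> \<le> U i \<omega>) \<and> (\<forall>i\<in>?Sm. U m \<omega> \<le> U i \<omega>)}"
    using notin sub by (auto simp: retained_II_def not_less dist_commute subset_eq)
  then have "emeasure M {\<omega> \<in> space M. retained_II \<delta> x (\<lambda>j. U j \<omega>) n \<and> retained_II \<delta> x (\<lambda>j. U j \<omega>) m}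
      \<le> emeasure M {\<omega> \<in> space M. (\<forall>i\<in>?Sn. U n \<omega> \<le> U i \<omega>) \<and> (\<forall>i\<in>?Sm. U m \<omega> \<le> U i \<omega>)}"
    using fin by (intro emeasure_mono sets.sets_Collect_conj sets.sets_Collect_finite_All) auto
  also have "\<dots> = (\<integral>\<^sup>+u\<in>{0..1}. (\<integral>\<^sup>+w\<in>{0..1}. ennreal ((1 - u) ^ card (?Sn - ?Sm) * (1 - w) ^ card (?Sm - ?Sn) *
       (1 - max u w) ^ card (?Sn \<inter> ?Sm)) \<partial>lborel) \<partial>lborel)"
    by (rule iid_uniform_two_minima[OF indep unif fin \<open>n \<noteq> m\<close>]) (use notin in auto)
  finally show ?thesis
    by (simp add: set_diff_eq Collect_conj_eq[symmetric])
qed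


section \<open>Counts of the Poisson process\<close>

lemma poisson_process_count_indep:
  fixes B :: "nat \<Rightarrow> (real \<times> real) set"
  assumes "poisson_process lp X" "\<And>i. i < m \<Longrightarrow> B i \<in> sets borel" "\<And>i. i < m \<Longrightarrow> bounded (B i)"
    and "disjoint_family_on B {..<m}"
  shows "indep_vars (\<lambda>_. count_space UNIV) (\<lambda>i. point_count X (B i)) {..<m}"
  using assms unfolding poisson_process_def by blast

lemma poisson_process_count_measurable:
  assumes "poisson_process lp X" "B \<in> sets borel" "bounded B"
  shows "random_variable (count_space UNIV) (point_count X B)"
proof -
  \<comment> \<open>Measurability of a count is contained in \<open>indep_vars\<close>; a family of
    a single set yields it.\<close>
  have "indep_vars (\<lambda>_. count_space UNIV) (\<lambda>i. point_count X B) {..<1::nat}"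
    by (rule poisson_process_count_indep[OF assms(1)]) (use assms in \<open>auto simp: disjoint_family_on_def\<close>)
  then show ?thesis by (auto simp: indep_vars_def)
qed

lemma poisson_process_nn_integral_count:
  assumes "poisson_process lp X" "B \<in> sets borel" "bounded B" "0 \<le> lp"
  shows "(\<integral>\<^sup>+\<omega>. h (point_count X B \<omega>) \<partial>M) =
    (\<Sum>k. h k * ennreal ((lp * measure lborel B) ^ k / fact k * exp (- (lp * measure lborel B))))"
proof -
  note [measurable] = poisson_process_count_measurable[OF assms(1-3)]
  let ?p = "\<lambda>k. ennreal ((lp * measure lborel B) ^ k / fact k * exp (- (lp * measure lborel B)))"
  let ?D = "distr M (count_space UNIV) (point_count X B)"
  have "emeasure ?D {k} = ?p k" for k
  proof -
    have "emeasure ?D {k} = emeasure M {\<omega> \<in> space M. point_count X B \<omega> = k}"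
      by (subst emeasure_distr) (auto intro!: arg_cong2[where f = emeasure])
    then show ?thesis
      using assms(1-3) by (simp add: emeasure_eq_measure poisson_process_def)
  qed
  then have D: "?D = density (count_space UNIV) ?p"
    by (intro measure_eqI_countable[where A = UNIV]) (auto simp: emeasure_density)
  have "(\<integral>\<^sup>+\<omega>. h (point_count X B \<omega>) \<partial>M) = (\<integral>\<^sup>+k. h k \<partial>?D)"
    by (subst nn_integral_distr) auto
  also have "\<dots> = (\<integral>\<^sup>+k. ?p k * h k \<partial>count_space UNIV)"
    unfolding D by (subst nn_integral_density) auto
  finally show ?thesis
    by (simp add: nn_integral_count_space_nat mult.commute)
qed

lemma poisson_process_nn_integral_of_count:
  assumes "poisson_process lp X" "B \<in> sets borel" "bounded B" "0 \<le> lp"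
  shows "(\<integral>\<^sup>+\<omega>. of_nat (point_count X B \<omega>) \<partial>M) = ennreal (lp * measure lborel B)"
proof -
  define c where "c = lp * measure lborel B"
  have "c \<ge> 0" using assms by (simp add: c_def)
  have "(\<lambda>k. c ^ k / fact k) sums exp c"
    using exp_converges[of c] by (simp add: divide_inverse mult.commute)
  then have "(\<lambda>k. (c * exp (- c)) * (c ^ k / fact k)) sums (c * exp (- c) * exp c)"
    by (rule sums_mult)
  moreover have "(c * exp (- c)) * (c ^ k / fact k) = real (Suc k) * (c ^ Suc k / fact (Suc k) * exp (- c))" for k
  proof -
    have "real (Suc k) * (c ^ Suc k / (real (Suc k) * fact k) * exp (- c)) = c ^ Suc k / fact k * exp (- c)"
      by (simp del: of_nat_Suc)
    then show ?thesis by (simp only: fact_Suc) simp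
  qed
  ultimately have "(\<lambda>k. real (Suc k) * (c ^ Suc k / fact (Suc k) * exp (- c))) sums (c * exp (- c) * exp c)"
    by (simp only:)
  then have "(\<lambda>k. real k * (c ^ k / fact k * exp (- c))) sums (c * exp (- c) * exp c)"
    by (subst (asm) sums_Suc_iff) simp
  moreover have "c * exp (- c) * exp c = c"
    by (simp add: mult.assoc exp_add[symmetric])
  ultimately have "(\<lambda>k. real k * (c ^ k / fact k * exp (- c))) sums c"
    by (simp only:)
  then have "(\<Sum>k. ennreal (real k * (c ^ k / fact k * exp (- c)))) = ennreal c"
    using \<open>c \<ge> 0\<close> by (intro suminf_ennreal_eq) auto
  then show ?thesis
    using \<open>c \<ge> 0\<close>
    unfolding poisson_process_nn_integral_count[OF assms, where h = of_nat]
    by (simp add: c_def ennreal_mult[symmetric] ennreal_of_nat_eq_real_of_nat)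
qed

text \<open>The probability generating function of the Poisson law. It is applied with t = 1 - u,
  the probability that a competing mark is at least u.\<close>

lemma poisson_process_nn_integral_power_count:
  assumes "poisson_process lp X" "B \<in> sets borel" "bounded B" "0 \<le> lp" "0 \<le> t"
  shows "(\<integral>\<^sup>+\<omega>. ennreal (t ^ point_count X B \<omega>) \<partial>M) = ennreal (exp (- (lp * measure lborel B * (1 - t))))"
proof -
  define c where "c = lp * measure lborel B"
  have "c \<ge> 0" using assms by (simp add: c_def)
  have "(\<lambda>k. (c * t) ^ k / fact k) sums exp (c * t)"
    using exp_converges[of "c * t"] by (simp add: divide_inverse mult.commute)
  then have "(\<lambda>k. (c * t) ^ k / fact k * exp (- c)) sums (exp (c * t) * exp (- c))"
    by (rule sums_mult2)
  then have "(\<lambda>k. t ^ k * (c ^ k / fact k * exp (- c))) sums (exp (- (c * (1 - t))))"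
    by (simp add: power_mult_distrib exp_add[symmetric] algebra_simps)
  then have "(\<Sum>k. ennreal (t ^ k * (c ^ k / fact k * exp (- c)))) = ennreal (exp (- (c * (1 - t))))"
    using \<open>c \<ge> 0\<close> \<open>0 \<le> t\<close> by (intro suminf_ennreal_eq) auto
  then show ?thesis
    using \<open>c \<ge> 0\<close> \<open>0 \<le> t\<close>
    unfolding poisson_process_nn_integral_count[OF assms(1-4), where h = "\<lambda>k. ennreal (t ^ k)"]
    by (simp add: c_def ennreal_mult[symmetric])
qed

lemma poisson_process_nn_integral_count_eq_1:
  assumes "poisson_process lp X" "B \<in> sets borel" "bounded B" "0 \<le> lp"
  shows "(\<integral>\<^sup>+\<omega>. of_bool (point_count X B \<omega> = 1) \<partial>M)
    = ennreal (lp * measure lborel B * exp (- (lp * measure lborel B)))"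
proof -
  have "(\<integral>\<^sup>+\<omega>. of_bool (point_count X B \<omega> = 1) \<partial>M)
      = (\<Sum>k\<in>{1}. of_bool (k = 1) * ennreal ((lp * measure lborel B) ^ k / fact k * exp (- (lp * measure lborel B))))"
    unfolding poisson_process_nn_integral_count[OF assms, where h = "\<lambda>k. of_bool (k = 1)"]
    by (rule suminf_finite) auto
  then show ?thesis by simp
qed

lemma poisson_process_nn_integral_prod:
  fixes B :: "nat \<Rightarrow> (real \<times> real) set" and h :: "nat \<Rightarrow> nat \<Rightarrow> ennreal"
  assumes "poisson_process lp X" "\<And>i. i < m \<Longrightarrow> B i \<in> sets borel" "\<And>i. i < m \<Longrightarrow> bounded (B i)"
    and "disjoint_family_on B {..<m}"
  shows "(\<integral>\<^sup>+\<omega>. (\<Prod>i<m. h i (point_count X (B i) \<omega>)) \<partial>M)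
    = (\<Prod>i<m. \<integral>\<^sup>+\<omega>. h i (point_count X (B i) \<omega>) \<partial>M)"
proof (rule indep_vars_nn_integral)
  show "indep_vars (\<lambda>_. borel) (\<lambda>i \<omega>. h i (point_count X (B i) \<omega>)) {..<m}"
    by (rule indep_vars_compose2[OF poisson_process_count_indep[OF assms]]) auto
qed auto


lemma poisson_process_measurable:
  "poisson_process lp X \<Longrightarrow> random_variable borel (X n)"
  unfolding poisson_process_def by blast

lemma poisson_process_AE_finite:
  assumes "poisson_process lp X"
  shows "AE \<omega> in M. \<forall>B. bounded B \<longrightarrow> finite {n. X n \<omega> \<in> B}"
proof -
  have "AE \<omega> in M. \<forall>r. finite {n. norm (X n \<omega>) \<le> r}"
    using assms unfolding poisson_process_def by blast
  then show ?thesis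
  proof eventually_elim
    case (elim \<omega>)
    show ?case
    proof (intro allI impI)
      fix B :: "(real \<times> real) set" assume "bounded B"
      then obtain r where "\<forall>x\<in>B. norm x \<le> r" by (auto simp: bounded_iff)
      then have "{n. X n \<omega> \<in> B} \<subseteq> {n. norm (X n \<omega>) \<le> r}" by auto
      then show "finite {n. X n \<omega> \<in> B}" using elim finite_subset by blast
    qed
  qed
qed

text \<open>
  A two-point Mecke formula for events that do not depend on the points in \<open>C \<union> D\<close>: equality holds for
  products of indicators, and these determine a measure on the plane squared.
\<close>

lemma poisson_process_two_point_formula:
  fixes f :: "(real \<times> real) \<Rightarrow> (real \<times> real) \<Rightarrow> ennreal"
  assumes X: "poisson_process lp X" and lp: "0 \<le> lp"
    and f [measurable]: "case_prod f \<in> borel_measurable (borel \<Otimes>\<^sub>M borel)"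
    and sets [measurable]: "C \<in> sets borel" "D \<in> sets borel" "P \<in> sets borel" "Q \<in> sets borel"
    and bdd: "bounded C" "bounded D" "bounded P" "bounded Q"
    and disj: "C \<inter> D = {}" "(C \<union> D) \<inter> (P \<union> Q) = {}"
    and t: "0 \<le> t1" "0 \<le> t2" "0 \<le> t3"
  shows "(\<integral>\<^sup>+\<omega>. (\<integral>\<^sup>+n. \<integral>\<^sup>+m. indicator C (X n \<omega>) * indicator D (X m \<omega>) * f (X n \<omega>) (X m \<omega>)
            \<partial>count_space UNIV \<partial>count_space UNIV) *
          ennreal (t1 ^ point_count X (P - Q) \<omega> * t2 ^ point_count X (Q - P) \<omega> * t3 ^ point_count X (P \<inter> Q) \<omega>) \<partial>M) =
    ennreal (lp\<^sup>2 * exp (- (lp * (measure lborel (P - Q) * (1 - t1) + measure lborel (Q - P) * (1 - t2) +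
          measure lborel (P \<inter> Q) * (1 - t3))))) *
      (\<integral>\<^sup>+x. \<integral>\<^sup>+y. indicator C x * indicator D y * f x y \<partial>lborel \<partial>lborel)"
proof -
  note [measurable] = poisson_process_measurable[OF X]
  have bdd': "bounded (P - Q)" "bounded (Q - P)" "bounded (P \<inter> Q)" "bounded (A \<inter> C)" "bounded (A \<inter> D)" for A
    using bdd by (meson bounded_subset Diff_subset Int_lower1 Int_lower2)+
  have [measurable]: "random_variable (count_space UNIV) (point_count X (P - Q))"
    "random_variable (count_space UNIV) (point_count X (Q - P))"
    "random_variable (count_space UNIV) (point_count X (P \<inter> Q))"
    using bdd' by (auto intro!: poisson_process_count_measurable[OF X])
  define Z where "Z \<omega> = ennreal (t1 ^ point_count X (P - Q) \<omega> * t2 ^ point_count X (Q - P) \<omega> * t3 ^ point_count X (P \<inter> Q) \<omega>)" for \<omega>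
  define z where "z = exp (- (lp * (measure lborel (P - Q) * (1 - t1) + measure lborel (Q - P) * (1 - t2) +
          measure lborel (P \<inter> Q) * (1 - t3))))"
  have [measurable]: "Z \<in> borel_measurable M"
  proof -
    have "(\<lambda>\<omega>. t ^ N \<omega> :: real) \<in> borel_measurable M"
      if [measurable]: "random_variable (count_space UNIV) N" for N :: "'a \<Rightarrow> nat" and t
      by (rule measurable_compose[OF that]) simp
    then show ?thesis unfolding Z_def by measurable
  qed
  let ?I = "count_space (UNIV :: (nat \<times> nat) set)"
  interpret I: sigma_finite_measure ?I
    by (rule sigma_finite_measure_count_space_countable) simp
  define XX where "XX p = (X (fst (snd p)) (fst p), X (snd (snd p)) (fst p))" for p :: "'a \<times> nat \<times> nat"
  have [measurable]: "XX \<in> measurable (M \<Otimes>\<^sub>M ?I) (borel \<Otimes>\<^sub>M borel)"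
  proof -
    have "(\<lambda>p. (\<lambda>i p. (X (fst i) (fst p), X (snd i) (fst p))) (snd p) p) \<in> measurable (M \<Otimes>\<^sub>M ?I) (borel \<Otimes>\<^sub>M borel)"
      by (rule measurable_compose_countable'[where I = UNIV]) auto
    then show ?thesis by (simp add: XX_def[abs_def])
  qed
  \<comment> \<open>The intensity measure of the pairs (X n, X m) in C \<times> D, each weighted by
    Z. Integrating f against it gives the left-hand side of the formula.\<close>
  define \<kappa> where "\<kappa> = distr (density (M \<Otimes>\<^sub>M ?I)
     (\<lambda>p. indicator C (fst (XX p)) * indicator D (snd (XX p)) * Z (fst p))) (borel \<Otimes>\<^sub>M borel) XX"
  have int_\<kappa>: "(\<integral>\<^sup>+q. h q \<partial>\<kappa>) = (\<integral>\<^sup>+\<omega>. (\<integral>\<^sup>+n. \<integral>\<^sup>+m. indicator C (X n \<omega>) * indicator D (X m \<omega>) * h (X n \<omega>, X m \<omega>)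
      \<partial>count_space UNIV \<partial>count_space UNIV) * Z \<omega> \<partial>M)"
    if [measurable]: "h \<in> borel_measurable (borel \<Otimes>\<^sub>M borel)" for h
  proof -
    have "(\<integral>\<^sup>+q. h q \<partial>\<kappa>) = (\<integral>\<^sup>+p. indicator C (fst (XX p)) * indicator D (snd (XX p)) * Z (fst p) * h (XX p) \<partial>(M \<Otimes>\<^sub>M ?I))"
      unfolding \<kappa>_def by (subst nn_integral_distr, simp, simp) (subst nn_integral_density; simp)
    also have "\<dots> = (\<integral>\<^sup>+\<omega>. \<integral>\<^sup>+i. indicator C (fst (XX (\<omega>, i))) * indicator D (snd (XX (\<omega>, i))) * Z \<omega> * h (XX (\<omega>, i)) \<partial>?I \<partial>M)"
      by (subst I.nn_integral_fst[symmetric]) auto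
    also have "\<dots> = (\<integral>\<^sup>+\<omega>. (\<integral>\<^sup>+n. \<integral>\<^sup>+m. indicator C (X n \<omega>) * indicator D (X m \<omega>) * h (X n \<omega>, X m \<omega>)
      \<partial>count_space UNIV \<partial>count_space UNIV) * Z \<omega> \<partial>M)"
    proof (rule nn_integral_cong)
      fix \<omega>
      let ?h = "\<lambda>i. indicator C (X (fst i) \<omega>) * indicator D (X (snd i) \<omega>) * h (X (fst i) \<omega>, X (snd i) \<omega>)"
      have "(\<integral>\<^sup>+i. indicator C (fst (XX (\<omega>, i))) * indicator D (snd (XX (\<omega>, i))) * Z \<omega> * h (XX (\<omega>, i)) \<partial>?I)
          = (\<integral>\<^sup>+i. ?h i * Z \<omega> \<partial>?I)"
        by (intro nn_integral_cong) (simp add: XX_def mult_ac)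
      also have "\<dots> = (\<integral>\<^sup>+i. ?h i \<partial>?I) * Z \<omega>"
        by (rule nn_integral_multc) simp
      also have "(\<integral>\<^sup>+i. ?h i \<partial>?I) = (\<integral>\<^sup>+n. \<integral>\<^sup>+m. ?h (n, m) \<partial>count_space UNIV \<partial>count_space UNIV)"
        by (rule nn_integral_fst_count_space[symmetric])
      finally show "(\<integral>\<^sup>+i. indicator C (fst (XX (\<omega>, i))) * indicator D (snd (XX (\<omega>, i))) * Z \<omega> * h (XX (\<omega>, i)) \<partial>?I)
        = (\<integral>\<^sup>+n. \<integral>\<^sup>+m. indicator C (X n \<omega>) * indicator D (X m \<omega>) * h (X n \<omega>, X m \<omega>)
            \<partial>count_space UNIV \<partial>count_space UNIV) * Z \<omega>"
        by simp
    qed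
    finally show ?thesis .
  qed
  let ?\<mu>C = "density lborel (\<lambda>x :: real \<times> real. ennreal (lp * z) * indicator C x)"
  let ?\<mu>D = "density lborel (\<lambda>x :: real \<times> real. ennreal lp * indicator D x)"
  have fin: "emeasure lborel A < \<infinity>" if "bounded A" for A :: "(real \<times> real) set"
    using that by (rule emeasure_bounded_finite)
  have \<mu>: "emeasure (density lborel (\<lambda>x. ennreal a * indicator E x)) A = ennreal (a * measure lborel (A \<inter> E))"
    if "a \<ge> 0" "A \<in> sets borel" "E \<in> sets borel" "bounded E" for a A and E :: "(real \<times> real) set"
  proof -
    have "emeasure (density lborel (\<lambda>x. ennreal a * indicator E x)) A
        = (\<integral>\<^sup>+x. ennreal a * indicator (A \<inter> E) x \<partial>lborel)"
      using that by (subst emeasure_density) (auto intro!: nn_integral_cong split: split_indicator)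
    also have "\<dots> = ennreal a * emeasure lborel (A \<inter> E)"
      using that by (subst nn_integral_cmult) auto
    also have "emeasure lborel (A \<inter> E) = ennreal (measure lborel (A \<inter> E))"
      using fin[OF bounded_subset[OF that(4) Int_lower2], of A]
      by (intro emeasure_eq_ennreal_measure) (simp add: less_top)
    finally show ?thesis using that by (simp add: ennreal_mult)
  qed
  have sf: "sigma_finite_measure (density lborel (\<lambda>x. ennreal a * indicator E x))"
    if "a \<ge> 0" "E \<in> sets borel" "bounded E" for a and E :: "(real \<times> real) set"
  proof -
    interpret finite_measure "density lborel (\<lambda>x. ennreal a * indicator E x)"
      by (rule finite_measureI) (simp add: \<mu>[OF that(1) _ that(2,3), of UNIV, simplified])
    show ?thesis ..
  qed
  have prod5: "(\<Prod>i<5. F i) = F 0 * F 1 * F 2 * F 3 * F 4" for F :: "nat \<Rightarrow> ennreal"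
    by (simp add: numeral_eq_Suc lessThan_Suc mult_ac)
  \<comment> \<open>The constants are shared out so that a product measure results: z goes with C.
    Boundedness of C and D makes both factors finite measures, so rectangles decide
    equality.\<close>
  have "?\<mu>C \<Otimes>\<^sub>M ?\<mu>D = \<kappa>"
  proof (rule pair_measure_eqI)
    show "sigma_finite_measure ?\<mu>C" "sigma_finite_measure ?\<mu>D"
      using sf[of "lp * z" C] sf[of lp D] lp bdd by (simp_all add: z_def)
    show "sets (?\<mu>C \<Otimes>\<^sub>M ?\<mu>D) = sets \<kappa>"
      unfolding \<kappa>_def sets_distr by (rule sets_pair_measure_cong) simp_all
    fix A B assume "A \<in> sets ?\<mu>C" "B \<in> sets ?\<mu>D"
    then have [measurable]: "A \<in> sets borel" "B \<in> sets borel" by simp_all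
    have "emeasure \<kappa> (A \<times> B) = (\<integral>\<^sup>+q. indicator (A \<times> B) q \<partial>\<kappa>)"
      by (rule nn_integral_indicator[symmetric]) (simp add: \<kappa>_def)
    also have "\<dots> = (\<integral>\<^sup>+\<omega>. (\<integral>\<^sup>+n. \<integral>\<^sup>+m. indicator (A \<inter> C) (X n \<omega>) * indicator (B \<inter> D) (X m \<omega>)
        \<partial>count_space UNIV \<partial>count_space UNIV) * Z \<omega> \<partial>M)"
    proof -
      have "indicator C x * indicator D y * indicator (A \<times> B) (x, y)
          = (indicator (A \<inter> C) x * indicator (B \<inter> D) y :: ennreal)" for x y
        by (auto split: split_indicator)
      then show ?thesis by (subst int_\<kappa>) simp_all
    qed
    also have "\<dots> = (\<integral>\<^sup>+\<omega>. of_nat (point_count X (A \<inter> C) \<omega>) * of_nat (point_count X (B \<inter> D) \<omega>) * Z \<omega> \<partial>M)"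
    proof (rule nn_integral_cong_AE)
      \<comment> \<open>Local finiteness matters here: \<open>card\<close> of an infinite set is 0,
        whereas the sum over the indices would be infinite.\<close>
      show "AE \<omega> in M. (\<integral>\<^sup>+n. \<integral>\<^sup>+m. indicator (A \<inter> C) (X n \<omega>) * indicator (B \<inter> D) (X m \<omega>)
          \<partial>count_space UNIV \<partial>count_space UNIV) * Z \<omega>
        = of_nat (point_count X (A \<inter> C) \<omega>) * of_nat (point_count X (B \<inter> D) \<omega>) * Z \<omega>"
        using poisson_process_AE_finite[OF X]
      proof eventually_elim
        case (elim \<omega>)
        then have fin: "finite {n. X n \<omega> \<in> A \<inter> C}" "finite {n. X n \<omega> \<in> B \<inter> D}"
          using bdd' by blast+
        have "(\<integral>\<^sup>+n. \<integral>\<^sup>+m. indicator (A \<inter> C) (X n \<omega>) * indicator (B \<inter> D) (X m \<omega>)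
            \<partial>count_space UNIV \<partial>count_space UNIV)
          = (\<integral>\<^sup>+n. indicator (A \<inter> C) (X n \<omega>) \<partial>count_space UNIV) *
            (\<integral>\<^sup>+m. indicator (B \<inter> D) (X m \<omega>) \<partial>count_space UNIV)"
          by (subst nn_integral_cmult, simp, rule nn_integral_multc) simp
        then show ?case
          unfolding nn_integral_count_space_indicator_finite[OF fin(1)]
            nn_integral_count_space_indicator_finite[OF fin(2)] by simp
      qed
    qed
    \<comment> \<open>The five sets are pairwise disjoint, so their counts are independent: the
      first two contribute means, the other three generating functions. As C and D are disjoint, no
      term with n = m survives and the product of counts takes no diagonal correction.\<close>
    also have "\<dots> = (\<integral>\<^sup>+\<omega>. (\<Prod>i<5. ([of_nat, of_nat, \<lambda>k. ennreal (t1 ^ k), \<lambda>k. ennreal (t2 ^ k), \<lambda>k. ennreal (t3 ^ k)] ! i)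
        (point_count X ([A \<inter> C, B \<inter> D, P - Q, Q - P, P \<inter> Q] ! i) \<omega>)) \<partial>M)"
    proof -
      have "Z \<omega> = ennreal (t1 ^ point_count X (P - Q) \<omega>) * ennreal (t2 ^ point_count X (Q - P) \<omega>) *
          ennreal (t3 ^ point_count X (P \<inter> Q) \<omega>)" for \<omega>
        unfolding Z_def using t by (simp only: ennreal_mult zero_le_power mult_nonneg_nonneg)
      then show ?thesis
        unfolding prod5 by (simp add: mult.assoc)
    qed
    also have "\<dots> = (\<Prod>i<5. \<integral>\<^sup>+\<omega>. ([of_nat, of_nat, \<lambda>k. ennreal (t1 ^ k), \<lambda>k. ennreal (t2 ^ k), \<lambda>k. ennreal (t3 ^ k)] ! i)
        (point_count X ([A \<inter> C, B \<inter> D, P - Q, Q - P, P \<inter> Q] ! i) \<omega>) \<partial>M)"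
    proof (rule poisson_process_nn_integral_prod[OF X])
      fix i :: nat assume "i < 5"
      then have "i \<in> {0, 1, 2, 3, 4}" by auto
      then show "[A \<inter> C, B \<inter> D, P - Q, Q - P, P \<inter> Q] ! i \<in> sets borel"
        "bounded ([A \<inter> C, B \<inter> D, P - Q, Q - P, P \<inter> Q] ! i)"
        using bdd' by auto
    next
      have "{..<5} = {0, 1, 2, 3, 4 :: nat}" by auto
      then show "disjoint_family_on (\<lambda>i. [A \<inter> C, B \<inter> D, P - Q, Q - P, P \<inter> Q] ! i) {..<5}"
        using disj by (auto simp: disjoint_family_on_def)
    qed
    also have "\<dots> = ennreal (lp * measure lborel (A \<inter> C)) * ennreal (lp * measure lborel (B \<inter> D)) * ennreal z"
    proof -
      have z: "ennreal z = ennreal (exp (- (lp * measure lborel (P - Q) * (1 - t1)))) *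
          ennreal (exp (- (lp * measure lborel (Q - P) * (1 - t2)))) *
          ennreal (exp (- (lp * measure lborel (P \<inter> Q) * (1 - t3))))"
        unfolding z_def by (simp only: ennreal_mult[symmetric] exp_ge_zero mult_nonneg_nonneg exp_add[symmetric])
          (simp add: algebra_simps)
      show ?thesis
        unfolding prod5 z
        by (simp add: poisson_process_nn_integral_of_count[OF X _ bdd'(4) lp]
            poisson_process_nn_integral_of_count[OF X _ bdd'(5) lp]
            poisson_process_nn_integral_power_count[OF X _ bdd'(1) lp t(1)]
            poisson_process_nn_integral_power_count[OF X _ bdd'(2) lp t(2)]
            poisson_process_nn_integral_power_count[OF X _ bdd'(3) lp t(3)] mult.assoc del: Int_iff Diff_iff)
    qed
    also have "\<dots> = emeasure ?\<mu>C A * emeasure ?\<mu>D B"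
    proof -
      have "0 \<le> z" by (simp add: z_def)
      then have "emeasure ?\<mu>C A = ennreal (lp * z * measure lborel (A \<inter> C))"
        using lp bdd by (intro \<mu>) auto
      moreover have "emeasure ?\<mu>D B = ennreal (lp * measure lborel (B \<inter> D))"
        using lp bdd by (intro \<mu>) auto
      ultimately show ?thesis
        using lp \<open>0 \<le> z\<close> by (simp add: ennreal_mult mult_ac)
    qed
    finally show "emeasure ?\<mu>C A * emeasure ?\<mu>D B = emeasure \<kappa> (A \<times> B)" ..
  qed
  interpret D: sigma_finite_measure ?\<mu>D
    using sf[of lp D] lp bdd by simp
  have "(\<integral>\<^sup>+\<omega>. (\<integral>\<^sup>+n. \<integral>\<^sup>+m. indicator C (X n \<omega>) * indicator D (X m \<omega>) * f (X n \<omega>) (X m \<omega>)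
            \<partial>count_space UNIV \<partial>count_space UNIV) * Z \<omega> \<partial>M) = (\<integral>\<^sup>+q. case_prod f q \<partial>\<kappa>)"
    by (subst int_\<kappa>) auto
  also have "\<dots> = (\<integral>\<^sup>+x. \<integral>\<^sup>+y. f x y \<partial>?\<mu>D \<partial>?\<mu>C)"
    unfolding \<open>?\<mu>C \<Otimes>\<^sub>M ?\<mu>D = \<kappa>\<close>[symmetric]
    by (subst D.nn_integral_fst[symmetric]) auto
  also have "\<dots> = (\<integral>\<^sup>+x. \<integral>\<^sup>+y. ennreal (lp\<^sup>2 * z) * (indicator C x * indicator D y * f x y) \<partial>lborel \<partial>lborel)"
  proof -
    have "(\<integral>\<^sup>+y. f x y \<partial>?\<mu>D) = (\<integral>\<^sup>+y. ennreal lp * indicator D y * f x y \<partial>lborel)" for x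
      by (subst nn_integral_density) auto
    then have "(\<integral>\<^sup>+x. \<integral>\<^sup>+y. f x y \<partial>?\<mu>D \<partial>?\<mu>C)
        = (\<integral>\<^sup>+x. ennreal (lp * z) * indicator C x * (\<integral>\<^sup>+y. ennreal lp * indicator D y * f x y \<partial>lborel) \<partial>lborel)"
      by (simp only:) (subst nn_integral_density; simp)
    also have "\<dots> = (\<integral>\<^sup>+x. \<integral>\<^sup>+y. ennreal (lp\<^sup>2 * z) * (indicator C x * indicator D y * f x y) \<partial>lborel \<partial>lborel)"
    proof (rule nn_integral_cong)
      fix x
      have "ennreal (lp\<^sup>2 * z) = ennreal (lp * z) * ennreal lp"
        using lp by (simp add: ennreal_mult[symmetric] z_def power2_eq_square mult_ac)
      then show "ennreal (lp * z) * indicator C x * (\<integral>\<^sup>+y. ennreal lp * indicator D y * f x y \<partial>lborel)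
          = (\<integral>\<^sup>+y. ennreal (lp\<^sup>2 * z) * (indicator C x * indicator D y * f x y) \<partial>lborel)"
        by (subst nn_integral_cmult[symmetric]) (simp_all add: mult_ac)
    qed
    finally show ?thesis .
  qed
  also have "\<dots> = ennreal (lp\<^sup>2 * z) * (\<integral>\<^sup>+x. \<integral>\<^sup>+y. indicator C x * indicator D y * f x y \<partial>lborel \<partial>lborel)"
    by (subst nn_integral_cmult[symmetric], measurable) (subst nn_integral_cmult; simp)
  finally show ?thesis
    by (simp only: Z_def z_def)
qed

end

section \<open>Grid cells\<close>

text \<open>Half-open squares of side 1 / j for j > 0. The floors make them a partition of the plane
  and name the cell of a given point.\<close>

definition grid_cell :: "real \<Rightarrow> int \<times> int \<Rightarrow> (real \<times> real) set" where
  "grid_cell j a = {x. \<lfloor>j * fst x\<rfloor> = fst a \<and> \<lfloor>j * snd x\<rfloor> = snd a}"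

text \<open>The lower left corner of the cell, which stands in for all its points.\<close>

definition grid_point :: "real \<Rightarrow> int \<times> int \<Rightarrow> real \<times> real" where
  "grid_point j a = (of_int (fst a) / j, of_int (snd a) / j)"

lemma grid_cell_eq:
  assumes "j > 0"
  shows "grid_cell j a = {of_int (fst a) / j..<of_int (fst a + 1) / j} \<times> {of_int (snd a) / j..<of_int (snd a + 1) / j}"
  using assms by (auto simp: grid_cell_def floor_eq_iff field_simps)

lemma grid_cell_borel [measurable]: "grid_cell j a \<in> sets borel"
proof -
  have "Measurable.pred borel (\<lambda>x :: real \<times> real. \<lfloor>j * fst x\<rfloor> = fst a \<and> \<lfloor>j * snd x\<rfloor> = snd a)"
    by measurable
  then show ?thesis by (simp add: grid_cell_def pred_def)
qed

lemma grid_cell_disjoint: "a \<noteq> b \<Longrightarrow> grid_cell j a \<inter> grid_cell j b = {}"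
  by (auto simp: grid_cell_def prod_eq_iff)

lemma mem_grid_cell: "x \<in> grid_cell j (\<lfloor>j * fst x\<rfloor>, \<lfloor>j * snd x\<rfloor>)"
  by (simp add: grid_cell_def)

lemma grid_cell_unique: "x \<in> grid_cell j a \<Longrightarrow> a = (\<lfloor>j * fst x\<rfloor>, \<lfloor>j * snd x\<rfloor>)"
  by (auto simp: grid_cell_def)

lemma dist_grid_point:
  assumes "j > 0" "x \<in> grid_cell j a"
  shows "dist x (grid_point j a) < 2 / j"
proof -
  have "\<bar>fst x - of_int (fst a) / j\<bar> < 1 / j" "\<bar>snd x - of_int (snd a) / j\<bar> < 1 / j"
    using assms by (auto simp: grid_cell_eq add_divide_distrib)
  moreover have "dist x (grid_point j a) \<le> \<bar>fst x - of_int (fst a) / j\<bar> + \<bar>snd x - of_int (snd a) / j\<bar>"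
    unfolding dist_prod_def grid_point_def dist_real_def
    by (rule order_trans[OF sqrt_sum_squares_le_sum_abs]) simp
  ultimately show ?thesis by simp
qed

lemma bounded_grid_cell: "j > 0 \<Longrightarrow> bounded (grid_cell j a)"
  by (rule bounded_subset[OF bounded_ball[of "grid_point j a" "2 / j"]])
     (auto simp: dist_grid_point dist_commute)

lemma measure_grid_cell:
  assumes "j > 0"
  shows "measure lborel (grid_cell j a) = 1 / j\<^sup>2"
proof -
  have "emeasure lborel (grid_cell j a) = emeasure (lborel \<Otimes>\<^sub>M lborel) (grid_cell j a)"
    by (simp add: lborel_prod)
  also have "\<dots> = ennreal (1 / j) * ennreal (1 / j)"
    using assms by (simp add: grid_cell_eq lborel.emeasure_pair_measure_Times diff_divide_distrib[symmetric] divide_right_mono)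
  also have "\<dots> = ennreal (1 / j\<^sup>2)"
    using assms by (simp add: ennreal_mult[symmetric] power2_eq_square)
  finally show ?thesis
    by (simp add: measure_def)
qed

lemma retained_II_measurable [measurable]:
  "Measurable.pred (PiM UNIV (\<lambda>_. borel) \<Otimes>\<^sub>M PiM UNIV (\<lambda>_. borel)) (\<lambda>p. retained_II \<delta> (fst p) (snd p) n)"
  unfolding retained_II_def by measurable

section \<open>Intensity and pairs of retained points\<close>

context matern_II
begin

lemma X_measurable [measurable]: "random_variable borel (X n)"
  by (rule poisson_process_measurable[OF parents])

lemma count_measurable: "B \<in> sets borel \<Longrightarrow> bounded B \<Longrightarrow> random_variable (count_space UNIV) (point_count X B)"
  using poisson_process_count_measurable[OF parents] .

lemma marks_indep: "indep_vars (\<lambda>_. borel) U UNIV"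
  and marks_uniform: "distr M lborel (U n) = uniform_measure lborel {0..1}"
  and points_marks_indep: "indep_elements (PiM UNIV (\<lambda>_. borel)) (\<lambda>\<omega> n. X n \<omega>) (PiM UNIV (\<lambda>_. borel)) (\<lambda>\<omega> n. U n \<omega>)"
  using marks unfolding iid_uniform_marks_def by blast+

lemma U_measurable [measurable]: "random_variable borel (U n)"
  using marks_indep by (auto simp: indep_vars_def)

text \<open>Points are taken from the first sample point and marks from the second. The thinned
  process itself is the diagonal case; with separate sample points the marks can be averaged while
  the points stay fixed.\<close>

abbreviation ret :: "'a \<Rightarrow> 'a \<Rightarrow> nat \<Rightarrow> bool" where
  "ret \<omega> \<omega>' \<equiv> retained_II \<delta> (\<lambda>j. X j \<omega>) (\<lambda>j. U j \<omega>')"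

lemma ret_measurable [measurable]: "Measurable.pred M (\<lambda>\<omega>. ret \<omega> \<omega> n)" "Measurable.pred M (\<lambda>\<omega>'. ret \<omega> \<omega>' n)"
  unfolding retained_II_def by measurable

lemma ret_pair_measurable [measurable]: "Measurable.pred (M \<Otimes>\<^sub>M M) (\<lambda>p. ret (fst p) (snd p) n)"
  unfolding retained_II_def by measurable

lemma AE_good: "AE \<omega> in M. inj (\<lambda>n. X n \<omega>) \<and> (\<forall>B. bounded B \<longrightarrow> finite {n. X n \<omega> \<in> B})"
proof -
  have "AE \<omega> in M. inj (\<lambda>n. X n \<omega>)"
    using parents unfolding poisson_process_def by blast
  then show ?thesis
    using poisson_process_AE_finite[OF parents] by eventually_elim blast
qed

text \<open>The process is a set of pairs; by injectivity of the locations, counting its elements is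
  counting indices.\<close>

lemma matern_II_points_window:
  assumes "inj (\<lambda>n. X n \<omega>)"
  shows "bij_betw (\<lambda>n. (X n \<omega>, H n \<omega>)) {n. ret \<omega> \<omega> n \<and> X n \<omega> \<in> B} {p \<in> matern_II_points \<delta> X U H \<omega>. fst p \<in> B}"
  using assms by (auto simp: bij_betw_def matern_II_points_def inj_on_def)

lemma intensity_eq:
  "intensity M (matern_II_points \<delta> X U H) =
    (\<integral>\<^sup>+\<omega>. \<integral>\<^sup>+n. indicator unit_square (X n \<omega>) * of_bool (ret \<omega> \<omega> n) \<partial>count_space UNIV \<partial>M)"
  unfolding intensity_def
proof (rule nn_integral_cong_AE, use AE_good in eventually_elim)
  fix \<omega> assume *: "inj (\<lambda>n. X n \<omega>) \<and> (\<forall>B. bounded B \<longrightarrow> finite {n. X n \<omega> \<in> B})"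
  let ?R = "{n. ret \<omega> \<omega> n \<and> X n \<omega> \<in> unit_square}" and ?S = "{p \<in> matern_II_points \<delta> X U H \<omega>. fst p \<in> unit_square}"
  have "emeasure (count_space UNIV) ?S = emeasure (count_space UNIV) ?R"
    using bij_betw_same_card[OF matern_II_points_window[of \<omega> unit_square]] bij_betw_finite[OF matern_II_points_window[of \<omega> unit_square]] *
    by (simp add: emeasure_count_space)
  also have "\<dots> = (\<integral>\<^sup>+n. indicator ?R n \<partial>count_space UNIV)"
    by (rule nn_integral_indicator[symmetric]) simp
  also have "\<dots> = (\<integral>\<^sup>+n. indicator unit_square (X n \<omega>) * of_bool (ret \<omega> \<omega> n) \<partial>count_space UNIV)"
    by (intro nn_integral_cong) (auto split: split_indicator)
  finally show "emeasure (count_space UNIV) ?S = (\<integral>\<^sup>+n. indicator unit_square (X n \<omega>) * of_bool (ret \<omega> \<omega> n) \<partial>count_space UNIV)" .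
qed

text \<open>Each grid cell with exactly one parent point contributes the retention probability of that point.\<close>

lemma intensity_ge_grid:
  fixes k :: nat
  assumes "k > 0"
  defines "A \<equiv> pi * (\<delta> + 2 / real k)\<^sup>2"
  shows "ennreal (exp (- (lp / (real k)\<^sup>2)) * ((1 - exp (- (lp * A))) / A)) \<le> intensity M (matern_II_points \<delta> X U H)"
proof -
  define j where "j = real k"
  have j: "j > 0" using assms by (simp add: j_def)
  have "\<delta> + 2 / real k > 0" using delta_pos by (simp add: add_pos_nonneg)
  then have A: "A > 0" by (simp add: A_def)
  \<comment> \<open>The k * k cells that tile the half-open unit square.\<close>
  define K where "K = {0..<int k} \<times> {0..<int k}"
  define C where "C = grid_cell j"
  \<comment> \<open>For a point in cell \<open>a\<close>, this set contains every point within
    \<delta> that lies outside the cell. Overcounting competitors lowers the bound, as it should;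
    removing the cell makes the count independent of the number of points in it.\<close>
  define J where "J a = ball (grid_point j a) (\<delta> + 2 / j) - C a" for a
  have [measurable]: "C a \<in> sets borel" "J a \<in> sets borel" for a by (simp_all add: C_def J_def)
  have bdd: "bounded (C a)" "bounded (J a)" for a
    using bounded_grid_cell[OF j] by (auto simp: C_def J_def intro: bounded_subset[OF bounded_ball])
  have [measurable]: "random_variable (count_space UNIV) (point_count X (C a))"
    "random_variable (count_space UNIV) (point_count X (J a))" for a
    using bdd by (auto intro!: count_measurable)
  let ?\<tau> = "\<lambda>\<omega> n. \<integral>\<^sup>+u\<in>{0..1}. ennreal ((1 - u) ^ card {i. i \<noteq> n \<and> dist (X i \<omega>) (X n \<omega>) \<le> \<delta>}) \<partial>lborel"
  \<comment> \<open>A lower bound for the integrand of \<open>?\<tau>\<close> at the sole point of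
    cell \<open>a\<close>. Cells with several points are given up; their probability is of order 1 /
    k^4 each, hence negligible in the limit.\<close>
  let ?h = "\<lambda>a \<omega> u. of_bool (point_count X (C a) \<omega> = 1) * (ennreal ((1 - u) ^ point_count X (J a) \<omega>) * indicator {0..1::real} u)"
  have [measurable]: "(\<lambda>p. ?h a (fst p) (snd p)) \<in> borel_measurable (M \<Otimes>\<^sub>M lborel)" for a
    by measurable
  \<comment> \<open>Sum and expectation are exchanged and later exchanged back, because independence
    of points and marks is applied to one fixed index at a time.\<close>
  have "intensity M (matern_II_points \<delta> X U H)
      = (\<integral>\<^sup>+n. \<integral>\<^sup>+\<omega>. indicator unit_square (X n \<omega>) * of_bool (ret \<omega> \<omega> n) \<partial>M \<partial>count_space UNIV)"
    unfolding intensity_eq by (intro nn_integral_count_space_nn_integral) auto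
  also have "\<dots> = (\<integral>\<^sup>+n. \<integral>\<^sup>+\<omega>. \<integral>\<^sup>+\<omega>'. indicator unit_square (X n \<omega>) * of_bool (ret \<omega> \<omega>' n) \<partial>M \<partial>M \<partial>count_space UNIV)"
  proof (rule nn_integral_cong)
    fix n
    show "(\<integral>\<^sup>+\<omega>. indicator unit_square (X n \<omega>) * of_bool (ret \<omega> \<omega> n) \<partial>M)
        = (\<integral>\<^sup>+\<omega>. \<integral>\<^sup>+\<omega>'. indicator unit_square (X n \<omega>) * of_bool (ret \<omega> \<omega>' n) \<partial>M \<partial>M)"
      by (rule indep_elements_nn_integral[OF points_marks_indep,
            where F = "\<lambda>x u. indicator unit_square (x n) * of_bool (retained_II \<delta> x u n)"])
         (simp add: split_beta)
  qed
  also have "\<dots> = (\<integral>\<^sup>+\<omega>. \<integral>\<^sup>+n. \<integral>\<^sup>+\<omega>'. indicator unit_square (X n \<omega>) * of_bool (ret \<omega> \<omega>' n) \<partial>M \<partial>count_space UNIV \<partial>M)"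
    by (intro nn_integral_count_space_nn_integral[symmetric]) auto
  also have "\<dots> = (\<integral>\<^sup>+\<omega>. \<integral>\<^sup>+n. indicator unit_square (X n \<omega>) * ?\<tau> \<omega> n \<partial>count_space UNIV \<partial>M)"
  proof (rule nn_integral_cong_AE, use AE_good in eventually_elim)
    fix \<omega> assume *: "inj (\<lambda>n. X n \<omega>) \<and> (\<forall>B. bounded B \<longrightarrow> finite {n. X n \<omega> \<in> B})"
    show "(\<integral>\<^sup>+n. \<integral>\<^sup>+\<omega>'. indicator unit_square (X n \<omega>) * of_bool (ret \<omega> \<omega>' n) \<partial>M \<partial>count_space UNIV)
        = (\<integral>\<^sup>+n. indicator unit_square (X n \<omega>) * ?\<tau> \<omega> n \<partial>count_space UNIV)"
    proof (rule nn_integral_cong)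
      fix n
      have "finite {i. X i \<omega> \<in> cball (X n \<omega>) \<delta>}" using * by blast
      then have fin: "finite {i. i \<noteq> n \<and> dist (X i \<omega>) (X n \<omega>) \<le> \<delta>}"
        by (rule finite_subset[rotated]) (auto simp: dist_commute)
      have "(\<integral>\<^sup>+\<omega>'. of_bool (ret \<omega> \<omega>' n) \<partial>M) = (\<integral>\<^sup>+\<omega>'. indicator {\<omega>' \<in> space M. ret \<omega> \<omega>' n} \<omega>' \<partial>M)"
        by (intro nn_integral_cong) (auto split: split_indicator)
      also have "\<dots> = emeasure M {\<omega>' \<in> space M. ret \<omega> \<omega>' n}"
        by (rule nn_integral_indicator) measurable
      also have "\<dots> = ?\<tau> \<omega> n"
        by (rule emeasure_retained[OF marks_indep marks_uniform fin])
      finally show "(\<integral>\<^sup>+\<omega>'. indicator unit_square (X n \<omega>) * of_bool (ret \<omega> \<omega>' n) \<partial>M)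
          = indicator unit_square (X n \<omega>) * ?\<tau> \<omega> n"
        by (subst nn_integral_cmult) simp_all
    qed
  qed
  finally have I: "intensity M (matern_II_points \<delta> X U H)
      = (\<integral>\<^sup>+\<omega>. \<integral>\<^sup>+n. indicator unit_square (X n \<omega>) * ?\<tau> \<omega> n \<partial>count_space UNIV \<partial>M)" .
  have pointwise: "(\<Sum>a\<in>K. \<integral>\<^sup>+u. ?h a \<omega> u \<partial>lborel) \<le> (\<integral>\<^sup>+n. indicator unit_square (X n \<omega>) * ?\<tau> \<omega> n \<partial>count_space UNIV)"
    if fin: "\<forall>B. bounded B \<longrightarrow> finite {n. X n \<omega> \<in> B}" for \<omega>
  proof -
    have "(\<integral>\<^sup>+u. ?h a \<omega> u \<partial>lborel) \<le> (\<integral>\<^sup>+n. indicator (C a) (X n \<omega>) * ?\<tau> \<omega> n \<partial>count_space UNIV)" for a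
    proof (cases "point_count X (C a) \<omega> = 1")
      case True
      then obtain n where n: "{n. X n \<omega> \<in> C a} = {n}"
        by (auto simp: card_1_singleton_iff)
      then have "X n \<omega> \<in> C a" by blast
      have sub: "{i. i \<noteq> n \<and> dist (X i \<omega>) (X n \<omega>) \<le> \<delta>} \<subseteq> {i. X i \<omega> \<in> J a}"
      proof safe
        fix i assume i: "i \<noteq> n" "dist (X i \<omega>) (X n \<omega>) \<le> \<delta>"
        have "dist (X n \<omega>) (grid_point j a) < 2 / j"
          using dist_grid_point[OF j] \<open>X n \<omega> \<in> C a\<close> by (simp add: C_def)
        then have "dist (X i \<omega>) (grid_point j a) < \<delta> + 2 / j"
          using i(2) dist_triangle[of "X i \<omega>" "grid_point j a" "X n \<omega>"] by linarith
        moreover have "X i \<omega> \<notin> C a" using n i(1) by blast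
        ultimately show "X i \<omega> \<in> J a" by (simp add: J_def dist_commute)
      qed
      have card: "card {i. i \<noteq> n \<and> dist (X i \<omega>) (X n \<omega>) \<le> \<delta>} \<le> point_count X (J a) \<omega>"
        using fin bdd(2) sub by (intro card_mono) auto
      have "(\<integral>\<^sup>+u. ?h a \<omega> u \<partial>lborel) \<le> ?\<tau> \<omega> n"
        using True card by (intro nn_integral_mono) (auto intro!: ennreal_leI power_decreasing split: split_indicator)
      also have "\<dots> = indicator (C a) (X n \<omega>) * ?\<tau> \<omega> n"
        using \<open>X n \<omega> \<in> C a\<close> by simp
      also have "\<dots> \<le> (\<integral>\<^sup>+n. indicator (C a) (X n \<omega>) * ?\<tau> \<omega> n \<partial>count_space UNIV)"
        by (rule nn_integral_ge_point) simp
      finally show ?thesis .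
    qed simp
    then have "(\<Sum>a\<in>K. \<integral>\<^sup>+u. ?h a \<omega> u \<partial>lborel)
        \<le> (\<Sum>a\<in>K. \<integral>\<^sup>+n. indicator (C a) (X n \<omega>) * ?\<tau> \<omega> n \<partial>count_space UNIV)"
      by (intro sum_mono)
    also have "\<dots> = (\<integral>\<^sup>+n. (\<Sum>a\<in>K. indicator (C a) (X n \<omega>) * ?\<tau> \<omega> n) \<partial>count_space UNIV)"
      by (rule nn_integral_sum[symmetric]) simp
    also have "\<dots> \<le> (\<integral>\<^sup>+n. indicator unit_square (X n \<omega>) * ?\<tau> \<omega> n \<partial>count_space UNIV)"
    proof (rule nn_integral_mono)
      fix n
      have "(\<Sum>a\<in>K. indicator (C a) (X n \<omega>) :: ennreal) = indicator (\<Union>a\<in>K. C a) (X n \<omega>)"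
        by (rule indicator_UN_disjoint[symmetric])
           (auto simp: K_def C_def disjoint_family_on_def grid_cell_disjoint)
      also have "\<dots> \<le> indicator unit_square (X n \<omega>)"
      proof -
        have "C a \<subseteq> unit_square" if "a \<in> K" for a
        proof
          fix x assume "x \<in> C a"
          then have x: "of_int (fst a) / j \<le> fst x" "fst x < of_int (fst a + 1) / j"
            "of_int (snd a) / j \<le> snd x" "snd x < of_int (snd a + 1) / j"
            using j by (auto simp: C_def grid_cell_eq)
          have "0 \<le> fst a" "fst a + 1 \<le> int k" "0 \<le> snd a" "snd a + 1 \<le> int k"
            using that by (auto simp: K_def)
          then have "0 \<le> real_of_int (fst a)" "real_of_int (fst a + 1) \<le> j"
            "0 \<le> real_of_int (snd a)" "real_of_int (snd a + 1) \<le> j"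
            unfolding j_def by linarith+
          then have "0 \<le> real_of_int (fst a) / j" "real_of_int (fst a + 1) / j \<le> 1"
            "0 \<le> real_of_int (snd a) / j" "real_of_int (snd a + 1) / j \<le> 1"
            using j by (simp_all only: divide_le_eq_1_pos zero_le_divide_iff) auto
          then have "0 \<le> fst x" "fst x \<le> 1" "0 \<le> snd x" "snd x \<le> 1"
            using x by linarith+
          then show "x \<in> unit_square" by (auto simp: mem_Times_iff)
        qed
        then show ?thesis by (auto split: split_indicator)
      qed
      finally show "(\<Sum>a\<in>K. indicator (C a) (X n \<omega>) * ?\<tau> \<omega> n) \<le> indicator unit_square (X n \<omega>) * ?\<tau> \<omega> n"
        by (simp add: sum_distrib_right[symmetric] mult_right_mono)
    qed
    finally show ?thesis .
  qed
  have cell: "ennreal (lp / j\<^sup>2 * exp (- (lp / j\<^sup>2)) * ((1 - exp (- (lp * A))) / (lp * A)))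
      \<le> (\<integral>\<^sup>+u. \<integral>\<^sup>+\<omega>. ?h a \<omega> u \<partial>M \<partial>lborel)" for a
  proof -
    define c where "c = lp / j\<^sup>2 * exp (- (lp / j\<^sup>2))"
    have "c \<ge> 0" using lp_pos by (simp add: c_def)
    have mJ: "measure lborel (J a) \<le> A"
    proof -
      have "measure lborel (J a) \<le> measure lborel (ball (grid_point j a) (\<delta> + 2 / j))"
        by (rule measure_mono_fmeasurable) (auto simp: J_def intro!: bounded_borel_fmeasurable)
      also have "\<dots> = A"
        using delta_pos j by (subst measure_disc) (auto simp: A_def j_def)
      finally show ?thesis .
    qed
    have "ennreal (c * ((1 - exp (- (lp * A))) / (lp * A)))
        = ennreal c * (\<integral>\<^sup>+u. ennreal (exp (- (lp * A * u))) * indicator {0..1} u \<partial>lborel)"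
      unfolding ennreal_mult'[OF \<open>c \<ge> 0\<close>] using integral_exp_linear[of "lp * A" 1] lp_pos A by simp
    also have "\<dots> = (\<integral>\<^sup>+u. ennreal c * (ennreal (exp (- (lp * A * u))) * indicator {0..1} u) \<partial>lborel)"
      by (rule nn_integral_cmult[symmetric]) simp
    also have "\<dots> \<le> (\<integral>\<^sup>+u. \<integral>\<^sup>+\<omega>. ?h a \<omega> u \<partial>M \<partial>lborel)"
    proof (rule nn_integral_mono)
      fix u :: real
      show "ennreal c * (ennreal (exp (- (lp * A * u))) * indicator {0..1} u) \<le> (\<integral>\<^sup>+\<omega>. ?h a \<omega> u \<partial>M)"
      proof (cases "u \<in> {0..1}")
        case True
        have "(\<integral>\<^sup>+\<omega>. ?h a \<omega> u \<partial>M) = (\<integral>\<^sup>+\<omega>. (\<Prod>i<2. ([\<lambda>m. of_bool (m = 1), \<lambda>m. ennreal ((1 - u) ^ m)] ! i)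
            (point_count X ([C a, J a] ! i) \<omega>)) \<partial>M)"
          using True by (simp add: numeral_2_eq_2 lessThan_Suc mult.commute)
        also have "\<dots> = (\<Prod>i<2. \<integral>\<^sup>+\<omega>. ([\<lambda>m. of_bool (m = 1), \<lambda>m. ennreal ((1 - u) ^ m)] ! i)
            (point_count X ([C a, J a] ! i) \<omega>) \<partial>M)"
        proof (rule poisson_process_nn_integral_prod[OF parents])
          fix i :: nat assume "i < 2"
          then show "[C a, J a] ! i \<in> sets borel" "bounded ([C a, J a] ! i)"
            using bdd[of a] by (auto simp: less_2_cases_iff)
        next
          have "{..<2} = {0, 1 :: nat}" by auto
          then show "disjoint_family_on (\<lambda>i. [C a, J a] ! i) {..<2}"
            by (auto simp: disjoint_family_on_def J_def)
        qed
        also have "\<dots> = (\<integral>\<^sup>+\<omega>. of_bool (point_count X (C a) \<omega> = 1) \<partial>M) *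
            (\<integral>\<^sup>+\<omega>. ennreal ((1 - u) ^ point_count X (J a) \<omega>) \<partial>M)"
          by (simp add: numeral_2_eq_2 lessThan_Suc mult.commute)
        also have "\<dots> = ennreal c * ennreal (exp (- (lp * measure lborel (J a) * u)))"
          using True bdd lp_pos j
          by (subst poisson_process_nn_integral_count_eq_1[OF parents], simp, simp, simp,
              subst poisson_process_nn_integral_power_count[OF parents])
             (simp_all add: c_def C_def measure_grid_cell)
        also have "\<dots> \<ge> ennreal c * ennreal (exp (- (lp * A * u)))"
          using mJ lp_pos True by (intro mult_left_mono ennreal_leI) (auto intro!: mult_right_mono)
        finally show ?thesis using True by simp
      qed simp
    qed
    finally show ?thesis by (simp add: c_def)
  qed
  interpret MU: pair_sigma_finite M "lborel :: real measure" ..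
  \<comment> \<open>The number of cells cancels their area 1 / k^2, and the factor lp of the
    probability of a single point cancels the lp below the one-point factor.\<close>
  have "ennreal (exp (- (lp / (real k)\<^sup>2)) * ((1 - exp (- (lp * A))) / A))
      = (\<Sum>a\<in>K. ennreal (lp / j\<^sup>2 * exp (- (lp / j\<^sup>2)) * ((1 - exp (- (lp * A))) / (lp * A))))"
  proof -
    have "card K = k * k" by (simp add: K_def)
    then have "(\<Sum>a\<in>K. ennreal (lp / j\<^sup>2 * exp (- (lp / j\<^sup>2)) * ((1 - exp (- (lp * A))) / (lp * A))))
        = ennreal (real (k * k)) * ennreal (lp / j\<^sup>2 * exp (- (lp / j\<^sup>2)) * ((1 - exp (- (lp * A))) / (lp * A)))"
      by (simp only: sum_constant ennreal_of_nat_eq_real_of_nat)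
    also have "\<dots> = ennreal (real (k * k) * (lp / j\<^sup>2 * exp (- (lp / j\<^sup>2)) * ((1 - exp (- (lp * A))) / (lp * A))))"
      by (rule ennreal_mult'[symmetric]) simp
    also have "real (k * k) * (lp / j\<^sup>2 * exp (- (lp / j\<^sup>2)) * ((1 - exp (- (lp * A))) / (lp * A)))
        = exp (- (lp / j\<^sup>2)) * ((1 - exp (- (lp * A))) / A)"
      using j lp_pos A by (simp add: j_def power2_eq_square)
    finally show ?thesis by (simp add: j_def)
  qed
  also have "\<dots> \<le> (\<Sum>a\<in>K. \<integral>\<^sup>+u. \<integral>\<^sup>+\<omega>. ?h a \<omega> u \<partial>M \<partial>lborel)"
    by (intro sum_mono cell)
  also have "\<dots> = (\<Sum>a\<in>K. \<integral>\<^sup>+\<omega>. \<integral>\<^sup>+u. ?h a \<omega> u \<partial>lborel \<partial>M)"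
    by (intro sum.cong refl MU.Fubini') (simp add: split_beta)
  also have "\<dots> = (\<integral>\<^sup>+\<omega>. (\<Sum>a\<in>K. \<integral>\<^sup>+u. ?h a \<omega> u \<partial>lborel) \<partial>M)"
    by (intro nn_integral_sum[symmetric] lborel.borel_measurable_nn_integral) (simp add: split_beta)
  also have "\<dots> \<le> intensity M (matern_II_points \<delta> X U H)"
    unfolding I
    by (rule nn_integral_mono_AE, use AE_good in eventually_elim) (use pointwise in blast)
  finally show ?thesis .
qed


section \<open>From the Palm expectation to sums over pairs\<close>

lemma nn_integral_fading: "(\<integral>\<^sup>+\<omega>. ennreal (H n \<omega>) \<partial>M) = 1"
proof -
  \<comment> \<open>\<open>expectation\<close> of a non-integrable function is 0, so mean 1 entails
    integrability.\<close>
  have "integrable M (H n)"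
    using fading_mean[of n] not_integrable_integral_eq[of M "H n"] by (metis zero_neq_one)
  then show ?thesis
    using nn_integral_eq_integral[OF _ fading_nonneg] fading_mean by simp
qed

lemma H_measurable [measurable]: "random_variable borel (H n)"
  using fading_indep[of n] by (simp add: indep_elements_def)

text \<open>By injectivity, sums over the random set turn into sums over indices, and the removal of
  the location itself in \<open>shift_reduce\<close> turns into m \<noteq> n.\<close>

lemma palm_sum_eq:
  assumes "inj (\<lambda>n. X n \<omega>)" and g: "\<And>r. r \<ge> 0 \<Longrightarrow> g r \<ge> 0"
  shows "(\<integral>\<^sup>+p. interference g (shift_reduce (fst p) (matern_II_points \<delta> X U H \<omega>))
              \<partial>count_space {p \<in> matern_II_points \<delta> X U H \<omega>. fst p \<in> B}) =
    (\<integral>\<^sup>+n. \<integral>\<^sup>+m. indicator B (X n \<omega>) * of_bool (ret \<omega> \<omega> n \<and> ret \<omega> \<omega> m \<and> m \<noteq> n) *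
       ennreal (g (norm (X m \<omega> - X n \<omega>))) * ennreal (H m \<omega>) \<partial>count_space UNIV \<partial>count_space UNIV)"
proof -
  let ?\<Phi> = "matern_II_points \<delta> X U H \<omega>"
  have inner: "interference g (shift_reduce (X n \<omega>) ?\<Phi>) =
      (\<integral>\<^sup>+m. of_bool (ret \<omega> \<omega> m \<and> m \<noteq> n) * ennreal (g (norm (X m \<omega> - X n \<omega>))) * ennreal (H m \<omega>) \<partial>count_space UNIV)" for n
  proof -
    have "bij_betw (\<lambda>m. (X m \<omega> - X n \<omega>, H m \<omega>)) {m. ret \<omega> \<omega> m \<and> m \<noteq> n} (shift_reduce (X n \<omega>) ?\<Phi>)"
    proof (rule bij_betw_imageI)
      show "inj_on (\<lambda>m. (X m \<omega> - X n \<omega>, H m \<omega>)) {m. ret \<omega> \<omega> m \<and> m \<noteq> n}"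
        using assms(1) by (auto simp: inj_on_def)
      show "(\<lambda>m. (X m \<omega> - X n \<omega>, H m \<omega>)) ` {m. ret \<omega> \<omega> m \<and> m \<noteq> n} = shift_reduce (X n \<omega>) ?\<Phi>"
      proof (intro equalityI subsetI)
        fix q assume "q \<in> (\<lambda>m. (X m \<omega> - X n \<omega>, H m \<omega>)) ` {m. ret \<omega> \<omega> m \<and> m \<noteq> n}"
        then obtain m where m: "q = (X m \<omega> - X n \<omega>, H m \<omega>)" "ret \<omega> \<omega> m" "m \<noteq> n" by blast
        moreover have "X m \<omega> \<noteq> X n \<omega>" using injD[OF assms(1), of m n] m(3) by auto
        ultimately show "q \<in> shift_reduce (X n \<omega>) ?\<Phi>"
          unfolding shift_reduce_def matern_II_points_def by blast
      next
        fix q assume "q \<in> shift_reduce (X n \<omega>) ?\<Phi>"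
        then obtain m where "q = (X m \<omega> - X n \<omega>, H m \<omega>)" "ret \<omega> \<omega> m" "X m \<omega> \<noteq> X n \<omega>"
          unfolding shift_reduce_def matern_II_points_def by auto
        then show "q \<in> (\<lambda>m. (X m \<omega> - X n \<omega>, H m \<omega>)) ` {m. ret \<omega> \<omega> m \<and> m \<noteq> n}"
          by blast
      qed
    qed
    then have "interference g (shift_reduce (X n \<omega>) ?\<Phi>) =
        (\<integral>\<^sup>+m. (case (X m \<omega> - X n \<omega>, H m \<omega>) of (x, h) \<Rightarrow> ennreal (h * g (norm x))) \<partial>count_space {m. ret \<omega> \<omega> m \<and> m \<noteq> n})"
      unfolding interference_def by (rule nn_integral_bij_count_space[symmetric])
    also have "\<dots> = (\<integral>\<^sup>+m. ennreal (H m \<omega> * g (norm (X m \<omega> - X n \<omega>))) * indicator {m. ret \<omega> \<omega> m \<and> m \<noteq> n} m \<partial>count_space UNIV)"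
      by (subst nn_integral_count_space_indicator) auto
    also have "\<dots> = (\<integral>\<^sup>+m. of_bool (ret \<omega> \<omega> m \<and> m \<noteq> n) * ennreal (g (norm (X m \<omega> - X n \<omega>))) * ennreal (H m \<omega>) \<partial>count_space UNIV)"
      by (intro nn_integral_cong) (auto simp: ennreal_mult'' g mult.commute split: split_indicator)
    finally show ?thesis .
  qed
  have "(\<integral>\<^sup>+p. interference g (shift_reduce (fst p) ?\<Phi>) \<partial>count_space {p \<in> ?\<Phi>. fst p \<in> B})
      = (\<integral>\<^sup>+n. interference g (shift_reduce (fst (X n \<omega>, H n \<omega>)) ?\<Phi>) \<partial>count_space {n. ret \<omega> \<omega> n \<and> X n \<omega> \<in> B})"
    by (rule nn_integral_bij_count_space[OF matern_II_points_window[OF assms(1)], symmetric])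
  also have "\<dots> = (\<integral>\<^sup>+n. interference g (shift_reduce (X n \<omega>) ?\<Phi>) * indicator {n. ret \<omega> \<omega> n \<and> X n \<omega> \<in> B} n \<partial>count_space UNIV)"
    by (subst nn_integral_count_space_indicator) auto
  also have "\<dots> = (\<integral>\<^sup>+n. \<integral>\<^sup>+m. indicator B (X n \<omega>) * of_bool (ret \<omega> \<omega> n \<and> ret \<omega> \<omega> m \<and> m \<noteq> n) *
       ennreal (g (norm (X m \<omega> - X n \<omega>))) * ennreal (H m \<omega>) \<partial>count_space UNIV \<partial>count_space UNIV)"
    by (intro nn_integral_cong) (auto simp: inner split: split_indicator)
  finally show ?thesis .
qed

text \<open>The intensity times the integral of G against the reduced second moment measure: the
  numerator of a Palm expectation, with the fading already averaged out.\<close>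

definition pair_sum :: "(real \<times> real \<Rightarrow> ennreal) \<Rightarrow> ennreal" where
  "pair_sum G = (\<integral>\<^sup>+\<omega>. \<integral>\<^sup>+n. \<integral>\<^sup>+m. indicator unit_square (X n \<omega>) * of_bool (ret \<omega> \<omega> n \<and> ret \<omega> \<omega> m \<and> m \<noteq> n) *
       G (X m \<omega> - X n \<omega>) \<partial>count_space UNIV \<partial>count_space UNIV \<partial>M)"

text \<open>Each term is a function of the thinned process times a single coefficient
  \<open>H m\<close>, which is independent of that process and has mean 1. Sums are pulled out of
  the expectation to reach the single terms and put back afterwards.\<close>

lemma nn_integral_palm_sum:
  assumes [measurable]: "(\<lambda>z :: real \<times> real. g (norm z)) \<in> borel_measurable borel"
    and g: "\<And>r. r \<ge> 0 \<Longrightarrow> g r \<ge> 0"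
  shows "(\<integral>\<^sup>+\<omega>. (\<integral>\<^sup>+p. interference g (shift_reduce (fst p) (matern_II_points \<delta> X U H \<omega>))
              \<partial>count_space {p \<in> matern_II_points \<delta> X U H \<omega>. fst p \<in> unit_square}) \<partial>M) =
    pair_sum (\<lambda>z. ennreal (g (norm z)))"
proof -
  let ?N = "PiM UNIV (\<lambda>_. borel \<Otimes>\<^sub>M count_space UNIV) :: (nat \<Rightarrow> (real \<times> real) \<times> bool) measure"
  let ?f = "\<lambda>n m y. indicator unit_square (fst (y n)) * of_bool (snd (y n) \<and> snd (y m) \<and> m \<noteq> n) *
       ennreal (g (norm (fst (y m) - fst (y n))))"
  let ?Y = "\<lambda>\<omega> i. (X i \<omega>, ret \<omega> \<omega> i)"
  have f [measurable]: "?f n m \<in> borel_measurable ?N" for n m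
    by measurable
  have [measurable]: "random_variable ?N ?Y"
    using fading_indep[of 0] by (simp add: indep_elements_def)
  have term_eq: "(\<integral>\<^sup>+\<omega>. ?f n m (?Y \<omega>) * ennreal (H m \<omega>) \<partial>M) = (\<integral>\<^sup>+\<omega>. ?f n m (?Y \<omega>) \<partial>M)" for n m
  proof -
    have "(\<integral>\<^sup>+\<omega>. ?f n m (?Y \<omega>) * ennreal (H m \<omega>) \<partial>M)
        = (\<integral>\<^sup>+\<omega>. \<integral>\<^sup>+\<omega>'. ?f n m (?Y \<omega>) * ennreal (H m \<omega>') \<partial>M \<partial>M)"
      by (rule indep_elements_nn_integral[OF fading_indep, where F = "\<lambda>y h. ?f n m y * ennreal h"])
         (simp add: split_beta)
    also have "\<dots> = (\<integral>\<^sup>+\<omega>. ?f n m (?Y \<omega>) \<partial>M)"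
      by (intro nn_integral_cong) (subst nn_integral_cmult, simp, simp add: nn_integral_fading)
    finally show ?thesis .
  qed
  have "(\<integral>\<^sup>+\<omega>. (\<integral>\<^sup>+p. interference g (shift_reduce (fst p) (matern_II_points \<delta> X U H \<omega>))
              \<partial>count_space {p \<in> matern_II_points \<delta> X U H \<omega>. fst p \<in> unit_square}) \<partial>M)
      = (\<integral>\<^sup>+\<omega>. \<integral>\<^sup>+n. \<integral>\<^sup>+m. ?f n m (?Y \<omega>) * ennreal (H m \<omega>) \<partial>count_space UNIV \<partial>count_space UNIV \<partial>M)"
    using AE_good by (intro nn_integral_cong_AE, eventually_elim) (simp add: palm_sum_eq g)
  also have "\<dots> = (\<integral>\<^sup>+n. \<integral>\<^sup>+\<omega>. \<integral>\<^sup>+m. ?f n m (?Y \<omega>) * ennreal (H m \<omega>) \<partial>count_space UNIV \<partial>M \<partial>count_space UNIV)"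
    by (rule nn_integral_count_space_nn_integral) simp_all
  also have "\<dots> = (\<integral>\<^sup>+n. \<integral>\<^sup>+m. \<integral>\<^sup>+\<omega>. ?f n m (?Y \<omega>) * ennreal (H m \<omega>) \<partial>M \<partial>count_space UNIV \<partial>count_space UNIV)"
    by (intro nn_integral_cong nn_integral_count_space_nn_integral) simp_all
  also have "\<dots> = (\<integral>\<^sup>+n. \<integral>\<^sup>+m. \<integral>\<^sup>+\<omega>. ?f n m (?Y \<omega>) \<partial>M \<partial>count_space UNIV \<partial>count_space UNIV)"
    by (simp only: term_eq)
  also have "\<dots> = (\<integral>\<^sup>+n. \<integral>\<^sup>+\<omega>. \<integral>\<^sup>+m. ?f n m (?Y \<omega>) \<partial>count_space UNIV \<partial>M \<partial>count_space UNIV)"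
    by (intro nn_integral_cong nn_integral_count_space_nn_integral[symmetric]) simp_all
  also have "\<dots> = (\<integral>\<^sup>+\<omega>. \<integral>\<^sup>+n. \<integral>\<^sup>+m. ?f n m (?Y \<omega>) \<partial>count_space UNIV \<partial>count_space UNIV \<partial>M)"
    by (rule nn_integral_count_space_nn_integral[symmetric]) simp_all
  finally show ?thesis
    by (simp add: pair_sum_def)
qed

lemma pair_sum_add:
  assumes [measurable]: "G1 \<in> borel_measurable borel" "G2 \<in> borel_measurable borel"
  shows "pair_sum (\<lambda>z. G1 z + G2 z) = pair_sum G1 + pair_sum G2"
  unfolding pair_sum_def distrib_left by (simp add: nn_integral_add)

text \<open>Points and marks are independent, so for each pair of indices the marks can be averaged
  first, with the points frozen; the indicator of joint retention becomes its probability.\<close>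

lemma pair_sum_retention:
  assumes [measurable]: "G \<in> borel_measurable borel"
  shows "pair_sum G = (\<integral>\<^sup>+\<omega>. \<integral>\<^sup>+n. \<integral>\<^sup>+m. indicator unit_square (X n \<omega>) * of_bool (m \<noteq> n) * G (X m \<omega> - X n \<omega>) *
      emeasure M {\<omega>' \<in> space M. ret \<omega> \<omega>' n \<and> ret \<omega> \<omega>' m} \<partial>count_space UNIV \<partial>count_space UNIV \<partial>M)"
proof -
  let ?f = "\<lambda>n m \<omega> \<omega>'. indicator unit_square (X n \<omega>) * of_bool (ret \<omega> \<omega>' n \<and> ret \<omega> \<omega>' m \<and> m \<noteq> n) * G (X m \<omega> - X n \<omega>)"
  let ?g = "\<lambda>n m \<omega>. indicator unit_square (X n \<omega>) * of_bool (m \<noteq> n) * G (X m \<omega> - X n \<omega>) *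
      emeasure M {\<omega>' \<in> space M. ret \<omega> \<omega>' n \<and> ret \<omega> \<omega>' m}"
  have [measurable]: "(\<lambda>p. ?f n m (fst p) (snd p)) \<in> borel_measurable (M \<Otimes>\<^sub>M M)" for n m
    by measurable
  have inner: "(\<integral>\<^sup>+\<omega>'. ?f n m \<omega> \<omega>' \<partial>M) = ?g n m \<omega>" for n m \<omega>
  proof -
    have "(\<integral>\<^sup>+\<omega>'. ?f n m \<omega> \<omega>' \<partial>M) = (\<integral>\<^sup>+\<omega>'. indicator unit_square (X n \<omega>) * of_bool (m \<noteq> n) * G (X m \<omega> - X n \<omega>) *
        indicator {\<omega>' \<in> space M. ret \<omega> \<omega>' n \<and> ret \<omega> \<omega>' m} \<omega>' \<partial>M)"
      by (intro nn_integral_cong) (auto split: split_indicator)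
    also have "\<dots> = ?g n m \<omega>"
      by (rule nn_integral_cmult_indicator) measurable
    finally show ?thesis .
  qed
  have [measurable]: "?g n m \<in> borel_measurable M" for n m
    unfolding inner[symmetric] by (rule borel_measurable_nn_integral) (simp add: split_beta)
  have term_eq: "(\<integral>\<^sup>+\<omega>. ?f n m \<omega> \<omega> \<partial>M) = (\<integral>\<^sup>+\<omega>. ?g n m \<omega> \<partial>M)" for n m
    unfolding inner[symmetric]
    by (rule indep_elements_nn_integral[OF points_marks_indep,
          where F = "\<lambda>x u. indicator unit_square (x n) * of_bool (retained_II \<delta> x u n \<and> retained_II \<delta> x u m \<and> m \<noteq> n) * G (x m - x n)"])
       (simp add: split_beta)
  have "pair_sum G = (\<integral>\<^sup>+n. \<integral>\<^sup>+\<omega>. \<integral>\<^sup>+m. ?f n m \<omega> \<omega> \<partial>count_space UNIV \<partial>M \<partial>count_space UNIV)"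
    unfolding pair_sum_def by (rule nn_integral_count_space_nn_integral) simp_all
  also have "\<dots> = (\<integral>\<^sup>+n. \<integral>\<^sup>+m. \<integral>\<^sup>+\<omega>. ?f n m \<omega> \<omega> \<partial>M \<partial>count_space UNIV \<partial>count_space UNIV)"
    by (intro nn_integral_cong nn_integral_count_space_nn_integral) simp_all
  also have "\<dots> = (\<integral>\<^sup>+n. \<integral>\<^sup>+m. \<integral>\<^sup>+\<omega>. ?g n m \<omega> \<partial>M \<partial>count_space UNIV \<partial>count_space UNIV)"
    by (simp only: term_eq)
  also have "\<dots> = (\<integral>\<^sup>+n. \<integral>\<^sup>+\<omega>. \<integral>\<^sup>+m. ?g n m \<omega> \<partial>count_space UNIV \<partial>M \<partial>count_space UNIV)"
    by (intro nn_integral_cong nn_integral_count_space_nn_integral[symmetric]) simp_all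
  also have "\<dots> = (\<integral>\<^sup>+\<omega>. \<integral>\<^sup>+n. \<integral>\<^sup>+m. ?g n m \<omega> \<partial>count_space UNIV \<partial>count_space UNIV \<partial>M)"
    by (rule nn_integral_count_space_nn_integral[symmetric]) simp_all
  finally show ?thesis .
qed

text \<open>Closer pairs are jointly retained only if their marks tie, so they contribute nothing
  and G may be cut off below \<delta>.\<close>

lemma pair_sum_hard_core:
  assumes [measurable]: "G \<in> borel_measurable borel"
  shows "pair_sum G = pair_sum (\<lambda>z. G z * indicator {z. \<delta> \<le> norm z} z)"
proof -
  have *: "of_bool (m \<noteq> n) * emeasure M {\<omega>' \<in> space M. ret \<omega> \<omega>' n \<and> ret \<omega> \<omega>' m} =
      indicator {z. \<delta> \<le> norm z} (X m \<omega> - X n \<omega>) * (of_bool (m \<noteq> n) * emeasure M {\<omega>' \<in> space M. ret \<omega> \<omega>' n \<and> ret \<omega> \<omega>' m})" for n m \<omega>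
    using emeasure_two_retained_eq_0[OF marks_indep marks_uniform, of n m "\<lambda>j. X j \<omega>" \<delta>]
    by (auto simp: dist_norm norm_minus_commute split: split_indicator)
  have "pair_sum G = (\<integral>\<^sup>+\<omega>. \<integral>\<^sup>+n. \<integral>\<^sup>+m. indicator unit_square (X n \<omega>) * G (X m \<omega> - X n \<omega>) *
      (of_bool (m \<noteq> n) * emeasure M {\<omega>' \<in> space M. ret \<omega> \<omega>' n \<and> ret \<omega> \<omega>' m}) \<partial>count_space UNIV \<partial>count_space UNIV \<partial>M)"
    by (simp only: pair_sum_retention[OF assms] mult_ac)
  also have "\<dots> = pair_sum (\<lambda>z. G z * indicator {z. \<delta> \<le> norm z} z)"
    by (subst *, subst pair_sum_retention) (simp_all add: mult_ac)
  finally show ?thesis .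
qed


text \<open>
  Two retained points in the grid cells \<open>a\<close> and \<open>b\<close> exclude smaller marks from discs around the
  grid points. The radius \<open>\<rho> = \<delta> - 4 / k\<close> is small enough for these discs to be contained in the
  discs of radius \<open>\<delta>\<close> around the points, and distance \<open>s \<delta>\<close> of the points implies
  distance \<open>s \<rho>\<close> of the grid points.
\<close>

lemma pair_sum_le_grid:
  fixes k :: nat and G :: "real \<times> real \<Rightarrow> ennreal"
  assumes G [measurable]: "G \<in> borel_measurable borel"
    and s: "1 \<le> s" and supp: "\<And>z. G z \<noteq> 0 \<Longrightarrow> s * \<delta> \<le> norm z"
    and lens: "\<And>\<rho> (p :: real \<times> real) q. 0 < \<rho> \<Longrightarrow> s * \<rho> \<le> dist p q \<Longrightarrow>
        measure lborel (ball p \<rho> \<inter> ball q \<rho>) \<le> l * \<rho>\<^sup>2"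
    and l: "0 \<le> l"
    and k: "4 / real k < \<delta>" "k > 0"
  defines "\<rho> \<equiv> \<delta> - 4 / real k"
  defines "A \<equiv> pi * \<rho>\<^sup>2 - 2 / (real k)\<^sup>2" and "S \<equiv> (pi - l) * \<rho>\<^sup>2 - 2 / (real k)\<^sup>2"
  assumes S: "0 < S"
  shows "pair_sum G \<le> ennreal (lp\<^sup>2 * (2 * A / (A + S) * ((1 - exp (- (lp * A))) / (lp * A))\<^sup>2)) * (\<integral>\<^sup>+z. G z \<partial>lborel)"
proof -
  define j where "j = real k"
  have j: "j > 0" "4 / j < \<delta>" using k by (simp_all add: j_def)
  have \<rho>: "\<rho> > 0" "\<rho> + 4 / j = \<delta>" using k by (simp_all add: \<rho>_def j_def)
  have "S \<le> A" using l by (simp add: S_def A_def algebra_simps)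
  define C where "C = grid_cell j"
  define p where "p = grid_point j"
  \<comment> \<open>Both cells are removed from both discs. The counts in P and Q are then
    independent of the points in the cells, and the two points themselves are not among the
    competitors. The loss of area is at most \<open>2 / (real k)\<^sup>2\<close>, the correction in
    \<open>A\<close> and \<open>S\<close>.\<close>
  define P where "P a b = ball (p a) \<rho> - (C a \<union> C b)" for a b
  define Q where "Q a b = ball (p b) \<rho> - (C a \<union> C b)" for a b
  have [measurable]: "C a \<in> sets borel" "P a b \<in> sets borel" "Q a b \<in> sets borel" for a b
    by (simp_all add: C_def P_def Q_def)
  have bdd: "bounded (C a)" "bounded (P a b)" "bounded (Q a b)" for a b
    using bounded_grid_cell[OF j(1)] by (simp_all add: C_def P_def Q_def bounded_diff)
  have bdd': "bounded (P a b - Q a b)" "bounded (Q a b - P a b)" "bounded (P a b \<inter> Q a b)" for a b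
    using bdd by (simp_all add: bounded_diff bounded_Int)
  define N1 N2 N3 where "N1 a b = point_count X (P a b - Q a b)" and "N2 a b = point_count X (Q a b - P a b)"
    and "N3 a b = point_count X (P a b \<inter> Q a b)" for a b
  have [measurable]: "random_variable (count_space UNIV) (N1 a b)" "random_variable (count_space UNIV) (N2 a b)"
    "random_variable (count_space UNIV) (N3 a b)" for a b
    using bdd' by (auto simp: N1_def N2_def N3_def intro!: count_measurable)
  define W where "W a b \<omega> u w = ennreal ((1 - u) ^ N1 a b \<omega> * (1 - w) ^ N2 a b \<omega> * (1 - max u w) ^ N3 a b \<omega>) *
      (indicator {0..1} u * indicator {0..1} w)" for a b \<omega> and u w :: real
  let ?F = "\<lambda>x y. indicator unit_square x * G (y - x)"
  let ?T = "\<lambda>a b \<omega>. \<integral>\<^sup>+n. \<integral>\<^sup>+m. indicator (C a) (X n \<omega>) * indicator (C b) (X m \<omega>) * ?F (X n \<omega>) (X m \<omega>)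
      \<partial>count_space UNIV \<partial>count_space UNIV"
  let ?D = "{(a, b). a \<noteq> b} :: ((int \<times> int) \<times> int \<times> int) set"
  have W_meas [measurable]: "(\<lambda>q. W a b (fst (fst q)) (snd (fst q)) (snd q)) \<in> borel_measurable ((M \<Otimes>\<^sub>M lborel) \<Otimes>\<^sub>M lborel)" for a b
    unfolding W_def by measurable
  have W_int [measurable]: "(\<lambda>q. \<integral>\<^sup>+w. W a b (fst q) (snd q) w \<partial>lborel) \<in> borel_measurable (M \<Otimes>\<^sub>M lborel)" for a b
    by (rule lborel.borel_measurable_nn_integral) (simp add: split_beta)
  have W_int2 [measurable]: "(\<lambda>\<omega>. \<integral>\<^sup>+u. \<integral>\<^sup>+w. W a b \<omega> u w \<partial>lborel \<partial>lborel) \<in> borel_measurable M" for a b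
    by (rule lborel.borel_measurable_nn_integral) (simp add: split_beta)
  have W_sec [measurable]: "(\<lambda>q. W a b \<omega> (fst q) (snd q)) \<in> borel_measurable (lborel \<Otimes>\<^sub>M lborel)" for a b \<omega>
    unfolding W_def by measurable
  have W_sec_int [measurable]: "(\<lambda>u. \<integral>\<^sup>+w. W a b \<omega> u w \<partial>lborel) \<in> borel_measurable lborel" for a b \<omega>
    by (rule lborel.borel_measurable_nn_integral) (simp add: split_beta)
  have W_sec2 [measurable]: "W a b \<omega> u \<in> borel_measurable lborel" for a b \<omega> u
    unfolding W_def by measurable
  have W_sec3 [measurable]: "(\<lambda>q. W a b (fst q) u (snd q)) \<in> borel_measurable (M \<Otimes>\<^sub>M lborel)" for a b u
    unfolding W_def by measurable
  have T_meas [measurable]: "?T a b \<in> borel_measurable M" for a b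
    by measurable
  have pointwise: "(\<integral>\<^sup>+n. \<integral>\<^sup>+m. indicator unit_square (X n \<omega>) * of_bool (m \<noteq> n) * G (X m \<omega> - X n \<omega>) *
        emeasure M {\<omega>' \<in> space M. ret \<omega> \<omega>' n \<and> ret \<omega> \<omega>' m} \<partial>count_space UNIV \<partial>count_space UNIV)
      \<le> (\<integral>\<^sup>+(a, b). ?T a b \<omega> * (\<integral>\<^sup>+u. \<integral>\<^sup>+w. W a b \<omega> u w \<partial>lborel \<partial>lborel) \<partial>count_space ?D)"
    if good: "\<forall>B. bounded B \<longrightarrow> finite {n. X n \<omega> \<in> B}" for \<omega>
  proof -
    let ?w = "\<lambda>a b. \<integral>\<^sup>+u. \<integral>\<^sup>+w. W a b \<omega> u w \<partial>lborel \<partial>lborel"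
    let ?t = "\<lambda>n m a b. indicator (C a) (X n \<omega>) * indicator (C b) (X m \<omega>) * ?F (X n \<omega>) (X m \<omega>) * ?w a b"
    have pair: "indicator unit_square (X n \<omega>) * of_bool (m \<noteq> n) * G (X m \<omega> - X n \<omega>) *
        emeasure M {\<omega>' \<in> space M. ret \<omega> \<omega>' n \<and> ret \<omega> \<omega>' m} \<le> (\<integral>\<^sup>+(a, b). ?t n m a b \<partial>count_space ?D)" for n m
    proof (cases "G (X m \<omega> - X n \<omega>) = 0 \<or> m = n")
      case False
      then have "m \<noteq> n" and dist: "s * \<delta> \<le> dist (X n \<omega>) (X m \<omega>)"
        using supp[of "X m \<omega> - X n \<omega>"] by (auto simp: dist_norm norm_minus_commute)
      obtain a b where ab: "X n \<omega> \<in> C a" "X m \<omega> \<in> C b"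
        unfolding C_def using mem_grid_cell by blast
      have da: "dist (X n \<omega>) (p a) < 2 / j" and db: "dist (X m \<omega>) (p b) < 2 / j"
        using ab dist_grid_point[OF j(1)] by (simp_all add: C_def p_def)
      \<comment> \<open>Points of one cell are less than 4 / j apart, which is below \<delta>. Hence
        \<open>?D\<close> may be restricted to pairs of different cells.\<close>
      have "a \<noteq> b"
      proof
        assume "a = b"
        then have "dist (X n \<omega>) (X m \<omega>) < 2 / j + 2 / j"
          using da db dist_triangle2[of "X n \<omega>" "X m \<omega>" "p a"] by simp
        also have "\<dots> < \<delta>" using j(2) by simp
        also have "\<delta> \<le> s * \<delta>" using s delta_pos by simp
        finally show False using dist by simp
      qed
      have sub: "ball c \<rho> \<subseteq> cball x \<delta>" if "dist x c < 2 / j" for x c :: "real \<times> real"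
      proof
        fix y assume "y \<in> ball c \<rho>"
        then have "dist x y \<le> 2 / j + \<rho>"
          using that dist_triangle[of x y c] by simp
        also have "2 / j + \<rho> \<le> 4 / j + \<rho>" using j(1) by (simp add: divide_right_mono)
        also have "\<dots> = \<delta>" using \<rho>(2) by simp
        finally show "y \<in> cball x \<delta>" by simp
      qed
      have "emeasure M {\<omega>' \<in> space M. ret \<omega> \<omega>' n \<and> ret \<omega> \<omega>' m} \<le>
          (\<integral>\<^sup>+u\<in>{0..1}. (\<integral>\<^sup>+w\<in>{0..1}. ennreal ((1 - u) ^ N1 a b \<omega> * (1 - w) ^ N2 a b \<omega> *
             (1 - max u w) ^ N3 a b \<omega>) \<partial>lborel) \<partial>lborel)"
        unfolding N1_def N2_def N3_def
      proof (rule emeasure_two_retained_le[OF marks_indep marks_uniform])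
        show "finite {i. X i \<omega> \<in> P a b}" "finite {i. X i \<omega> \<in> Q a b}"
          using good bdd by blast+
        show "X n \<omega> \<notin> P a b \<union> Q a b" "X m \<omega> \<notin> P a b \<union> Q a b"
          using ab by (auto simp: P_def Q_def)
        show "P a b \<subseteq> cball (X n \<omega>) \<delta>" "Q a b \<subseteq> cball (X m \<omega>) \<delta>"
          using sub[OF da] sub[OF db] by (auto simp: P_def Q_def)
      qed (use \<open>m \<noteq> n\<close> in simp)
      also have "\<dots> = ?w a b"
      proof (rule nn_integral_cong)
        fix u :: real
        show "(\<integral>\<^sup>+w\<in>{0..1}. ennreal ((1 - u) ^ N1 a b \<omega> * (1 - w) ^ N2 a b \<omega> * (1 - max u w) ^ N3 a b \<omega>) \<partial>lborel) * indicator {0..1} u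
            = (\<integral>\<^sup>+w. W a b \<omega> u w \<partial>lborel)"
          by (simp add: W_def split: split_indicator)
      qed
      finally have "indicator unit_square (X n \<omega>) * of_bool (m \<noteq> n) * G (X m \<omega> - X n \<omega>) *
        emeasure M {\<omega>' \<in> space M. ret \<omega> \<omega>' n \<and> ret \<omega> \<omega>' m} \<le> ?t n m a b"
        using ab \<open>m \<noteq> n\<close> by (simp add: mult_left_mono)
      also have "\<dots> \<le> (\<integral>\<^sup>+(a, b). ?t n m a b \<partial>count_space ?D)"
        using nn_integral_ge_point[of "(a, b)" ?D "\<lambda>(a, b). ?t n m a b"] \<open>a \<noteq> b\<close> by simp
      finally show ?thesis .
    qed auto
    have "(\<integral>\<^sup>+n. \<integral>\<^sup>+m. indicator unit_square (X n \<omega>) * of_bool (m \<noteq> n) * G (X m \<omega> - X n \<omega>) *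
        emeasure M {\<omega>' \<in> space M. ret \<omega> \<omega>' n \<and> ret \<omega> \<omega>' m} \<partial>count_space UNIV \<partial>count_space UNIV)
      \<le> (\<integral>\<^sup>+n. \<integral>\<^sup>+m. \<integral>\<^sup>+(a, b). ?t n m a b \<partial>count_space ?D \<partial>count_space UNIV \<partial>count_space UNIV)"
      by (intro nn_integral_mono pair)
    also have "\<dots> = (\<integral>\<^sup>+n. \<integral>\<^sup>+(a, b). (\<integral>\<^sup>+m. ?t n m a b \<partial>count_space UNIV) \<partial>count_space ?D \<partial>count_space UNIV)"
      unfolding split_beta by (intro nn_integral_cong nn_integral_count_space_nn_integral) simp_all
    also have "\<dots> = (\<integral>\<^sup>+(a, b). (\<integral>\<^sup>+n. \<integral>\<^sup>+m. ?t n m a b \<partial>count_space UNIV \<partial>count_space UNIV) \<partial>count_space ?D)"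
      unfolding split_beta by (intro nn_integral_count_space_nn_integral) simp_all
    also have "\<dots> = (\<integral>\<^sup>+(a, b). ?T a b \<omega> * ?w a b \<partial>count_space ?D)"
      by (simp add: nn_integral_multc)
    finally show ?thesis .
  qed
  have expect: "(\<integral>\<^sup>+\<omega>. ?T a b \<omega> * (\<integral>\<^sup>+u. \<integral>\<^sup>+w. W a b \<omega> u w \<partial>lborel \<partial>lborel) \<partial>M)
      \<le> ennreal (lp\<^sup>2 * (2 * A / (A + S) * ((1 - exp (- (lp * A))) / (lp * A))\<^sup>2)) *
        (\<integral>\<^sup>+x. \<integral>\<^sup>+y. indicator (C a) x * indicator (C b) y * ?F x y \<partial>lborel \<partial>lborel)" if "a \<noteq> b" for a b
  proof -
    let ?I = "\<integral>\<^sup>+x. \<integral>\<^sup>+y. indicator (C a) x * indicator (C b) y * ?F x y \<partial>lborel \<partial>lborel"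
    let ?e = "\<lambda>u w. ennreal (exp (- (lp * (min u w * S + max u w * A))))"
    interpret MU: pair_sigma_finite M "lborel :: real measure" ..
    have "(\<integral>\<^sup>+\<omega>. ?T a b \<omega> * (\<integral>\<^sup>+u. \<integral>\<^sup>+w. W a b \<omega> u w \<partial>lborel \<partial>lborel) \<partial>M)
        = (\<integral>\<^sup>+\<omega>. \<integral>\<^sup>+u. ?T a b \<omega> * (\<integral>\<^sup>+w. W a b \<omega> u w \<partial>lborel) \<partial>lborel \<partial>M)"
      by (simp add: nn_integral_cmult)
    also have "\<dots> = (\<integral>\<^sup>+u. \<integral>\<^sup>+\<omega>. ?T a b \<omega> * (\<integral>\<^sup>+w. W a b \<omega> u w \<partial>lborel) \<partial>M \<partial>lborel)"
      by (rule MU.Fubini'[symmetric]) (simp add: split_beta)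
    also have "\<dots> = (\<integral>\<^sup>+u. \<integral>\<^sup>+\<omega>. \<integral>\<^sup>+w. ?T a b \<omega> * W a b \<omega> u w \<partial>lborel \<partial>M \<partial>lborel)"
      by (simp add: nn_integral_cmult)
    also have "\<dots> = (\<integral>\<^sup>+u. \<integral>\<^sup>+w. \<integral>\<^sup>+\<omega>. ?T a b \<omega> * W a b \<omega> u w \<partial>M \<partial>lborel \<partial>lborel)"
      by (intro nn_integral_cong MU.Fubini'[symmetric]) (simp add: split_beta)
    also have "\<dots> \<le> (\<integral>\<^sup>+u. \<integral>\<^sup>+w. ennreal (lp\<^sup>2) * ?I * (?e u w * indicator {0..1} w * indicator {0..1} u) \<partial>lborel \<partial>lborel)"
    proof (intro nn_integral_mono)
      fix u w :: real
      show "(\<integral>\<^sup>+\<omega>. ?T a b \<omega> * W a b \<omega> u w \<partial>M) \<le> ennreal (lp\<^sup>2) * ?I * (?e u w * indicator {0..1} w * indicator {0..1} u)"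
      proof (cases "u \<in> {0..1} \<and> w \<in> {0..1}")
        case True
        define x where "x = lp * (measure lborel (P a b - Q a b) * (1 - (1 - u)) + measure lborel (Q a b - P a b) * (1 - (1 - w)) +
            measure lborel (P a b \<inter> Q a b) * (1 - (1 - max u w)))"
        have "(\<integral>\<^sup>+\<omega>. ?T a b \<omega> * W a b \<omega> u w \<partial>M) = (\<integral>\<^sup>+\<omega>. ?T a b \<omega> *
            ennreal ((1 - u) ^ point_count X (P a b - Q a b) \<omega> * (1 - w) ^ point_count X (Q a b - P a b) \<omega> *
              (1 - max u w) ^ point_count X (P a b \<inter> Q a b) \<omega>) \<partial>M)"
          using True by (simp add: W_def N1_def N2_def N3_def)
        also have "\<dots> = ennreal (lp\<^sup>2 * exp (- x)) * ?I"
          unfolding x_def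
        proof (rule poisson_process_two_point_formula[OF parents])
          show "C a \<inter> C b = {}"
            using that by (simp add: C_def grid_cell_disjoint)
          show "(C a \<union> C b) \<inter> (P a b \<union> Q a b) = {}"
            by (auto simp: P_def Q_def)
          show "(\<lambda>(x, y). ?F x y) \<in> borel_measurable (borel \<Otimes>\<^sub>M borel)"
            by measurable
        qed (use lp_pos bdd True in auto)
        also have "\<dots> = ennreal (lp\<^sup>2) * ?I * ennreal (exp (- x))"
          by (simp add: ennreal_mult mult_ac)
        also have "\<dots> \<le> ennreal (lp\<^sup>2) * ?I * ?e u w"
        \<comment> \<open>If the integral vanishes, both sides do. Otherwise the two cells contain
          points whose difference lies in the support of G, and their distance is what the lens
          bound for the two corners rests on.\<close>
        proof (cases "?I = 0")
          case False
          obtain x' y where xy: "x' \<in> C a" "y \<in> C b" "G (y - x') \<noteq> 0"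
          proof (rule ccontr)
            assume "\<not> thesis"
            then have "x' \<in> C a \<Longrightarrow> y \<in> C b \<Longrightarrow> G (y - x') = 0" for x' y
              using that by blast
            then have "indicator (C a) x' * indicator (C b) y * ?F x' y = 0" for x' y
              by (cases "x' \<in> C a"; cases "y \<in> C b"; simp)
            then have "?I = (\<integral>\<^sup>+x. \<integral>\<^sup>+y. 0 \<partial>(lborel :: (real \<times> real) measure) \<partial>(lborel :: (real \<times> real) measure))"
              by (simp only:)
            then have "?I = 0" by simp
            then show False using False by contradiction
          qed
          \<comment> \<open>Passing from the points to the corners costs less than 4 / j in
            distance; passing from \<delta> to \<rho> gains s times 4 / j, at least as much since s
            \<ge> 1.\<close>
          have "s * \<rho> \<le> dist (p a) (p b)"
          proof -
            have "dist x' (p a) < 2 / j" "dist y (p b) < 2 / j"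
              using xy dist_grid_point[OF j(1)] by (simp_all add: C_def p_def)
            moreover have "s * \<delta> \<le> dist x' y"
              using supp[OF xy(3)] by (simp add: dist_norm norm_minus_commute)
            moreover have "dist x' y \<le> dist x' (p a) + dist (p a) (p b) + dist y (p b)"
              using dist_triangle[of x' y "p a"] dist_triangle[of "p a" y "p b"] by (simp add: dist_commute)
            moreover have "s * (4 / j) \<ge> 4 / j"
              using s j(1) by (simp add: divide_right_mono)
            moreover have "s * \<delta> = s * \<rho> + s * (4 / j)"
              unfolding \<rho>(2)[symmetric] by (rule distrib_left)
            ultimately show ?thesis by linarith
          qed
          then have L: "measure lborel (ball (p a) \<rho> \<inter> ball (p b) \<rho>) \<le> l * \<rho>\<^sup>2"
            by (rule lens[OF \<rho>(1)])
          have cells: "measure lborel (C a \<union> C b) \<le> 2 / j\<^sup>2"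
          proof -
            have "measure lborel (C a \<union> C b) \<le> measure lborel (C a) + measure lborel (C b)"
              by (rule measure_Un_le) simp_all
            then show ?thesis using j(1) by (simp add: C_def measure_grid_cell)
          qed
          have disc: "measure lborel (ball c \<rho>) = pi * \<rho>\<^sup>2" for c :: "real \<times> real"
            using \<rho>(1) by (simp add: measure_disc)
          have sub3: "measure lborel B \<le> measure lborel B1 + measure lborel B2 + measure lborel B3"
            if "B \<subseteq> B1 \<union> B2 \<union> B3" "B \<in> sets borel" "B1 \<in> sets borel" "B2 \<in> sets borel" "B3 \<in> sets borel"
              "bounded B1" "bounded B2" "bounded B3" for B B1 B2 B3 :: "(real \<times> real) set"
          proof -
            have "measure lborel B \<le> measure lborel (B1 \<union> B2 \<union> B3)"
              using that by (intro measure_mono_fmeasurable bounded_borel_fmeasurable) auto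
            also have "\<dots> \<le> measure lborel (B1 \<union> B2) + measure lborel B3"
              using that by (intro measure_Un_le) auto
            also have "measure lborel (B1 \<union> B2) \<le> measure lborel B1 + measure lborel B2"
              using that by (intro measure_Un_le) auto
            finally show ?thesis by simp
          qed
          have bCC: "bounded (C a \<union> C b)" using bdd by simp
          have bLL: "bounded (ball (p a) \<rho> \<inter> ball (p b) \<rho>)" by (simp add: bounded_Int)
          \<comment> \<open>A disc is covered by its part in \<open>P a b - Q a b\<close>, the lens
            and the two cells. For \<open>A\<close> below, the lens is replaced by
            \<open>P a b \<inter> Q a b\<close>.\<close>
          have m1: "S \<le> measure lborel (P a b - Q a b)"
          proof -
            have "measure lborel (ball (p a) \<rho>)
                \<le> measure lborel (P a b - Q a b) + measure lborel (ball (p a) \<rho> \<inter> ball (p b) \<rho>) + measure lborel (C a \<union> C b)"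
              using bdd'[of a b] bCC bLL by (intro sub3) (auto simp: P_def Q_def)
            then show ?thesis
              using L cells disc[of "p a"] by (simp add: S_def A_def j_def left_diff_distrib)
          qed
          have m2: "S \<le> measure lborel (Q a b - P a b)"
          proof -
            have "measure lborel (ball (p b) \<rho>)
                \<le> measure lborel (Q a b - P a b) + measure lborel (ball (p a) \<rho> \<inter> ball (p b) \<rho>) + measure lborel (C a \<union> C b)"
              using bdd'[of a b] bCC bLL by (intro sub3) (auto simp: P_def Q_def)
            then show ?thesis
              using L cells disc[of "p b"] by (simp add: S_def A_def j_def left_diff_distrib)
          qed
          have m13: "A \<le> measure lborel (P a b - Q a b) + measure lborel (P a b \<inter> Q a b)"
          proof -
            have "measure lborel (ball (p a) \<rho>)
                \<le> measure lborel (P a b - Q a b) + measure lborel (P a b \<inter> Q a b) + measure lborel (C a \<union> C b)"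
              using bdd'[of a b] bCC bLL by (intro sub3) (auto simp: P_def Q_def)
            then show ?thesis
              using cells disc[of "p a"] by (simp add: S_def A_def j_def left_diff_distrib)
          qed
          have m23: "A \<le> measure lborel (Q a b - P a b) + measure lborel (P a b \<inter> Q a b)"
          proof -
            have "measure lborel (ball (p b) \<rho>)
                \<le> measure lborel (Q a b - P a b) + measure lborel (P a b \<inter> Q a b) + measure lborel (C a \<union> C b)"
              using bdd'[of a b] bCC bLL by (intro sub3) (auto simp: P_def Q_def)
            then show ?thesis
              using cells disc[of "p b"] by (simp add: S_def A_def j_def left_diff_distrib)
          qed
          \<comment> \<open>The smaller mark is charged with its own crescent, of area at least S;
            the larger mark with its crescent and the common part together, of area at least
            A.\<close>
          have "min u w * S + max u w * A \<le> measure lborel (P a b - Q a b) * u + measure lborel (Q a b - P a b) * w +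
              measure lborel (P a b \<inter> Q a b) * max u w"
          proof (cases "u \<le> w")
            case True
            have "u * S \<le> u * measure lborel (P a b - Q a b)"
              using m1 \<open>u \<in> {0..1} \<and> w \<in> {0..1}\<close> by (intro mult_left_mono) auto
            moreover have "w * A \<le> w * (measure lborel (Q a b - P a b) + measure lborel (P a b \<inter> Q a b))"
              using m23 \<open>u \<in> {0..1} \<and> w \<in> {0..1}\<close> by (intro mult_left_mono) auto
            ultimately show ?thesis
              using True by (simp add: min_absorb1 max_absorb2 algebra_simps)
          next
            case False
            have "w * S \<le> w * measure lborel (Q a b - P a b)"
              using m2 \<open>u \<in> {0..1} \<and> w \<in> {0..1}\<close> by (intro mult_left_mono) auto
            moreover have "u * A \<le> u * (measure lborel (P a b - Q a b) + measure lborel (P a b \<inter> Q a b))"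
              using m13 \<open>u \<in> {0..1} \<and> w \<in> {0..1}\<close> by (intro mult_left_mono) auto
            ultimately show ?thesis
              using False by (simp add: min_absorb2 max_absorb1 algebra_simps)
          qed
          then have "lp * (min u w * S + max u w * A) \<le> x"
            using lp_pos by (simp add: x_def)
          then show ?thesis
            by (intro mult_left_mono ennreal_leI) simp_all
        qed simp
        finally show ?thesis using True by simp
      qed (auto simp: W_def)
    qed
    also have "\<dots> = ennreal (lp\<^sup>2) * ?I * (\<integral>\<^sup>+u\<in>{0..1}. (\<integral>\<^sup>+w\<in>{0..1}. ?e u w \<partial>lborel) \<partial>lborel)"
      by (simp add: nn_integral_cmult nn_integral_multc)
    also have "\<dots> \<le> ennreal (lp\<^sup>2) * ?I * ennreal (2 * A / (A + S) * ((1 - exp (- (lp * A))) / (lp * A))\<^sup>2)"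
      by (intro mult_left_mono nn_integral_exp_min_max_le lp_pos S \<open>S \<le> A\<close>) simp
    also have "\<dots> = ennreal (lp\<^sup>2 * (2 * A / (A + S) * ((1 - exp (- (lp * A))) / (lp * A))\<^sup>2)) * ?I"
      unfolding ennreal_mult'[OF zero_le_power2[of lp]] by (simp only: mult.assoc mult.commute mult.left_commute)
    finally show ?thesis .
  qed
  have "pair_sum G = (\<integral>\<^sup>+\<omega>. \<integral>\<^sup>+n. \<integral>\<^sup>+m. indicator unit_square (X n \<omega>) * of_bool (m \<noteq> n) * G (X m \<omega> - X n \<omega>) *
      emeasure M {\<omega>' \<in> space M. ret \<omega> \<omega>' n \<and> ret \<omega> \<omega>' m} \<partial>count_space UNIV \<partial>count_space UNIV \<partial>M)"
    by (rule pair_sum_retention) simp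
  also have "\<dots> \<le> (\<integral>\<^sup>+\<omega>. \<integral>\<^sup>+(a, b). ?T a b \<omega> * (\<integral>\<^sup>+u. \<integral>\<^sup>+w. W a b \<omega> u w \<partial>lborel \<partial>lborel) \<partial>count_space ?D \<partial>M)"
    by (rule nn_integral_mono_AE, use AE_good in eventually_elim) (use pointwise in blast)
  also have "\<dots> = (\<integral>\<^sup>+(a, b). (\<integral>\<^sup>+\<omega>. ?T a b \<omega> * (\<integral>\<^sup>+u. \<integral>\<^sup>+w. W a b \<omega> u w \<partial>lborel \<partial>lborel) \<partial>M) \<partial>count_space ?D)"
    unfolding split_beta by (rule nn_integral_count_space_nn_integral) simp_all
  also have "\<dots> \<le> (\<integral>\<^sup>+(a, b). ennreal (lp\<^sup>2 * (2 * A / (A + S) * ((1 - exp (- (lp * A))) / (lp * A))\<^sup>2)) *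
        (\<integral>\<^sup>+x. \<integral>\<^sup>+y. indicator (C a) x * indicator (C b) y * ?F x y \<partial>lborel \<partial>lborel) \<partial>count_space ?D)"
    using expect by (intro nn_integral_mono) auto
  also have "\<dots> = ennreal (lp\<^sup>2 * (2 * A / (A + S) * ((1 - exp (- (lp * A))) / (lp * A))\<^sup>2)) *
        (\<integral>\<^sup>+(a, b). (\<integral>\<^sup>+x. \<integral>\<^sup>+y. indicator (C a) x * indicator (C b) y * ?F x y \<partial>lborel \<partial>lborel) \<partial>count_space ?D)"
    unfolding split_beta by (rule nn_integral_cmult) simp
  also have "\<dots> \<le> ennreal (lp\<^sup>2 * (2 * A / (A + S) * ((1 - exp (- (lp * A))) / (lp * A))\<^sup>2)) * (\<integral>\<^sup>+z. G z \<partial>lborel)"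
  proof (rule mult_left_mono)
    let ?t = "\<lambda>a b x y. indicator (C a) x * indicator (C b) y * ?F x y"
    have [measurable]: "(\<lambda>q. ?t a b (fst q) (snd q)) \<in> borel_measurable (lborel \<Otimes>\<^sub>M lborel)" for a b
      by measurable
    have [measurable]: "(\<lambda>x. \<integral>\<^sup>+y. ?t a b x y \<partial>lborel) \<in> borel_measurable lborel" for a b
      by (rule lborel.borel_measurable_nn_integral) (simp add: split_beta)
    have "(\<integral>\<^sup>+(a, b). (\<integral>\<^sup>+x. \<integral>\<^sup>+y. ?t a b x y \<partial>lborel \<partial>lborel) \<partial>count_space ?D)
        = (\<integral>\<^sup>+x. \<integral>\<^sup>+(a, b). (\<integral>\<^sup>+y. ?t a b x y \<partial>lborel) \<partial>count_space ?D \<partial>lborel)"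
      unfolding split_beta by (rule nn_integral_count_space_nn_integral[symmetric]) simp_all
    also have "\<dots> = (\<integral>\<^sup>+x. \<integral>\<^sup>+y. \<integral>\<^sup>+(a, b). ?t a b x y \<partial>count_space ?D \<partial>lborel \<partial>lborel)"
      unfolding split_beta by (intro nn_integral_cong nn_integral_count_space_nn_integral[symmetric]) simp_all
    also have "\<dots> \<le> (\<integral>\<^sup>+x. \<integral>\<^sup>+y. ?F x y \<partial>lborel \<partial>lborel)"
    proof (intro nn_integral_mono)
      fix x y :: "real \<times> real"
      let ?c = "((\<lfloor>j * fst x\<rfloor>, \<lfloor>j * snd x\<rfloor>), (\<lfloor>j * fst y\<rfloor>, \<lfloor>j * snd y\<rfloor>))"
      \<comment> \<open>Each pair of points lies in exactly one pair of cells, so the sum over cells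
        has at most one nonzero term, and none if the two cells coincide.\<close>
      have t: "?t a b x y \<le> ?F x y * indicator {?c} (a, b)" for a b
      proof (cases "x \<in> C a \<and> y \<in> C b")
        case True
        then have "(a, b) = ?c"
          unfolding C_def using grid_cell_unique by blast
        then show ?thesis using True by simp
      qed auto
      have "(\<integral>\<^sup>+(a, b). ?t a b x y \<partial>count_space ?D) \<le> (\<integral>\<^sup>+q. ?F x y * indicator {?c} q \<partial>count_space ?D)"
      proof (rule nn_integral_mono)
        fix q
        show "(case q of (a, b) \<Rightarrow> ?t a b x y) \<le> ?F x y * indicator {?c} q"
          using t by (cases q) (simp only: prod.case)
      qed
      also have "\<dots> = ?F x y * (\<integral>\<^sup>+q. indicator {?c} q \<partial>count_space ?D)"
        by (rule nn_integral_cmult) simp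
      also have "(\<integral>\<^sup>+q. indicator {?c} q \<partial>count_space ?D) = (\<integral>\<^sup>+q. indicator {?c} q * indicator ?D q \<partial>count_space UNIV)"
        by (rule nn_integral_count_space_indicator) simp
      also have "\<dots> \<le> (\<integral>\<^sup>+q. indicator {?c} q \<partial>count_space UNIV)"
        by (intro nn_integral_mono) (simp add: indicator_def)
      also have "\<dots> = emeasure (count_space UNIV) {?c}"
        by (rule nn_integral_indicator) simp
      also have "\<dots> = 1" by simp
      finally show "(\<integral>\<^sup>+(a, b). ?t a b x y \<partial>count_space ?D) \<le> ?F x y"
        by (simp add: mult_left_mono)
    qed
    also have "\<dots> = (\<integral>\<^sup>+x. indicator unit_square x * (\<integral>\<^sup>+z. G z \<partial>lborel) \<partial>lborel)"
    proof (rule nn_integral_cong)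
      fix x :: "real \<times> real"
      have "(\<integral>\<^sup>+z. G z \<partial>lborel) = (\<integral>\<^sup>+z. G z \<partial>distr lborel borel ((+) (- x)))"
        by (simp add: lborel_distr_plus)
      also have "\<dots> = (\<integral>\<^sup>+y. G (y - x) \<partial>lborel)"
        by (subst nn_integral_distr) simp_all
      finally show "(\<integral>\<^sup>+y. ?F x y \<partial>lborel) = indicator unit_square x * (\<integral>\<^sup>+z. G z \<partial>lborel)"
        by (subst nn_integral_cmult) simp_all
    qed
    also have "\<dots> = emeasure lborel unit_square * (\<integral>\<^sup>+z. G z \<partial>lborel)"
      by (subst nn_integral_multc) simp_all
    also have "emeasure lborel unit_square = 1"
      unfolding lborel_prod[symmetric] by (subst lborel.emeasure_pair_measure_Times) simp_all
    finally show "(\<integral>\<^sup>+(a, b). (\<integral>\<^sup>+x. \<integral>\<^sup>+y. ?t a b x y \<partial>lborel \<partial>lborel) \<partial>count_space ?D) \<le> (\<integral>\<^sup>+z. G z \<partial>lborel)"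
      by simp
  qed simp
  finally show ?thesis .
qed


section \<open>The limit of fine grids\<close>

text \<open>The closed form of the intensity \<lambda>, that is lp times the one-point retention
  probability. It serves as a lower bound for \<open>intensity\<close> and, squared, as a factor of
  the pair bound.\<close>

definition intensity_formula :: real where
  "intensity_formula = (1 - exp (- (lp * (pi * \<delta>\<^sup>2)))) / (pi * \<delta>\<^sup>2)"

lemma intensity_formula_pos: "intensity_formula > 0"
  using lp_pos delta_pos by (simp add: intensity_formula_def)

lemma intensity_ge: "ennreal intensity_formula \<le> intensity M (matern_II_points \<delta> X U H)"
proof (rule LIMSEQ_le_const2)
  define A where "A k = pi * (\<delta> + 2 / real k)\<^sup>2" for k
  have "A \<longlonglongrightarrow> pi * (\<delta> + 0)\<^sup>2"
    unfolding A_def by (intro tendsto_intros tendsto_divide_0[OF tendsto_const] filterlim_at_top_imp_at_infinity filterlim_real_sequentially)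
  moreover have "(\<lambda>k. lp / (real k)\<^sup>2) \<longlonglongrightarrow> 0"
    by (intro tendsto_divide_0[OF tendsto_const] filterlim_at_top_imp_at_infinity
        filterlim_pow_at_top filterlim_real_sequentially) simp
  ultimately have "(\<lambda>k. ennreal (exp (- (lp / (real k)\<^sup>2)) * ((1 - exp (- (lp * A k))) / A k)))
      \<longlonglongrightarrow> ennreal (exp (- 0) * ((1 - exp (- (lp * (pi * (\<delta> + 0)\<^sup>2)))) / (pi * (\<delta> + 0)\<^sup>2)))"
    using delta_pos by (intro tendsto_intros tendsto_ennrealI) auto
  then show "(\<lambda>k. ennreal (exp (- (lp / (real k)\<^sup>2)) * ((1 - exp (- (lp * A k))) / A k))) \<longlonglongrightarrow> ennreal intensity_formula"
    by (simp add: intensity_formula_def)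
  show "\<exists>N. \<forall>k\<ge>N. ennreal (exp (- (lp / (real k)\<^sup>2)) * ((1 - exp (- (lp * A k))) / A k)) \<le> intensity M (matern_II_points \<delta> X U H)"
    using intensity_ge_grid by (intro exI[of _ 1]) (auto simp: A_def)
qed

text \<open>If the lens has area at most l \<delta>^2, the union of the discs has area at least (2
  pi - l) \<delta>^2, and the constant is 2 A / V for this V. The pair s, l is 1 and the lens
  constant for all admissible distances, and 2 and 0 for disjoint discs. \<open>lens\<close> speaks
  of all radii because \<rho> varies with k.\<close>

lemma pair_sum_le:
  fixes G :: "real \<times> real \<Rightarrow> ennreal"
  assumes G: "G \<in> borel_measurable borel"
    and s: "1 \<le> s" and supp: "\<And>z. G z \<noteq> 0 \<Longrightarrow> s * \<delta> \<le> norm z"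
    and lens: "\<And>\<rho> (p :: real \<times> real) q. 0 < \<rho> \<Longrightarrow> s * \<rho> \<le> dist p q \<Longrightarrow>
        measure lborel (ball p \<rho> \<inter> ball q \<rho>) \<le> l * \<rho>\<^sup>2"
    and l: "0 \<le> l" "l < pi"
  shows "pair_sum G \<le> ennreal (2 * pi / (2 * pi - l) * intensity_formula\<^sup>2) * (\<integral>\<^sup>+z. G z \<partial>lborel)"
proof (rule LIMSEQ_le_const)
  define \<rho> A S where "\<rho> k = \<delta> - 4 / real k" and "A k = pi * (\<rho> k)\<^sup>2 - 2 / (real k)\<^sup>2"
    and "S k = (pi - l) * (\<rho> k)\<^sup>2 - 2 / (real k)\<^sup>2" for k
  define c where "c k = lp\<^sup>2 * (2 * A k / (A k + S k) * ((1 - exp (- (lp * A k))) / (lp * A k))\<^sup>2)" for k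
  have 4: "(\<lambda>k. 4 / real k) \<longlonglongrightarrow> 0"
    by (intro tendsto_divide_0[OF tendsto_const] filterlim_at_top_imp_at_infinity filterlim_real_sequentially)
  have 2: "(\<lambda>k. 2 / (real k)\<^sup>2) \<longlonglongrightarrow> 0"
    by (intro tendsto_divide_0[OF tendsto_const] filterlim_at_top_imp_at_infinity
        filterlim_pow_at_top filterlim_real_sequentially) simp
  have "A \<longlonglongrightarrow> pi * (\<delta> - 0)\<^sup>2 - 0"
    unfolding A_def \<rho>_def by (intro tendsto_intros 2 4)
  then have A: "A \<longlonglongrightarrow> pi * \<delta>\<^sup>2" by simp
  have "S \<longlonglongrightarrow> (pi - l) * (\<delta> - 0)\<^sup>2 - 0"
    unfolding S_def \<rho>_def by (intro tendsto_intros 2 4)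
  then have S: "S \<longlonglongrightarrow> (pi - l) * \<delta>\<^sup>2" by simp
  have A0: "pi * \<delta>\<^sup>2 > 0" and S0: "(pi - l) * \<delta>\<^sup>2 > 0"
    using delta_pos l by simp_all
  have "c \<longlonglongrightarrow> lp\<^sup>2 * (2 * (pi * \<delta>\<^sup>2) / (pi * \<delta>\<^sup>2 + (pi - l) * \<delta>\<^sup>2) *
      ((1 - exp (- (lp * (pi * \<delta>\<^sup>2)))) / (lp * (pi * \<delta>\<^sup>2)))\<^sup>2)"
    unfolding c_def using A0 S0 lp_pos by (intro tendsto_intros A S) auto
  also have "lp\<^sup>2 * (2 * (pi * \<delta>\<^sup>2) / (pi * \<delta>\<^sup>2 + (pi - l) * \<delta>\<^sup>2) *
      ((1 - exp (- (lp * (pi * \<delta>\<^sup>2)))) / (lp * (pi * \<delta>\<^sup>2)))\<^sup>2) = 2 * pi / (2 * pi - l) * intensity_formula\<^sup>2"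
  proof -
    have "2 * (pi * \<delta>\<^sup>2) / (pi * \<delta>\<^sup>2 + (pi - l) * \<delta>\<^sup>2) = ((2 * pi) * \<delta>\<^sup>2) / ((2 * pi - l) * \<delta>\<^sup>2)"
      by (simp add: algebra_simps)
    also have "\<dots> = 2 * pi / (2 * pi - l)"
      using delta_pos by (subst mult_divide_mult_cancel_right) auto
    finally show ?thesis
      using lp_pos by (simp add: intensity_formula_def power_mult_distrib power_divide)
  qed
  finally have c: "c \<longlonglongrightarrow> 2 * pi / (2 * pi - l) * intensity_formula\<^sup>2" .
  \<comment> \<open>The integral of G may be infinite, and multiplication is not continuous at 0
    times infinity; a positive limit of the constants avoids that case.\<close>
  have "2 * pi / (2 * pi - l) * intensity_formula\<^sup>2 > 0"
    using l intensity_formula_pos pi_gt_zero by (intro mult_pos_pos divide_pos_pos) auto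
  then show "(\<lambda>k. ennreal (c k) * (\<integral>\<^sup>+z. G z \<partial>lborel)) \<longlonglongrightarrow>
      ennreal (2 * pi / (2 * pi - l) * intensity_formula\<^sup>2) * (\<integral>\<^sup>+z. G z \<partial>lborel)"
    by (intro tendsto_mult_ennreal tendsto_ennrealI c tendsto_const) (simp_all add: ennreal_eq_0_iff)
  \<comment> \<open>By \<open>l < pi\<close> the limit of S is positive, so the grid bound is
    available for all large k.\<close>
  have "\<forall>\<^sub>F k in sequentially. pair_sum G \<le> ennreal (c k) * (\<integral>\<^sup>+z. G z \<partial>lborel)"
    using order_tendstoD(1)[OF S S0] order_tendstoD(2)[OF 4 delta_pos] eventually_gt_at_top[of 0]
  proof eventually_elim
    case (elim k)
    then show ?case
      unfolding c_def A_def S_def \<rho>_def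
      by (intro pair_sum_le_grid[OF G s supp lens l(1)]) auto
  qed
  then show "\<exists>N. \<forall>k\<ge>N. pair_sum G \<le> ennreal (c k) * (\<integral>\<^sup>+z. G z \<partial>lborel)"
    by (simp add: eventually_sequentially)
qed

lemma pair_sum_le_nu:
  fixes G :: "real \<times> real \<Rightarrow> ennreal"
  assumes "G \<in> borel_measurable borel" "\<And>z. G z \<noteq> 0 \<Longrightarrow> \<delta> \<le> norm z"
  shows "pair_sum G \<le> ennreal (nu * intensity_formula\<^sup>2) * (\<integral>\<^sup>+z. G z \<partial>lborel)"
proof -
  define l where "l = 2 * pi / 3 - sqrt 3 / 2"
  have "sqrt 3 \<le> (2 :: real)" by (intro real_le_lsqrt) auto
  then have l: "0 \<le> l" "l < pi"
    using pi_gt3 real_sqrt_ge_zero[of 3] unfolding l_def by linarith+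
  \<comment> \<open>2 pi - l = (8 pi + 3 sqrt 3) / 6.\<close>
  have "2 * pi / (2 * pi - l) = nu"
    by (simp add: l_def nu_def divide_simps)
  moreover have "pair_sum G \<le> ennreal (2 * pi / (2 * pi - l) * intensity_formula\<^sup>2) * (\<integral>\<^sup>+z. G z \<partial>lborel)"
  proof (rule pair_sum_le[where s = 1, OF assms(1)])
    fix \<rho> :: real and p q :: "real \<times> real" assume "0 < \<rho>" "1 * \<rho> \<le> dist p q"
    then have "emeasure lborel (ball p \<rho> \<inter> ball q \<rho>) \<le> ennreal (l * \<rho>\<^sup>2)"
      unfolding l_def by (intro emeasure_lens_le) auto
    then show "measure lborel (ball p \<rho> \<inter> ball q \<rho>) \<le> l * \<rho>\<^sup>2"
      unfolding measure_def using l(1) by (intro enn2real_leI) auto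
  qed (use assms l in auto)
  ultimately show ?thesis by simp
qed

lemma pair_sum_le_far:
  fixes G :: "real \<times> real \<Rightarrow> ennreal"
  assumes "G \<in> borel_measurable borel" "\<And>z. G z \<noteq> 0 \<Longrightarrow> 2 * \<delta> \<le> norm z"
  shows "pair_sum G \<le> ennreal (intensity_formula\<^sup>2) * (\<integral>\<^sup>+z. G z \<partial>lborel)"
proof -
  have "pair_sum G \<le> ennreal (2 * pi / (2 * pi - 0) * intensity_formula\<^sup>2) * (\<integral>\<^sup>+z. G z \<partial>lborel)"
  proof (rule pair_sum_le[where s = 2, OF assms(1)])
    fix \<rho> :: real and p q :: "real \<times> real" assume "2 * \<rho> \<le> dist p q"
    \<comment> \<open>The balls are open, hence disjoint also at distance exactly 2 \<rho>.\<close>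
    then have "ball p \<rho> \<inter> ball q \<rho> = {}"
      by (intro disjoint_ballI) simp
    then show "measure lborel (ball p \<rho> \<inter> ball q \<rho>) \<le> 0 * \<rho>\<^sup>2" by simp
  qed (use assms in auto)
  then show ?thesis by simp
qed

section \<open>Bounds for the excess interference ratio\<close>

text \<open>The numerator is \<open>pair_sum\<close> divided by the intensity, and the Poisson mean
  carries the intensity once more. Replacing both by the smaller \<open>intensity_formula\<close>
  only increases the quotient, and its square then cancels.\<close>

lemma EIR_le:
  assumes g: "(\<lambda>z :: real \<times> real. g (norm z)) \<in> borel_measurable borel" "\<And>r. r \<ge> 0 \<Longrightarrow> g r \<ge> 0"
    and c: "0 \<le> c"
    and le: "pair_sum (\<lambda>z. ennreal (g (norm z))) \<le>
      ennreal (c * intensity_formula\<^sup>2) * (ennreal (2 * pi) * (\<integral>\<^sup>+r\<in>{\<delta>..}. ennreal (g r * r) \<partial>lborel))"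
  shows "EIR M (matern_II_points \<delta> X U H) \<delta> g \<le> ennreal c"
proof -
  define P where "P = pair_sum (\<lambda>z. ennreal (g (norm z)))"
  define R where "R = (\<integral>\<^sup>+r\<in>{\<delta>..}. ennreal (g r * r) \<partial>lborel)"
  define i where "i = intensity M (matern_II_points \<delta> X U H)"
  let ?i = "ennreal intensity_formula"
  have "EIR M (matern_II_points \<delta> X U H) \<delta> g = P * inverse i * inverse (ennreal (2 * pi) * i * R)"
    by (simp add: EIR_def reduced_palm_expectation_def mean_interference_ppp_def
        nn_integral_palm_sum[OF g] P_def i_def R_def divide_ennreal_def)
  also have "\<dots> \<le> P * inverse ?i * inverse (ennreal (2 * pi) * ?i * R)"
    using intensity_ge by (intro mult_mono ennreal_inverse_antimono mult_right_mono mult_left_mono) (auto simp: i_def)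
  also have "\<dots> \<le> ennreal c"
  \<comment> \<open>Degenerate quotients: R = 0 forces P = 0 by \<open>le\<close>, and for R = top
    the reciprocal is 0. Either way the product is 0, as 0 times top is 0.\<close>
  proof (cases "R = 0 \<or> R = top")
    case True
    then show ?thesis
      using le intensity_formula_pos by (auto simp: P_def R_def[symmetric] ennreal_mult_top ennreal_eq_0_iff)
  next
    case False
    then obtain r where r: "R = ennreal r" "r > 0"
      by (cases R rule: ennreal_cases) (auto simp: less_le)
    have "P \<le> ennreal (c * intensity_formula\<^sup>2 * (2 * pi * r))"
      using le c r by (simp add: P_def R_def[symmetric] ennreal_mult'[symmetric] ennreal_mult[symmetric])
    then have "P * inverse ?i * inverse (ennreal (2 * pi) * ?i * R)
        \<le> ennreal (c * intensity_formula\<^sup>2 * (2 * pi * r)) * ennreal (1 / intensity_formula) * ennreal (1 / (2 * pi * intensity_formula * r))"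
      using intensity_formula_pos r
      by (intro mult_mono) (auto simp: inverse_ennreal ennreal_mult[symmetric] inverse_eq_divide)
    also have "\<dots> = ennreal c"
      using intensity_formula_pos r c by (simp add: ennreal_mult[symmetric] power2_eq_square)
    finally show ?thesis .
  qed
  finally show ?thesis .
qed

lemma nn_integral_radial_tail:
  fixes g :: "real \<Rightarrow> real"
  assumes [measurable]: "g \<in> borel_measurable borel" "B \<in> sets borel" and B: "B \<subseteq> {0..}"
  shows "(\<integral>\<^sup>+z. ennreal (g (norm (z :: real \<times> real))) * indicator B (norm z) \<partial>lborel) =
    ennreal (2 * pi) * (\<integral>\<^sup>+r\<in>B. ennreal (g r * r) \<partial>lborel)"
proof -
  have "(\<integral>\<^sup>+z. ennreal (g (norm (z :: real \<times> real))) * indicator B (norm z) \<partial>lborel)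
      = (\<integral>\<^sup>+r\<in>{0..}. ennreal (2 * pi * r) * (ennreal (g r) * indicator B r) \<partial>lborel)"
    by (rule nn_integral_radial) simp
  also have "\<dots> = (\<integral>\<^sup>+r. ennreal (2 * pi) * (ennreal (g r * r) * indicator B r) \<partial>lborel)"
    using B by (intro nn_integral_cong) (auto simp: ennreal_mult' ennreal_mult'' mult_ac split: split_indicator)
  also have "\<dots> = ennreal (2 * pi) * (\<integral>\<^sup>+r\<in>B. ennreal (g r * r) \<partial>lborel)"
    by (rule nn_integral_cmult) simp
  finally show ?thesis .
qed

lemma EIR_le_nu:
  assumes g: "g \<in> borel_measurable (restrict_space borel {0..})" "\<And>r. r \<ge> 0 \<Longrightarrow> g r \<ge> 0"
  shows "EIR M (matern_II_points \<delta> X U H) \<delta> g \<le> ennreal nu"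
proof -
  \<comment> \<open>Measurability of g is given on the half-line only; extension by 0 to negative
    radii makes it Borel measurable and leaves g (norm z) unchanged.\<close>
  define h where "h r = indicator {0..} r *\<^sub>R g r" for r
  have h [measurable]: "h \<in> borel_measurable borel"
    using g(1) unfolding h_def by (subst (asm) borel_measurable_restrict_space_iff) auto
  have gh: "g (norm z) = h (norm z)" for z :: "real \<times> real"
    by (simp add: h_def)
  let ?G = "\<lambda>z :: real \<times> real. ennreal (h (norm z)) * indicator {\<delta>..} (norm z)"
  have "pair_sum (\<lambda>z. ennreal (g (norm z))) = pair_sum ?G"
    unfolding gh by (subst pair_sum_hard_core) (simp_all add: indicator_def)
  also have "\<dots> \<le> ennreal (nu * intensity_formula\<^sup>2) * (\<integral>\<^sup>+z. ?G z \<partial>lborel)"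
    by (rule pair_sum_le_nu) (auto simp: indicator_def split: if_splits)
  also have "(\<integral>\<^sup>+z. ?G z \<partial>lborel) = ennreal (2 * pi) * (\<integral>\<^sup>+r\<in>{\<delta>..}. ennreal (h r * r) \<partial>lborel)"
    using delta_pos by (intro nn_integral_radial_tail) auto
  also have "(\<integral>\<^sup>+r\<in>{\<delta>..}. ennreal (h r * r) \<partial>lborel) = (\<integral>\<^sup>+r\<in>{\<delta>..}. ennreal (g r * r) \<partial>lborel)"
    using delta_pos by (intro nn_integral_cong) (auto simp: h_def split: split_indicator)
  finally show ?thesis
    using nu_ge_1 g(2) by (intro EIR_le) (simp_all add: gh)
qed

lemma power_law_tail:
  assumes \<alpha>: "\<alpha> > 2" "0 \<le> r0" "r0 \<le> a" "a > 0"
  shows "(\<integral>\<^sup>+r\<in>{a..}. ennreal (max r0 r powr (- \<alpha>) * r) \<partial>lborel) = ennreal (a powr (2 - \<alpha>) / (\<alpha> - 2))"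
proof -
  have "(\<integral>\<^sup>+r\<in>{a..}. ennreal (max r0 r powr (- \<alpha>) * r) \<partial>lborel) = ennreal (0 - - (a powr (2 - \<alpha>) / (\<alpha> - 2)))"
  proof (rule nn_integral_FTC_atLeast)
    fix r assume "a \<le> r"
    then have "r > 0" "max r0 r = r" using assms by auto
    have "((\<lambda>r. - (r powr (2 - \<alpha>) / (\<alpha> - 2))) has_real_derivative - ((2 - \<alpha>) * r powr (2 - \<alpha> - 1) / (\<alpha> - 2))) (at r)"
      using \<open>r > 0\<close> \<alpha> by (auto intro!: derivative_eq_intros has_real_derivative_powr)
    also have "- ((2 - \<alpha>) * r powr (2 - \<alpha> - 1) / (\<alpha> - 2)) = r powr (1 - \<alpha>)"
      using assms(1) by (simp add: divide_simps) (simp add: algebra_simps)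
    also have "\<dots> = max r0 r powr (- \<alpha>) * r"
      using \<open>r > 0\<close> \<open>max r0 r = r\<close> powr_add[of r "- \<alpha>" 1] by simp
    finally show "((\<lambda>r. - (r powr (2 - \<alpha>) / (\<alpha> - 2))) has_real_derivative max r0 r powr (- \<alpha>) * r) (at r)" .
    show "0 \<le> max r0 r powr (- \<alpha>) * r" using \<open>r > 0\<close> by simp
  next
    have "((\<lambda>r. r powr (2 - \<alpha>)) \<longlongrightarrow> 0) at_top"
      using assms(1) by (intro tendsto_neg_powr filterlim_ident) auto
    then have "((\<lambda>r. - (r powr (2 - \<alpha>) / (\<alpha> - 2))) \<longlongrightarrow> - (0 / (\<alpha> - 2))) at_top"
      using assms(1) by (intro tendsto_intros) auto
    then show "((\<lambda>r. - (r powr (2 - \<alpha>) / (\<alpha> - 2))) \<longlongrightarrow> 0) at_top" by simp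
  qed simp
  then show ?thesis by simp
qed

text \<open>Let q = 1 / 2 powr (\<alpha> - 2), the share of the tail integral beyond 2 \<delta>. The
  factor nu applies to the share 1 - q and the factor 1 to the share q, and nu (1 - q) + q = nu -
  (nu - 1) q. By r0 \<le> \<delta> the law is a pure power from \<delta> on, so the share can be
  computed.\<close>

lemma EIR_power_law_le:
  assumes \<alpha>: "\<alpha> > 2" and r0: "0 \<le> r0" "r0 \<le> \<delta>"
  shows "EIR M (matern_II_points \<delta> X U H) \<delta> (\<lambda>r. max r0 r powr (- \<alpha>)) \<le> ennreal (nu - (nu - 1) / 2 powr (\<alpha> - 2))"
proof -
  let ?g = "\<lambda>r. max r0 r powr (- \<alpha>)"
  let ?c = "nu - (nu - 1) / 2 powr (\<alpha> - 2)"
  define T where "T B = (\<integral>\<^sup>+r\<in>B. ennreal (?g r * r) \<partial>lborel)" for B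
  define r where "r = \<delta> powr (2 - \<alpha>) / (\<alpha> - 2)"
  have "r \<ge> 0" using \<alpha> by (simp add: r_def)
  have c: "0 \<le> ?c"
  proof -
    have "1 \<le> 2 powr (\<alpha> - 2)" using \<alpha> by (intro ge_one_powr_ge_zero) auto
    then have "(nu - 1) / 2 powr (\<alpha> - 2) \<le> (nu - 1) / 1"
      using nu_ge_1 by (intro divide_left_mono) auto
    then show ?thesis by simp
  qed
  have R: "T {\<delta>..} = ennreal r"
    unfolding T_def r_def using \<alpha> r0 delta_pos by (intro power_law_tail) auto
  have "T {2 * \<delta>..} = ennreal ((2 * \<delta>) powr (2 - \<alpha>) / (\<alpha> - 2))"
    unfolding T_def using \<alpha> r0 delta_pos by (intro power_law_tail) auto
  also have "(2 * \<delta>) powr (2 - \<alpha>) / (\<alpha> - 2) = r / 2 powr (\<alpha> - 2)"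
    using powr_minus_divide[of 2 "\<alpha> - 2"] delta_pos by (simp add: r_def powr_mult)
  finally have R2: "T {2 * \<delta>..} = ennreal (r / 2 powr (\<alpha> - 2))" .
  have sum: "T {\<delta>..<2 * \<delta>} + T {2 * \<delta>..} = T {\<delta>..}"
    unfolding T_def using delta_pos
    by (subst nn_integral_add[symmetric]) (auto intro!: nn_integral_cong split: split_indicator)
  then obtain r1 where r1: "T {\<delta>..<2 * \<delta>} = ennreal r1" "r1 \<ge> 0"
    unfolding R by (cases "T {\<delta>..<2 * \<delta>}" rule: ennreal_cases) auto
  have "r1 + r / 2 powr (\<alpha> - 2) = r"
    using sum r1 \<open>r \<ge> 0\<close> unfolding R R2 by (simp add: ennreal_plus[symmetric] del: ennreal_plus)
  have G: "(\<integral>\<^sup>+z. ennreal (?g (norm (z :: real \<times> real))) * indicator B (norm z) \<partial>lborel) = ennreal (2 * pi) * T B"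
    if "B \<in> sets borel" "B \<subseteq> {0..}" for B
    unfolding T_def using that by (intro nn_integral_radial_tail) auto
  let ?G = "\<lambda>B z. ennreal (?g (norm (z :: real \<times> real))) * indicator B (norm z)"
  have "pair_sum (\<lambda>z. ennreal (?g (norm z))) = pair_sum (\<lambda>z. ?G {\<delta>..<2 * \<delta>} z + ?G {2 * \<delta>..} z)"
    using delta_pos
    by (subst pair_sum_hard_core) (auto intro!: arg_cong[where f = pair_sum] simp: indicator_def fun_eq_iff)
  also have "\<dots> = pair_sum (?G {\<delta>..<2 * \<delta>}) + pair_sum (?G {2 * \<delta>..})"
    by (rule pair_sum_add) simp_all
  also have "\<dots> \<le> ennreal (nu * intensity_formula\<^sup>2) * (ennreal (2 * pi) * T {\<delta>..<2 * \<delta>}) +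
      ennreal (intensity_formula\<^sup>2) * (ennreal (2 * pi) * T {2 * \<delta>..})"
  proof (rule add_mono)
    show "pair_sum (?G {\<delta>..<2 * \<delta>}) \<le> ennreal (nu * intensity_formula\<^sup>2) * (ennreal (2 * pi) * T {\<delta>..<2 * \<delta>})"
      using delta_pos by (subst G[symmetric], simp, force, intro pair_sum_le_nu)
        (auto simp: indicator_def split: if_splits)
    show "pair_sum (?G {2 * \<delta>..}) \<le> ennreal (intensity_formula\<^sup>2) * (ennreal (2 * pi) * T {2 * \<delta>..})"
      using delta_pos by (subst G[symmetric], simp, force, intro pair_sum_le_far)
        (auto simp: indicator_def split: if_splits)
  qed
  also have "\<dots> = ennreal (2 * pi * intensity_formula\<^sup>2 * (nu * r1 + r / 2 powr (\<alpha> - 2)))"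
    unfolding r1 R2 using nu_ge_1 r1(2) \<open>r \<ge> 0\<close>
    by (simp add: ennreal_mult[symmetric] ennreal_plus[symmetric] del: ennreal_plus) (simp add: algebra_simps)
  also have "nu * r1 + r / 2 powr (\<alpha> - 2) = ?c * r"
  proof -
    have "r1 = r - r / 2 powr (\<alpha> - 2)" using \<open>r1 + r / 2 powr (\<alpha> - 2) = r\<close> by simp
    then show ?thesis by (simp add: left_diff_distrib right_diff_distrib diff_divide_distrib)
  qed
  also have "ennreal (2 * pi * intensity_formula\<^sup>2 * (?c * r)) = ennreal (?c * intensity_formula\<^sup>2) * (ennreal (2 * pi) * T {\<delta>..})"
    unfolding R using c \<open>r \<ge> 0\<close> by (simp add: ennreal_mult'[symmetric] ennreal_mult[symmetric] mult_ac)
  finally show ?thesis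
    using c by (intro EIR_le) (simp_all add: T_def)
qed

end

theorem theorem2:
  "nu < 5 / 4 \<and> (5 / 4 :: real) < 10 powr (1 / 10) \<and>
   (\<forall>(M :: 'w measure) lp \<delta> X U H. matern_II M lp \<delta> X U H \<longrightarrow>
      (\<forall>g :: real \<Rightarrow> real.
         g \<in> borel_measurable (restrict_space borel {0..}) \<longrightarrow>
         (\<forall>r\<ge>0. g r \<ge> 0) \<longrightarrow>
         integrable lborel (\<lambda>x :: real \<times> real. g (norm x)) \<longrightarrow>
         (\<integral>\<^sup>+r\<in>{\<delta>..}. ennreal (g r * r) \<partial>lborel) > 0 \<longrightarrow>
         EIR M (matern_II_points \<delta> X U H) \<delta> g \<le> ennreal nu) \<and>
      (\<forall>\<alpha> r0 :: real. \<alpha> > 2 \<longrightarrow> 0 \<le> r0 \<longrightarrow> r0 \<le> \<delta> \<longrightarrow>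
         EIR M (matern_II_points \<delta> X U H) \<delta> (\<lambda>r. max r0 r powr (- \<alpha>))
           \<le> ennreal (nu - (nu - 1) / 2 powr (\<alpha> - 2))))"
proof (intro conjI allI impI)
  show "nu < 5 / 4" by (rule nu_less)
  show "(5 / 4 :: real) < 10 powr (1 / 10)" by (rule five_quarters_less)
  fix M :: "'w measure" and lp \<delta> X U H
  assume "matern_II M lp \<delta> X U H"
  then interpret matern_II M lp \<delta> X U H .
  show "EIR M (matern_II_points \<delta> X U H) \<delta> g \<le> ennreal nu"
    if "g \<in> borel_measurable (restrict_space borel {0..})" "\<forall>r\<ge>0. g r \<ge> 0" for g
    using that by (intro EIR_le_nu) auto
  show "EIR M (matern_II_points \<delta> X U H) \<delta> (\<lambda>r. max r0 r powr (- \<alpha>)) \<le> ennreal (nu - (nu - 1) / 2 powr (\<alpha> - 2))"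
    if "\<alpha> > 2" "0 \<le> r0" "r0 \<le> \<delta>" for \<alpha> r0
    using that by (rule EIR_power_law_le)
qed

end
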